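(* Let $\Gamma$ be a finitely generated virtually abelian group and let $\mu$ be a probability measure on $\Gamma$ with finite second moment such that the support of $\mu$ generates $\Gamma$ as a semigroup. Then $$\lim_{\rho\to1}\limsup_{n\to\infty}\left\|\pi^\rho_n-\mu_n\times\mu_n\right\|_{\mathrm{TV}}=0.$$ If moreover $\Gamma$ admits a nonzero homomorphism onto $\mathbb{Z}$, then $$\lim_{\rho\to0}\liminf_{n\to\infty}\left\|\pi^\rho_n-\mu_n\times\mu_n\right\|_{\mathrm{TV}}=1;$$ in particular, in this case the $\mu$-random walk on $\Gamma$ is not noise sensitive in total variation.
   Context: A group is virtually abelian if it has an abelian subgroup of finite index. For a probability measure $\mu$ on a countable group, $\mu_n:=\mu^{*n}$ is the $n$-fold convolution power. For $\rho\in[0,1]$, $\pi^\rho:=\rho(\mu\times\mu)+(1-\rho)\mu_{\mathrm{diag}}$ is the probability measure on $\Gamma\times\Gamma$, where $\mu\times\mu$ is the product measure and $\mu_{\mathrm{diag}}((\gamma,\gamma'))=\mu(\gamma)$ if $\gamma=\gamma'$ and $0$ otherwise; $\pi^\rho_n:=(\pi^\rho)^{*n}$ is the $n$-fold convolution power on $\Gamma\times\Gamma$. The total variation distance is $\|\nu_1-\nu_2\|_{\mathrm{TV}}=\max_A|\nu_1(A)-\nu_2(A)|=\tfrac12\|\nu_1-\nu_2\|_1$. The $\mu$-random walk is noise sensitive in total variation if $\lim_{n\to\infty}\|\pi^\rho_n-\mu_n\times\mu_n\|_{\mathrm{TV}}=0$ for each $\rho\in(0,1]$. The measure $\mu$ has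 finite second moment if $\sum_\gamma|\gamma|^2\mu(\gamma)<\infty$ for a (equivalently, any) word metric $|\cdot|$ associated with a finite generating set. *)

theory Defs
  imports "HOL-Algebra.Algebra" "HOL-Probability.Probability"
begin

subsection \<open>Groups\<close>

definition finite_generating_set :: "('a, 'b) monoid_scheme \<Rightarrow> 'a set \<Rightarrow> bool" where
  "finite_generating_set G S \<longleftrightarrow> finite S \<and> S \<subseteq> carrier G \<and> generate G S = carrier G"

definition finitely_generated :: "('a, 'b) monoid_scheme \<Rightarrow> bool" where
  "finitely_generated G \<longleftrightarrow> (\<exists>S. finite_generating_set G S)"

definition virtually_abelian :: "('a, 'b) monoid_scheme \<Rightarrow> bool" where
  "virtually_abelian G \<longleftrightarrow>
     (\<exists>H. subgroup H G \<and> comm_group (G\<lparr>carrier := H\<rparr>) \<and> finite (rcosets\<^bsub>G\<^esub> H))"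

inductive_set semigroup_generate :: "('a, 'b) monoid_scheme \<Rightarrow> 'a set \<Rightarrow> 'a set"
  for G (structure) and S where
  incl: "x \<in> S \<Longrightarrow> x \<in> semigroup_generate G S"
| mult: "x \<in> semigroup_generate G S \<Longrightarrow> y \<in> semigroup_generate G S \<Longrightarrow>
           x \<otimes> y \<in> semigroup_generate G S"

definition word_length :: "('a, 'b) monoid_scheme \<Rightarrow> 'a set \<Rightarrow> 'a \<Rightarrow> nat" where
  "word_length G S g =
     (LEAST n. \<exists>ws. length ws = n \<and> set ws \<subseteq> S \<union> m_inv G ` S \<and>
                    foldr (\<lambda>x y. x \<otimes>\<^bsub>G\<^esub> y) ws \<one>\<^bsub>G\<^esub> = g)"

subsection \<open>Random walks\<close>

text \<open>A probability measure on a countable group \<open>G\<close> is represented by a pmf whose support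
  lies in \<open>carrier G\<close>.\<close>

definition finite_second_moment :: "('a, 'b) monoid_scheme \<Rightarrow> 'a pmf \<Rightarrow> bool" where
  "finite_second_moment G \<mu> \<longleftrightarrow>
     (\<exists>S. finite_generating_set G S \<and>
          (\<lambda>g. (real (word_length G S g))\<^sup>2 * pmf \<mu> g) summable_on carrier G)"

definition convolution_pmf :: "('a, 'b) monoid_scheme \<Rightarrow> 'a pmf \<Rightarrow> 'a pmf \<Rightarrow> 'a pmf" where
  "convolution_pmf G \<mu> \<nu> = map_pmf (\<lambda>(x, y). x \<otimes>\<^bsub>G\<^esub> y) (pair_pmf \<mu> \<nu>)"

primrec convolution_power :: "('a, 'b) monoid_scheme \<Rightarrow> 'a pmf \<Rightarrow> nat \<Rightarrow> 'a pmf" where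
  "convolution_power G \<mu> 0 = return_pmf \<one>\<^bsub>G\<^esub>"
| "convolution_power G \<mu> (Suc n) = convolution_pmf G (convolution_power G \<mu> n) \<mu>"

text \<open>The mixture \<open>\<rho> (\<mu> \<times> \<mu>) + (1 - \<rho>) \<mu>\<^sub>d\<^sub>i\<^sub>a\<^sub>g\<close>; only meaningful for \<open>0 \<le> \<rho> \<le> 1\<close>.\<close>

definition correlated_pmf :: "real \<Rightarrow> 'a pmf \<Rightarrow> ('a \<times> 'a) pmf" where
  "correlated_pmf \<rho> \<mu> =
     bind_pmf (bernoulli_pmf \<rho>)
       (\<lambda>b. if b then pair_pmf \<mu> \<mu> else map_pmf (\<lambda>x. (x, x)) \<mu>)"

lemma pmf_correlated_pmf:
  assumes "0 \<le> \<rho>" "\<rho> \<le> 1"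
  shows "pmf (correlated_pmf \<rho> \<mu>) (x, y) =
           \<rho> * (pmf \<mu> x * pmf \<mu> y) + (1 - \<rho>) * (if x = y then pmf \<mu> x else 0)"
proof -
  have "pmf (map_pmf (\<lambda>x. (x, x)) \<mu>) (x, y) = (if x = y then pmf \<mu> x else 0)"
  proof (cases "x = y")
    case True
    then show ?thesis
      using pmf_map_inj'[of "\<lambda>x. (x, x)" \<mu> x] by (simp add: inj_def)
  next
    case False
    then show ?thesis by (auto simp: pmf_eq_0_set_pmf)
  qed
  then show ?thesis
    using assms by (simp add: correlated_pmf_def pmf_bind pmf_pair)
qed

definition total_variation :: "'a pmf \<Rightarrow> 'a pmf \<Rightarrow> real" where
  "total_variation p q = (SUP A. \<bar>measure (measure_pmf p) A - measure (measure_pmf q) A\<bar>)"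

lemma bdd_above_total_variation:
  "bdd_above (range (\<lambda>A. \<bar>measure (measure_pmf p) A - measure (measure_pmf q) A\<bar>))"
proof (rule bdd_aboveI2)
  show "\<bar>measure (measure_pmf p) A - measure (measure_pmf q) A\<bar> \<le> 1" for A
    using measure_pmf.prob_le_1[of p A] measure_pmf.prob_le_1[of q A]
      measure_nonneg[of "measure_pmf p" A] measure_nonneg[of "measure_pmf q" A]
    by linarith
qed

definition noise_distance ::
    "('a, 'b) monoid_scheme \<Rightarrow> 'a pmf \<Rightarrow> real \<Rightarrow> nat \<Rightarrow> real" where
  "noise_distance G \<mu> \<rho> n =
     total_variation (convolution_power (G \<times>\<times> G) (correlated_pmf \<rho> \<mu>) n)
       (pair_pmf (convolution_power G \<mu> n) (convolution_power G \<mu> n))"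

definition noise_sensitive_TV :: "('a, 'b) monoid_scheme \<Rightarrow> 'a pmf \<Rightarrow> bool" where
  "noise_sensitive_TV G \<mu> \<longleftrightarrow>
     (\<forall>\<rho>\<in>{0<..1}. (\<lambda>n. noise_distance G \<mu> \<rho> n) \<longlonglongrightarrow> 0)"

end

(*
  Let phi_m(z) be the l1 distance between the law of the walk at time m and its right translate
  by z.  If h has finitely many conjugates, all reachable at one common time, then the walk
  contains on the order of m independent fair coins deciding whether to insert a conjugate of h,
  and binomial smoothing gives phi_m(h) = O(m^(-1/2)).  Such h form a finite-index subgroup of a
  virtually abelian group (up to periodicity); the remaining translations are handled by a
  contraction argument, and a finite second moment yields
    sum_x mu(x) ||mu_m delta_x - mu_(m+1)||^2 = O(1/m).

  Since mu_diag - mu x mu is the mu-average of the tensor squares of delta_x - mu, exchanging one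
  independent increment for a noised one next to m independent ones costs O((1 - rho) / m).  With
  A = mu x mu and B = pi^rho, the identity
    A^(p+q) - B^(p+q) = A^p (A^q - B^q) + (A^p - B^p) A^q - (A^p - B^p)(A^q - B^q)
  then propagates the bound O(1 - rho) from n / 2 to n.

  For a homomorphism h to the integers, h(x) - h(y) has variance of order n rho under pi^rho_n,
  whereas translation invariance of mu_n at scale sqrt n spreads it over the scale sqrt n under
  mu_n x mu_n.
*)
theory Submission
  imports Defs
begin

text \<open>Exchanging all n increments one at a time would cost the sum of (1 - rho) / m over m <=
  n, which grows like log n. Exchanging half of them next to the other half, kept independent, costs
  n / 2 times O((1 - rho) / n). The full exchange then enters only as a product of two errors at
  time n / 2, which a small 1 - rho absorbs. In one of the two linear terms the independent block
  stands to the right of the exchanged increments, so left translates are needed as well; they come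
  from the walk of inverses. Inserting h before a block b of later increments is a right translation
  by the conjugate b h b^(-1), and one coin can serve all b only if these conjugates are finitely
  many. A reflection in the infinite dihedral group is the model of an element for which they are
  not: its conjugates move away linearly in the length of b, and the contraction has to pay O(len b
  * m^(-1/2)) for that. The rate m^(-1/2) is demanded of every translation involved because its
  square has to be the 1 / m of a single exchange.\<close>

section \<open>Expectations of real functions under discrete laws\<close>

lemma integrable_pmf_bounded:
  fixes f :: "'a \<Rightarrow> real"
  assumes "\<And>x. \<bar>f x\<bar> \<le> B"
  shows "integrable (measure_pmf p) f"
  by (rule measure_pmf.integrable_const_bound[where B = B]) (auto simp: assms)

lemma integrable_pmf_mono:
  fixes f g :: "'a \<Rightarrow> real"
  assumes "integrable (measure_pmf p) g" and "\<And>x. x \<in> set_pmf p \<Longrightarrow> \<bar>f x\<bar> \<le> g x"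
  shows "integrable (measure_pmf p) f"
  by (rule Bochner_Integration.integrable_bound[OF assms(1)])
     (use assms(2) in \<open>auto simp: AE_measure_pmf_iff intro: order_trans[OF _ abs_ge_self]\<close>)

lemma expectation_mono_pmf:
  fixes f g :: "'a \<Rightarrow> real"
  assumes "integrable (measure_pmf p) f" "integrable (measure_pmf p) g"
    and "\<And>x. x \<in> set_pmf p \<Longrightarrow> f x \<le> g x"
  shows "measure_pmf.expectation p f \<le> measure_pmf.expectation p g"
  by (rule integral_mono_AE) (use assms in \<open>auto simp: AE_measure_pmf_iff\<close>)

lemma expectation_cong_pmf:
  fixes f g :: "'a \<Rightarrow> real"
  assumes "\<And>x. x \<in> set_pmf p \<Longrightarrow> f x = g x"
  shows "measure_pmf.expectation p f = measure_pmf.expectation p g"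
  by (rule integral_cong_AE) (use assms in \<open>auto simp: AE_measure_pmf_iff\<close>)

lemma abs_expectation_le:
  fixes f g :: "'a \<Rightarrow> real"
  assumes "integrable (measure_pmf p) g" and "\<And>x. x \<in> set_pmf p \<Longrightarrow> \<bar>f x\<bar> \<le> g x"
  shows "\<bar>measure_pmf.expectation p f\<bar> \<le> measure_pmf.expectation p g"
proof -
  have f: "integrable (measure_pmf p) f"
    using assms by (rule integrable_pmf_mono)
  have "\<bar>measure_pmf.expectation p f\<bar> \<le> measure_pmf.expectation p (\<lambda>x. \<bar>f x\<bar>)"
    by (rule integral_abs_bound)
  also have "\<dots> \<le> measure_pmf.expectation p g"
    using f assms by (intro expectation_mono_pmf) auto
  finally show ?thesis .
qed

lemma abs_expectation_le_const:
  fixes f :: "'a \<Rightarrow> real"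
  assumes "\<And>x. x \<in> set_pmf p \<Longrightarrow> \<bar>f x\<bar> \<le> B"
  shows "\<bar>measure_pmf.expectation p f\<bar> \<le> B"
  using abs_expectation_le[of p "\<lambda>_. B" f] assms by simp

text \<open>Word lengths and homomorphisms are unbounded, so integrability of the inner expectations
  has to come out of that of the whole. A finite iterated integral has almost everywhere finite
  inner integrals, and for a discrete law that means at every point of the support.\<close>

lemma bind_pmf_nonneg:
  fixes g :: "'b \<Rightarrow> real"
  assumes int: "integrable (measure_pmf (bind_pmf p f)) g" and nonneg: "\<And>y. 0 \<le> g y"
  shows "\<And>x. x \<in> set_pmf p \<Longrightarrow> integrable (measure_pmf (f x)) g"
    and "integrable (measure_pmf p) (\<lambda>x. measure_pmf.expectation (f x) g)"
    and "measure_pmf.expectation (bind_pmf p f) g =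
           measure_pmf.expectation p (\<lambda>x. measure_pmf.expectation (f x) g)"
proof -
  let ?N = "\<lambda>x. \<integral>\<^sup>+y. ennreal (g y) \<partial>measure_pmf (f x)"
  have fin: "(\<integral>\<^sup>+x. ?N x \<partial>measure_pmf p) < \<infinity>"
    using int nonneg unfolding nn_integral_bind_pmf[symmetric]
    by (subst (asm) integrable_iff_bounded) simp
  then have "AE x in measure_pmf p. ?N x \<noteq> \<infinity>"
    by (intro nn_integral_noteq_infinite) auto
  then show g: "integrable (measure_pmf (f x)) g" if "x \<in> set_pmf p" for x
    using that nonneg by (subst integrable_iff_bounded) (auto simp: AE_measure_pmf_iff top.not_eq_extremum)
  have N: "?N x = ennreal (measure_pmf.expectation (f x) g)" if "x \<in> set_pmf p" for x
    using nonneg by (intro nn_integral_eq_integral g that) auto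
  have nn: "(\<integral>\<^sup>+x. ?N x \<partial>measure_pmf p) =
      (\<integral>\<^sup>+x. ennreal (measure_pmf.expectation (f x) g) \<partial>measure_pmf p)"
    by (rule nn_integral_cong_AE) (auto simp: AE_measure_pmf_iff N)
  have E0: "0 \<le> measure_pmf.expectation (f x) g" for x
    using nonneg by simp
  show int2: "integrable (measure_pmf p) (\<lambda>x. measure_pmf.expectation (f x) g)"
    using fin nn E0 by (subst integrable_iff_bounded) auto
  have "ennreal (measure_pmf.expectation (bind_pmf p f) g) =
      (\<integral>\<^sup>+y. ennreal (g y) \<partial>measure_pmf (bind_pmf p f))"
    using int nonneg by (intro nn_integral_eq_integral[symmetric]) auto
  also have "\<dots> = ennreal (measure_pmf.expectation p (\<lambda>x. measure_pmf.expectation (f x) g))"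
    using int2 E0 nn by (simp add: nn_integral_eq_integral)
  finally show "measure_pmf.expectation (bind_pmf p f) g =
           measure_pmf.expectation p (\<lambda>x. measure_pmf.expectation (f x) g)"
    using nonneg E0 by (subst (asm) ennreal_inj) (auto intro!: integral_nonneg)
qed

lemma expectation_bind_pmf:
  fixes g :: "'b \<Rightarrow> real"
  assumes int: "integrable (measure_pmf (bind_pmf p f)) g"
  shows "measure_pmf.expectation (bind_pmf p f) g =
           measure_pmf.expectation p (\<lambda>x. measure_pmf.expectation (f x) g)"
proof -
  define u v where "u = (\<lambda>y. max 0 (g y))" and "v = (\<lambda>y. max 0 (- g y))"
  have int': "integrable (measure_pmf (bind_pmf p f)) u" "integrable (measure_pmf (bind_pmf p f)) v"
    unfolding u_def v_def using int by (auto intro!: integrable_max)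
  have nn: "0 \<le> u y" "0 \<le> v y" and g: "g y = u y - v y" for y
    by (auto simp: u_def v_def)
  note U = bind_pmf_nonneg[OF int'(1) nn(1)] and V = bind_pmf_nonneg[OF int'(2) nn(2)]
  have "measure_pmf.expectation (bind_pmf p f) g =
      measure_pmf.expectation p (\<lambda>x. measure_pmf.expectation (f x) u - measure_pmf.expectation (f x) v)"
    unfolding g using int' U V by simp
  also have "\<dots> = measure_pmf.expectation p (\<lambda>x. measure_pmf.expectation (f x) g)"
    unfolding g using U(1) V(1) by (intro expectation_cong_pmf) simp
  finally show ?thesis .
qed

lemma expectation_pair_pmf:
  fixes g :: "'a \<times> 'b \<Rightarrow> real"
  assumes "integrable (measure_pmf (pair_pmf p q)) g"
  shows "measure_pmf.expectation (pair_pmf p q) g =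
           measure_pmf.expectation p (\<lambda>x. measure_pmf.expectation q (\<lambda>y. g (x, y)))"
  using assms unfolding pair_pmf_def bind_return_pmf' map_pmf_def[symmetric]
  by (simp add: expectation_bind_pmf)

lemma expectation_swap_pmf:
  fixes g :: "'a \<Rightarrow> 'b \<Rightarrow> real"
  assumes "\<And>x y. \<bar>g x y\<bar> \<le> B"
  shows "measure_pmf.expectation p (\<lambda>x. measure_pmf.expectation q (g x)) =
         measure_pmf.expectation q (\<lambda>y. measure_pmf.expectation p (\<lambda>x. g x y))"
proof -
  have "measure_pmf.expectation (pair_pmf p q) (case_prod g) =
      measure_pmf.expectation (pair_pmf q p) (\<lambda>(y, x). g x y)"
    by (subst pair_commute_pmf) (simp add: case_prod_beta')
  moreover have "\<bar>case_prod g z\<bar> \<le> B" "\<bar>(\<lambda>(y, x). g x y) w\<bar> \<le> B" for z w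
    using assms by (auto simp: case_prod_beta)
  ultimately show ?thesis
    by (subst (asm) (1 2) expectation_pair_pmf) (auto intro: integrable_pmf_bounded[where B = B])
qed

section \<open>The l1 distance through test functions\<close>

text \<open>The \<open>\<ell>\<^sup>1\<close> norm of \<open>p - q\<close>, i.e. twice the total variation distance.\<close>

definition l1_dist :: "'a pmf \<Rightarrow> 'a pmf \<Rightarrow> real" where
  "l1_dist p q = (SUP f\<in>{f. \<forall>x. \<bar>f x\<bar> \<le> 1}.
     \<bar>measure_pmf.expectation p f - measure_pmf.expectation q f\<bar>)"

lemma l1_dist_aux:
  fixes f :: "'a \<Rightarrow> real"
  assumes "\<And>x. \<bar>f x\<bar> \<le> 1"
  shows "\<bar>measure_pmf.expectation p f - measure_pmf.expectation q f\<bar> \<le> 2"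
  using abs_expectation_le_const[of p f 1] abs_expectation_le_const[of q f 1] assms by fastforce

lemma l1_dist_leI:
  assumes "\<And>f. (\<And>x. \<bar>f x\<bar> \<le> 1) \<Longrightarrow>
    \<bar>measure_pmf.expectation p f - measure_pmf.expectation q f\<bar> \<le> c"
  shows "l1_dist p q \<le> c"
  unfolding l1_dist_def by (rule cSUP_least) (auto intro: assms exI[of _ "\<lambda>_. 0"])

lemma l1_distD1:
  assumes "\<And>x. \<bar>f x\<bar> \<le> 1"
  shows "\<bar>measure_pmf.expectation p f - measure_pmf.expectation q f\<bar> \<le> l1_dist p q"
  unfolding l1_dist_def using assms
  by (intro cSUP_upper) (auto intro!: bdd_aboveI2[where M = 2] l1_dist_aux)

lemma l1_dist_nonneg: "0 \<le> l1_dist p q"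
  using l1_distD1[of "\<lambda>_. 0" p q] by simp

lemma l1_dist_le_2: "l1_dist p q \<le> 2"
  by (intro l1_dist_leI l1_dist_aux)

lemma l1_distD:
  assumes "\<And>x. \<bar>f x\<bar> \<le> B"
  shows "\<bar>measure_pmf.expectation p f - measure_pmf.expectation q f\<bar> \<le> B * l1_dist p q"
proof (cases "B = 0")
  case True
  with assms have "f = (\<lambda>_. 0)" by auto
  with True show ?thesis by simp
next
  case False
  with assms[of undefined] have B: "0 < B" by linarith
  have "\<bar>measure_pmf.expectation p (\<lambda>x. f x / B) - measure_pmf.expectation q (\<lambda>x. f x / B)\<bar> \<le> l1_dist p q"
    using assms B by (intro l1_distD1) (simp add: abs_divide)
  also have "measure_pmf.expectation p (\<lambda>x. f x / B) - measure_pmf.expectation q (\<lambda>x. f x / B) =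
      (measure_pmf.expectation p f - measure_pmf.expectation q f) / B"
    by (simp add: diff_divide_distrib)
  finally show ?thesis
    using B by (simp add: abs_divide field_simps)
qed

lemma l1_dist_refl [simp]: "l1_dist p p = 0"
  by (rule antisym[OF l1_dist_leI l1_dist_nonneg]) simp

lemma l1_dist_sym: "l1_dist p q = l1_dist q p"
  unfolding l1_dist_def by (simp add: abs_minus_commute)

lemma l1_dist_triangle: "l1_dist p r \<le> l1_dist p q + l1_dist q r"
proof (rule l1_dist_leI)
  fix f :: "'a \<Rightarrow> real"
  assume f: "\<And>x. \<bar>f x\<bar> \<le> 1"
  show "\<bar>measure_pmf.expectation p f - measure_pmf.expectation r f\<bar> \<le> l1_dist p q + l1_dist q r"
    using l1_distD1[of f p q, OF f] l1_distD1[of f q r, OF f] by linarith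
qed

lemma l1_dist_map_le: "l1_dist (map_pmf h p) (map_pmf h q) \<le> l1_dist p q"
  by (rule l1_dist_leI) (simp add: l1_distD1)

lemma total_variation_le_l1_dist: "total_variation p q \<le> l1_dist p q"
  unfolding total_variation_def
proof (rule cSUP_least)
  fix A :: "'a set"
  have "\<bar>indicat_real A x\<bar> \<le> 1" for x
    by (simp add: indicator_def)
  from l1_distD1[of "indicat_real A" p q, OF this]
  show "\<bar>measure (measure_pmf p) A - measure (measure_pmf q) A\<bar> \<le> l1_dist p q"
    by simp
qed simp

lemma total_variation_le_1: "total_variation p q \<le> 1"
  unfolding total_variation_def
proof (rule cSUP_least)
  show "\<bar>measure (measure_pmf p) A - measure (measure_pmf q) A\<bar> \<le> 1" for A
    using measure_pmf.prob_le_1[of p A] measure_pmf.prob_le_1[of q A]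
      measure_nonneg[of "measure_pmf p" A] measure_nonneg[of "measure_pmf q" A]
    by linarith
qed simp

lemma total_variation_ge:
  "measure (measure_pmf p) A - measure (measure_pmf q) A \<le> total_variation p q"
  unfolding total_variation_def
  by (rule order_trans[OF abs_ge_self cSUP_upper[OF _ bdd_above_total_variation]]) simp

section \<open>Smoothing by coins and binomial weights\<close>

lemma coin_le_expectation:
  fixes g :: "'a \<Rightarrow> real"
  assumes "integrable (measure_pmf p) g" and "\<And>x. 0 \<le> g x" and "c \<le> pmf p z"
  shows "c * g z \<le> measure_pmf.expectation p g"
proof -
  have ind: "integrable (measure_pmf p) (\<lambda>x. g z * indicator {z} x)"
    by (rule integrable_pmf_bounded[where B = "\<bar>g z\<bar>"]) (simp add: indicator_def)
  have "c * g z \<le> measure_pmf.expectation p (\<lambda>x. g z * indicator {z} x)"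
    using assms by (simp add: measure_pmf_single mult_left_mono mult.commute[of c])
  also have "\<dots> \<le> measure_pmf.expectation p g"
    using assms by (intro expectation_mono_pmf ind) (auto simp: indicator_def)
  finally show ?thesis .
qed

text \<open>The law \<open>p\<close> dominates \<open>c\<close> times the uniform law on the list
  \<open>z 0, ..., z (n - 1)\<close>. On that share of the mass the bound \<open>u\<close> is
  exchanged for the bound \<open>v\<close> on the average of \<Psi>. Each atom is compared
  separately before averaging, so repetitions in the list do no harm.\<close>

lemma expectation_coin_bound:
  fixes \<Psi> u :: "'a \<Rightarrow> real" and z :: "nat \<Rightarrow> 'a" and c v :: real
  assumes u: "integrable (measure_pmf p) u" and \<Psi>: "\<And>x. x \<in> set_pmf p \<Longrightarrow> \<bar>\<Psi> x\<bar> \<le> u x"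
    and "n > 0" and c: "0 \<le> c" and z: "\<And>i. i < n \<Longrightarrow> c \<le> pmf p (z i)" "\<And>i. i < n \<Longrightarrow> z i \<in> set_pmf p"
    and v: "\<bar>\<Sum>i<n. \<Psi> (z i)\<bar> \<le> real n * v"
  shows "\<bar>measure_pmf.expectation p \<Psi>\<bar> \<le>
    measure_pmf.expectation p u - c * ((\<Sum>i<n. u (z i)) / n) + c * v"
proof -
  have *: "measure_pmf.expectation p (\<lambda>x. s * \<Psi> x) \<le>
    measure_pmf.expectation p u - c * ((\<Sum>i<n. u (z i)) / n) + c * v" if s: "\<bar>s\<bar> = 1" for s :: real
  proof -
    have i\<Psi>: "integrable (measure_pmf p) (\<lambda>x. s * \<Psi> x)"
      by (rule integrable_pmf_mono[OF u]) (use \<Psi> s in \<open>simp add: abs_mult\<close>)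
    \<comment> \<open>The slack in \<open>s * \<Psi> \<le> u\<close> is nonnegative, so its
      expectation is at least the contribution of any single atom.\<close>
    define g where "g x = (if x \<in> set_pmf p then u x - s * \<Psi> x else 0)" for x
    have g0: "0 \<le> g x" for x
    proof -
      have "s * \<Psi> x \<le> \<bar>\<Psi> x\<bar>" using s by (metis abs_ge_self abs_mult mult_1)
      with \<Psi>[of x] show ?thesis by (auto simp: g_def)
    qed
    have g_eq: "measure_pmf.expectation p g = measure_pmf.expectation p u - measure_pmf.expectation p (\<lambda>x. s * \<Psi> x)"
      unfolding Bochner_Integration.integral_diff[OF u i\<Psi>, symmetric]
      by (rule expectation_cong_pmf) (simp add: g_def)
    have ig: "integrable (measure_pmf p) g"
      by (rule integrable_pmf_mono[OF Bochner_Integration.integrable_diff[OF u i\<Psi>]])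
         (use g0 in \<open>auto simp: g_def\<close>, smt (verit, best))
    have "(\<Sum>i<n. c * g (z i)) \<le> (\<Sum>i<n. measure_pmf.expectation p g)"
      by (intro sum_mono coin_le_expectation ig g0 z) simp
    then have "c * (\<Sum>i<n. g (z i)) \<le> n * measure_pmf.expectation p g"
      by (simp add: sum_distrib_left)
    moreover have "(\<Sum>i<n. g (z i)) = (\<Sum>i<n. u (z i)) - s * (\<Sum>i<n. \<Psi> (z i))"
      by (simp add: g_def z(2) sum_subtractf sum_distrib_left)
    moreover have "s * (\<Sum>i<n. \<Psi> (z i)) \<le> n * v"
      using v s by (metis abs_ge_self abs_mult mult_1 order_trans)
    ultimately have "c * ((\<Sum>i<n. u (z i)) - n * v) \<le> n * measure_pmf.expectation p g"
      using c by (smt (verit) mult_left_mono)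
    then have "c * ((\<Sum>i<n. u (z i)) / n) - c * v \<le> measure_pmf.expectation p g"
      using \<open>n > 0\<close> by (simp add: field_simps)
    with g_eq show ?thesis by linarith
  qed
  from *[of 1] *[of "-1"] show ?thesis by simp
qed

text \<open>Pascal's rule read as one more fair coin: both outcomes of the new coin are added under
  the weights of order \<open>n\<close>.\<close>

lemma sum_binomial_Suc:
  fixes f :: "nat \<Rightarrow> real"
  shows "(\<Sum>i\<le>Suc n. real (Suc n choose i) * f i) = (\<Sum>i\<le>n. real (n choose i) * (f i + f (Suc i)))"
proof -
  have "(\<Sum>i\<le>Suc n. real (Suc n choose i) * f i) =
      f 0 + (\<Sum>i\<le>n. real (n choose i) * f (Suc i)) + (\<Sum>i\<le>n. real (n choose Suc i) * f (Suc i))"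
    by (subst sum.atMost_Suc_shift) (simp add: algebra_simps sum.distrib)
  also have "f 0 + (\<Sum>i\<le>n. real (n choose Suc i) * f (Suc i)) = (\<Sum>i\<le>Suc n. real (n choose i) * f i)"
    by (subst sum.atMost_Suc_shift) simp
  then have "f 0 + (\<Sum>i\<le>n. real (n choose i) * f (Suc i)) + (\<Sum>i\<le>n. real (n choose Suc i) * f (Suc i)) =
      (\<Sum>i\<le>n. real (n choose i) * f (Suc i)) + (\<Sum>i\<le>Suc n. real (n choose i) * f i)"
    by linarith
  also have "\<dots> = (\<Sum>i\<le>n. real (n choose i) * (f i + f (Suc i)))"
    by (simp add: algebra_simps sum.distrib)
  finally show ?thesis .
qed

lemma sum_binomial_real: "(\<Sum>i\<le>n. real (n choose i)) = 2 ^ n"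
  using choose_row_sum[of n] by (metis of_nat_numeral of_nat_power of_nat_sum)

text \<open>The variance of a sum of \<open>n\<close> fair signs. With x = n - 2 i, Pascal's rule
  turns the induction step into (x + 1)^2 + (x - 1)^2 = 2 x^2 + 2.\<close>

lemma sum_binomial_variance: "(\<Sum>i\<le>n. real (n choose i) * (real n - 2 * real i)\<^sup>2) = real n * 2 ^ n"
proof (induction n)
  case (Suc n)
  have "(\<Sum>i\<le>Suc n. real (Suc n choose i) * (real (Suc n) - 2 * real i)\<^sup>2) =
      (\<Sum>i\<le>n. real (n choose i) * (2 * (real n - 2 * real i)\<^sup>2 + 2))"
    by (subst sum_binomial_Suc) (simp add: power2_eq_square algebra_simps)
  also have "\<dots> = 2 * (\<Sum>i\<le>n. real (n choose i) * (real n - 2 * real i)\<^sup>2) + 2 * (\<Sum>i\<le>n. real (n choose i))"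
    by (simp add: sum_distrib_left sum.distrib algebra_simps)
  finally show ?case
    unfolding Suc sum_binomial_real by (simp add: algebra_simps del: sum.atMost_Suc)
qed simp

text \<open>The difference of consecutive binomial coefficients of order \<open>j\<close> is \<open>(n - 2 i) / n\<close> times a
  binomial coefficient of order \<open>n = j + 1\<close>, so the bound is a standard deviation.\<close>

lemma binomial_shift_bound:
  fixes a :: "nat \<Rightarrow> real"
  assumes a: "\<And>i. \<bar>a i\<bar> \<le> 1"
  shows "\<bar>\<Sum>i\<le>j. real (j choose i) * (a i - a (Suc i))\<bar> \<le> 2 ^ j * (2 / sqrt (real (Suc j)))"
proof -
  define n where "n = Suc j"
  have 1: "real n * real (j choose i) = (real n - real i) * real (n choose i)" if "i \<le> j" for i
  proof -
    have "n * (j choose i) = (n - i) * (n choose i)"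
      using binomial_absorb_comp[of n i] by (simp add: n_def)
    then show ?thesis using that
      by (metis n_def le_SucI of_nat_diff of_nat_mult)
  qed
  have 2: "real n * real (j choose i) = real (Suc i) * real (n choose Suc i)" for i
    unfolding n_def by (metis Suc_times_binomial_eq mult.commute of_nat_mult)
  have "real n * (\<Sum>i\<le>j. real (j choose i) * (a i - a (Suc i))) =
     (\<Sum>i\<le>j. real n * real (j choose i) * a i) - (\<Sum>i\<le>j. real n * real (j choose i) * a (Suc i))"
    by (simp add: sum_distrib_left sum_subtractf algebra_simps)
  also have "(\<Sum>i\<le>j. real n * real (j choose i) * a i) = (\<Sum>i\<le>n. (real n - real i) * real (n choose i) * a i)"
    using 1 by (simp add: n_def)
  also have "(\<Sum>i\<le>j. real n * real (j choose i) * a (Suc i)) = (\<Sum>i\<le>n. real i * real (n choose i) * a i)"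
    by (subst 2, subst n_def, subst sum.atMost_Suc_shift) (simp add: n_def)
  finally have "real n * (\<Sum>i\<le>j. real (j choose i) * (a i - a (Suc i))) =
      (\<Sum>i\<le>n. (real n - 2 * real i) * real (n choose i) * a i)"
    by (simp add: sum_subtractf[symmetric] algebra_simps)
  \<comment> \<open>In place of Cauchy-Schwarz: y <= (y^2 / t + t) / 2 with t =
    \<open>sqrt n\<close>, the standard deviation, for which both halves contribute equally.\<close>
  also have "\<bar>\<dots>\<bar> \<le> (\<Sum>i\<le>n. real (n choose i) * (((real n - 2 * real i)\<^sup>2 / sqrt n + sqrt n) / 2))"
  proof (rule order_trans[OF sum_abs sum_mono])
    fix i
    define y where "y = \<bar>real n - 2 * real i\<bar>"
    have "0 < sqrt n" by (simp add: n_def)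
    moreover have "0 \<le> (y - sqrt n)\<^sup>2" by simp
    ultimately have "y \<le> (y\<^sup>2 / sqrt n + sqrt n) / 2"
      by (simp add: power2_eq_square field_simps)
    then have "real (n choose i) * y * \<bar>a i\<bar> \<le> real (n choose i) * ((y\<^sup>2 / sqrt n + sqrt n) / 2) * 1"
      using a[of i] by (intro mult_mono mult_left_mono mult_nonneg_nonneg) (auto simp: y_def)
    then show "\<bar>(real n - 2 * real i) * real (n choose i) * a i\<bar>
        \<le> real (n choose i) * (((real n - 2 * real i)\<^sup>2 / sqrt n + sqrt n) / 2)"
      by (simp add: y_def abs_mult mult.commute)
  qed
  also have "\<dots> = ((\<Sum>i\<le>n. real (n choose i) * (real n - 2 * real i)\<^sup>2) / sqrt n
      + sqrt n * (\<Sum>i\<le>n. real (n choose i))) / 2"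
    by (simp add: sum_distrib_left sum_divide_distrib sum.distrib[symmetric] field_simps)
  also have "\<dots> = sqrt n * 2 ^ n"
    unfolding sum_binomial_variance sum_binomial_real
    using real_div_sqrt[of "real n"] by (simp add: times_divide_eq_left[symmetric] del: times_divide_eq_left)
  finally have "real n * \<bar>\<Sum>i\<le>j. real (j choose i) * (a i - a (Suc i))\<bar> \<le> sqrt n * 2 ^ n"
    by (simp add: abs_mult)
  moreover have "real n * (2 ^ j * (2 / sqrt (real (Suc j)))) = real n / sqrt n * 2 ^ n"
    by (simp add: n_def)
  then have "sqrt n * 2 ^ n = real n * (2 ^ j * (2 / sqrt (real (Suc j))))"
    by (simp add: real_div_sqrt)
  ultimately have "real n * \<bar>\<Sum>i\<le>j. real (j choose i) * (a i - a (Suc i))\<bar> \<le>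
      real n * (2 ^ j * (2 / sqrt (real (Suc j))))"
    by linarith
  then show ?thesis
    by (rule mult_left_le_imp_le) (simp add: n_def)
qed

section \<open>Second-order comparison and convolutions\<close>

text \<open>Duality applied twice: integrating \<open>F\<close> against \<open>q - q'\<close> in the
  second variable leaves a function bounded by \<open>l1_dist q q'\<close>, which then tests
  \<open>p - p'\<close>. Both quadratic gains, in the covariance and in the doubling step, come from
  here.\<close>

lemma l1_dist_bilinear:
  fixes F :: "'a \<Rightarrow> 'b \<Rightarrow> real"
  assumes F: "\<And>x y. \<bar>F x y\<bar> \<le> 1"
  defines "E p q \<equiv> measure_pmf.expectation p (\<lambda>x. measure_pmf.expectation q (F x))"
  shows "\<bar>E p q - E p q' - E p' q + E p' q'\<bar> \<le> l1_dist p p' * l1_dist q q'"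
proof -
  define g where "g x = measure_pmf.expectation q (F x) - measure_pmf.expectation q' (F x)" for x
  have "\<bar>g x\<bar> \<le> l1_dist q q'" for x
    unfolding g_def by (rule l1_distD1) (rule F)
  then have "\<bar>measure_pmf.expectation p g - measure_pmf.expectation p' g\<bar> \<le> l1_dist q q' * l1_dist p p'"
    by (rule l1_distD)
  moreover have "integrable (measure_pmf r) (\<lambda>x. measure_pmf.expectation s (F x))" for r s
    by (intro integrable_pmf_bounded[where B = 1] abs_expectation_le_const F)
  ultimately show ?thesis
    unfolding E_def g_def by (simp add: mult.commute)
qed

lemma expectation_convolution_pmf:
  fixes f :: "'a \<Rightarrow> real"
  assumes "\<And>x. \<bar>f x\<bar> \<le> B"
  shows "measure_pmf.expectation (convolution_pmf G p q) f =
    measure_pmf.expectation p (\<lambda>x. measure_pmf.expectation q (\<lambda>y. f (x \<otimes>\<^bsub>G\<^esub> y)))"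
  unfolding convolution_pmf_def integral_map_pmf
  by (subst expectation_pair_pmf) (auto intro!: integrable_pmf_bounded[where B = B] simp: assms case_prod_beta)

lemma expectation_convolution_pmf_swap:
  fixes f :: "'a \<Rightarrow> real"
  assumes "\<And>x. \<bar>f x\<bar> \<le> B"
  shows "measure_pmf.expectation (convolution_pmf G p q) f =
    measure_pmf.expectation q (\<lambda>y. measure_pmf.expectation p (\<lambda>x. f (x \<otimes>\<^bsub>G\<^esub> y)))"
  unfolding expectation_convolution_pmf[of f B, OF assms]
  by (rule expectation_swap_pmf[where B = B]) (rule assms)

lemma set_convolution_pmf:
  "set_pmf (convolution_pmf G p q) = (\<lambda>(x, y). x \<otimes>\<^bsub>G\<^esub> y) ` (set_pmf p \<times> set_pmf q)"
  by (simp add: convolution_pmf_def)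

text \<open>Averaging a test function over the other factor keeps it bounded by 1, and with a
  distance defined by test functions this is the whole argument.\<close>

lemma l1_dist_convolution_left:
  "l1_dist (convolution_pmf G r p) (convolution_pmf G r q) \<le> l1_dist p q"
proof (rule l1_dist_leI)
  fix f :: "'a \<Rightarrow> real"
  assume f: "\<And>x. \<bar>f x\<bar> \<le> 1"
  show "\<bar>measure_pmf.expectation (convolution_pmf G r p) f - measure_pmf.expectation (convolution_pmf G r q) f\<bar>
      \<le> l1_dist p q"
    unfolding expectation_convolution_pmf_swap[of f 1, OF f]
    by (intro l1_distD1 abs_expectation_le_const f)
qed

lemma l1_dist_convolution_right:
  "l1_dist (convolution_pmf G p r) (convolution_pmf G q r) \<le> l1_dist p q"
proof (rule l1_dist_leI)
  fix f :: "'a \<Rightarrow> real"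
  assume f: "\<And>x. \<bar>f x\<bar> \<le> 1"
  show "\<bar>measure_pmf.expectation (convolution_pmf G p r) f - measure_pmf.expectation (convolution_pmf G q r) f\<bar>
      \<le> l1_dist p q"
    unfolding expectation_convolution_pmf[of f 1, OF f]
    by (intro l1_distD1 abs_expectation_le_const f)
qed

text \<open>The linear terms stay distances of convolutions: bounding them by
  \<open>l1_dist q q'\<close> and \<open>l1_dist p p'\<close> would throw away the smoothing by the
  unchanged factor, on which the doubling step rests.\<close>

lemma l1_dist_convolution_mixed:
  "l1_dist (convolution_pmf G p q) (convolution_pmf G p' q') \<le>
    l1_dist (convolution_pmf G p q') (convolution_pmf G p q) +
    l1_dist (convolution_pmf G p' q) (convolution_pmf G p q) + l1_dist p p' * l1_dist q q'"
proof (rule l1_dist_leI)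
  fix f :: "'a \<Rightarrow> real"
  assume f: "\<And>x. \<bar>f x\<bar> \<le> 1"
  note D = l1_distD1[of f, OF f]
  from D[of "convolution_pmf G p q'" "convolution_pmf G p q"] D[of "convolution_pmf G p' q" "convolution_pmf G p q"]
    l1_dist_bilinear[of "\<lambda>x y. f (x \<otimes>\<^bsub>G\<^esub> y)" p q q' p', OF f]
  show "\<bar>measure_pmf.expectation (convolution_pmf G p q) f - measure_pmf.expectation (convolution_pmf G p' q') f\<bar>
      \<le> l1_dist (convolution_pmf G p q') (convolution_pmf G p q) +
        l1_dist (convolution_pmf G p' q) (convolution_pmf G p q) + l1_dist p p' * l1_dist q q'"
    unfolding expectation_convolution_pmf[of f 1, OF f] by linarith
qed

context monoid
begin

lemma convolution_pmf_assoc: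
  assumes "set_pmf p \<subseteq> carrier G" "set_pmf q \<subseteq> carrier G" "set_pmf r \<subseteq> carrier G"
  shows "convolution_pmf G (convolution_pmf G p q) r = convolution_pmf G p (convolution_pmf G q r)"
  unfolding convolution_pmf_def pair_pmf_def map_pmf_def bind_assoc_pmf bind_return_pmf case_prod_conv
  using assms by (intro bind_pmf_cong refl) (metis m_assoc subsetD)

lemma convolution_return_left:
  assumes "set_pmf p \<subseteq> carrier G"
  shows "convolution_pmf G (return_pmf \<one>) p = p"
proof -
  have "convolution_pmf G (return_pmf \<one>) p = map_pmf (\<lambda>y. \<one> \<otimes> y) p"
    by (simp add: convolution_pmf_def pair_pmf_def bind_return_pmf map_pmf_def bind_assoc_pmf)
  also have "\<dots> = map_pmf (\<lambda>y. y) p"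
    using assms by (intro map_pmf_cong refl) auto
  finally show ?thesis by simp
qed

lemma convolution_return_right:
  assumes "set_pmf p \<subseteq> carrier G"
  shows "convolution_pmf G p (return_pmf \<one>) = p"
proof -
  have "convolution_pmf G p (return_pmf \<one>) = map_pmf (\<lambda>y. y \<otimes> \<one>) p"
    by (simp add: convolution_pmf_def pair_pmf_def bind_return_pmf map_pmf_def bind_assoc_pmf)
  also have "\<dots> = map_pmf (\<lambda>y. y) p"
    using assms by (intro map_pmf_cong refl) auto
  finally show ?thesis by simp
qed

lemma set_convolution_power:
  assumes "set_pmf p \<subseteq> carrier G"
  shows "set_pmf (convolution_power G p n) \<subseteq> carrier G"
  using assms by (induction n) (auto simp: set_convolution_pmf subset_iff)

lemma convolution_power_add:
  assumes "set_pmf p \<subseteq> carrier G"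
  shows "convolution_power G p (m + n) = convolution_pmf G (convolution_power G p m) (convolution_power G p n)"
  by (induction n) (simp_all add: convolution_return_right convolution_pmf_assoc set_convolution_power assms)

lemma convolution_power_1:
  assumes "set_pmf p \<subseteq> carrier G"
  shows "convolution_power G p 1 = p"
  using assms by (simp add: convolution_return_left)

lemma convolution_power_Suc_left:
  assumes "set_pmf p \<subseteq> carrier G"
  shows "convolution_power G p (Suc n) = convolution_pmf G p (convolution_power G p n)"
  using convolution_power_add[OF assms, of 1 n] convolution_power_1[OF assms] by simp

lemma mult_mem_convolution_power:
  assumes "set_pmf p \<subseteq> carrier G"
    and "x \<in> set_pmf (convolution_power G p m)" "y \<in> set_pmf (convolution_power G p n)"
  shows "x \<otimes> y \<in> set_pmf (convolution_power G p (m + n))"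
  using assms by (auto simp: convolution_power_add set_convolution_pmf)

lemma pow_mem_convolution_power:
  assumes "set_pmf p \<subseteq> carrier G" "x \<in> set_pmf (convolution_power G p m)"
  shows "x [^] (n::nat) \<in> set_pmf (convolution_power G p (n * m))"
proof (induction n)
  case (Suc n)
  then show ?case
    using mult_mem_convolution_power[OF assms(1) Suc assms(2)] by (simp add: add.commute)
qed simp

end

section \<open>Finite transversals and the standing assumptions on the walk\<close>

lemma finite_transversal:
  assumes "finite (c ` A)"
  obtains T where "finite T" "T \<subseteq> A" "\<And>x. x \<in> A \<Longrightarrow> \<exists>t\<in>T. c x = c t"
proof
  show "finite (inv_into A c ` c ` A)"
    using assms by simp
  show "inv_into A c ` c ` A \<subseteq> A"
    by (auto intro: inv_into_into)
  show "\<exists>t\<in>inv_into A c ` c ` A. c x = c t" if "x \<in> A" for x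
    using that by (auto simp: f_inv_into_f)
qed

locale va_random_walk = group G for G (structure) +
  fixes \<mu> :: "'a pmf" and gens :: "'a set"
  assumes supp: "set_pmf \<mu> \<subseteq> carrier G"
    and semigroup: "semigroup_generate G (set_pmf \<mu>) = carrier G"
    and gens: "finite_generating_set G gens"
    and virt_abelian: "virtually_abelian G"
    and moment2: "integrable (measure_pmf \<mu>) (\<lambda>g. (real (word_length G gens g))\<^sup>2)"
begin

abbreviation "walk \<equiv> convolution_power G \<mu>"

abbreviation "len g \<equiv> real (word_length G gens g)"

abbreviation "conjugate g h \<equiv> g \<otimes> h \<otimes> inv g"

lemma inv_cancel_left:
  assumes "x \<in> carrier G" "y \<in> carrier G"
  shows "inv x \<otimes> (x \<otimes> y) = y" and "x \<otimes> (inv x \<otimes> y) = y"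
  using assms by (simp_all add: m_assoc[symmetric])

lemma conj_mult:
  assumes "g \<in> carrier G" "x \<in> carrier G" "y \<in> carrier G"
  shows "conjugate g (x \<otimes> y) = conjugate g x \<otimes> conjugate g y"
  using assms by (simp add: m_assoc inv_cancel_left)

lemma conj_conj:
  assumes "a \<in> carrier G" "b \<in> carrier G" "x \<in> carrier G"
  shows "conjugate a (conjugate b x) = conjugate (a \<otimes> b) x"
  using assms by (simp add: m_assoc inv_mult_group)

lemma conj_pow:
  assumes "g \<in> carrier G" "x \<in> carrier G"
  shows "conjugate g x [^] (n::nat) = conjugate g (x [^] n)"
  using assms by (induction n) (simp_all add: conj_mult)

lemma conj_inv:
  assumes "g \<in> carrier G" "x \<in> carrier G"
  shows "inv (conjugate g x) = conjugate g (inv x)"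
  using assms by (simp add: m_assoc inv_mult_group)

subsection \<open>Word length\<close>

text \<open>The predicate whose least \<open>n\<close> is \<open>word_length\<close>. Inductions
  over letters run over words of any length, so minimality never has to be carried along.\<close>

definition is_word :: "nat \<Rightarrow> 'a \<Rightarrow> bool" where
  "is_word n g \<longleftrightarrow> (\<exists>ws. length ws = n \<and> set ws \<subseteq> gens \<union> m_inv G ` gens \<and>
     foldr (\<lambda>x y. x \<otimes> y) ws \<one> = g)"

lemma gens_subset: "gens \<subseteq> carrier G" and finite_gens: "finite gens"
  and generate_gens: "generate G gens = carrier G"
  using gens by (auto simp: finite_generating_set_def)

lemma letters_subset: "gens \<union> m_inv G ` gens \<subseteq> carrier G"
  using gens_subset by auto

lemma foldr_mult:
  assumes "set ws \<subseteq> carrier G" "a \<in> carrier G"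
  shows "foldr (\<lambda>x y. x \<otimes> y) ws \<one> \<in> carrier G"
    and "foldr (\<lambda>x y. x \<otimes> y) ws a = foldr (\<lambda>x y. x \<otimes> y) ws \<one> \<otimes> a"
proof -
  have *: "foldr (\<lambda>x y. x \<otimes> y) vs \<one> \<in> carrier G" if "set vs \<subseteq> carrier G" for vs
    using that by (induction vs) auto
  then show "foldr (\<lambda>x y. x \<otimes> y) ws \<one> \<in> carrier G"
    using assms by blast
  show "foldr (\<lambda>x y. x \<otimes> y) ws a = foldr (\<lambda>x y. x \<otimes> y) ws \<one> \<otimes> a"
    using assms by (induction ws) (auto simp: m_assoc *)
qed

lemma is_word_carrier: "is_word n g \<Longrightarrow> g \<in> carrier G"
  using letters_subset foldr_mult(1)[OF _ one_closed] unfolding is_word_def by blast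

lemma is_word_one: "is_word 0 \<one>"
  by (simp add: is_word_def)

lemma is_word_letter:
  assumes "s \<in> gens \<union> m_inv G ` gens"
  shows "is_word 1 s"
  unfolding is_word_def using assms letters_subset by (intro exI[of _ "[s]"]) auto

lemma is_word_mult:
  assumes "is_word m x" "is_word n y"
  shows "is_word (m + n) (x \<otimes> y)"
proof -
  obtain v w where v: "length v = m" "set v \<subseteq> gens \<union> m_inv G ` gens" "foldr (\<lambda>x y. x \<otimes> y) v \<one> = x"
    and w: "length w = n" "set w \<subseteq> gens \<union> m_inv G ` gens" "foldr (\<lambda>x y. x \<otimes> y) w \<one> = y"
    using assms unfolding is_word_def by blast
  have "foldr (\<lambda>x y. x \<otimes> y) (v @ w) \<one> = x \<otimes> y"
    using v w foldr_mult(2)[of v y] is_word_carrier[OF assms(2)] letters_subset by auto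
  then show ?thesis
    unfolding is_word_def using v w by (intro exI[of _ "v @ w"]) auto
qed

lemma is_word_Suc:
  assumes "is_word (Suc n) g"
  obtains g' s where "is_word n g'" "s \<in> gens \<union> m_inv G ` gens" "g = g' \<otimes> s"
proof -
  obtain w where w: "length w = Suc n" "set w \<subseteq> gens \<union> m_inv G ` gens" "foldr (\<lambda>x y. x \<otimes> y) w \<one> = g"
    using assms unfolding is_word_def by blast
  then obtain v s where vs: "w = v @ [s]"
    by (cases w rule: rev_cases) auto
  with w letters_subset have "s \<in> carrier G" "set v \<subseteq> carrier G" by auto
  then have "g = foldr (\<lambda>x y. x \<otimes> y) v \<one> \<otimes> s"
    using w vs foldr_mult(2)[of v s] by simp
  with that[of "foldr (\<lambda>x y. x \<otimes> y) v \<one>" s] w vs show ?thesis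
    unfolding is_word_def by auto
qed

lemma is_word_inv:
  assumes "is_word n g"
  shows "is_word n (inv g)"
  using assms
proof (induction n arbitrary: g)
  case 0
  then show ?case by (auto simp: is_word_def)
next
  case (Suc n)
  from Suc.prems obtain g' s where gs: "is_word n g'" "s \<in> gens \<union> m_inv G ` gens" "g = g' \<otimes> s"
    by (rule is_word_Suc)
  then have "inv s \<in> gens \<union> m_inv G ` gens"
    using gens_subset by (auto simp: subset_iff)
  then have "is_word (1 + n) (inv s \<otimes> inv g')"
    using Suc.IH[OF gs(1)] by (intro is_word_mult is_word_letter)
  then show ?case
    using gs is_word_carrier[OF gs(1)] letters_subset by (auto simp: inv_mult_group subset_iff)
qed

lemma is_word_exists:
  assumes "g \<in> carrier G"
  shows "\<exists>n. is_word n g"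
proof -
  have "g \<in> generate G gens" using assms generate_gens by simp
  then show ?thesis
  proof induction
    case one
    then show ?case using is_word_one by blast
  next
    case (incl h)
    then show ?case using is_word_letter[of h] by blast
  next
    case (inv h)
    then show ?case using is_word_letter[of "inv h"] by blast
  next
    case (eng h1 h2)
    then show ?case using is_word_mult by blast
  qed
qed

lemma is_word_word_length: "g \<in> carrier G \<Longrightarrow> is_word (word_length G gens g) g"
  using LeastI_ex[OF is_word_exists] unfolding is_word_def word_length_def by blast

lemma word_length_le: "is_word n g \<Longrightarrow> word_length G gens g \<le> n"
  unfolding is_word_def word_length_def by (rule Least_le)

lemma len_mult:
  assumes "x \<in> carrier G" "y \<in> carrier G"
  shows "len (x \<otimes> y) \<le> len x + len y"
  using word_length_le[OF is_word_mult[OF assms[THEN is_word_word_length]]] by simp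

lemma len_inv_le: "x \<in> carrier G \<Longrightarrow> len (inv x) \<le> len x"
  using word_length_le[OF is_word_inv[OF is_word_word_length]] by simp

lemma len_inv: "x \<in> carrier G \<Longrightarrow> len (inv x) = len x"
  using len_inv_le[of x] len_inv_le[of "inv x"] by simp

lemma integrable_len: "integrable (measure_pmf \<mu>) len"
proof (rule integrable_pmf_mono[of _ "\<lambda>g. (len g)\<^sup>2"])
  show "\<bar>len x\<bar> \<le> (len x)\<^sup>2" for x
    using le_square[of "word_length G gens x"] by (simp add: power2_eq_square flip: of_nat_mult)
qed (rule moment2)

lemma walk_carrier: "set_pmf (walk n) \<subseteq> carrier G"
  using supp by (rule set_convolution_power)

lemma walk_carrier': "x \<in> set_pmf (walk n) \<Longrightarrow> x \<in> carrier G"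
  using walk_carrier by blast

text \<open>By subadditivity of \<open>len\<close>. The expectation at one fixed time will bound the
  cost of conjugating by a block of increments.\<close>

lemma integrable_len_walk: "integrable (measure_pmf (walk n)) len"
proof (induction n)
  case 0
  then show ?case by (simp add: integrable_measure_pmf_finite)
next
  case (Suc n)
  have 1: "integrable (measure_pmf (pair_pmf (walk n) \<mu>)) (\<lambda>z. len (fst z))"
    using Suc integrable_map_pmf_eq[of fst "pair_pmf (walk n) \<mu>" len] by (simp add: map_fst_pair_pmf)
  have 2: "integrable (measure_pmf (pair_pmf (walk n) \<mu>)) (\<lambda>z. len (snd z))"
    using integrable_len integrable_map_pmf_eq[of snd "pair_pmf (walk n) \<mu>" len] by (simp add: map_snd_pair_pmf)
  show ?case
    unfolding convolution_power.simps convolution_pmf_def integrable_map_pmf_eq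
    by (rule integrable_pmf_mono[OF Bochner_Integration.integrable_add[OF 1 2]])
       (use supp walk_carrier[of n] in \<open>auto intro!: len_mult\<close>)
qed

subsection \<open>The aperiodic subgroup and the elements with finitely many conjugates\<close>

text \<open>Here generation as a semigroup enters: every element, inverses included, is a product of
  a nonempty list of support elements. Positivity of \<open>j\<close> makes
  \<open>return_time\<close> positive.\<close>

lemma walk_cover:
  assumes "g \<in> carrier G"
  shows "\<exists>j>0. g \<in> set_pmf (walk j)"
proof -
  have "g \<in> semigroup_generate G (set_pmf \<mu>)" using assms semigroup by simp
  then show ?thesis
  proof induction
    case (incl x)
    then show ?case
      using convolution_power_1[OF supp] by (intro exI[of _ 1]) simp
  next
    case (mult x y)
    then obtain i j where "i > 0" "j > 0" "x \<in> set_pmf (walk i)" "y \<in> set_pmf (walk j)" by blast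
    then show ?case
      using mult_mem_convolution_power[OF supp] by (intro exI[of _ "i + j"]) auto
  qed
qed

definition return_time :: nat where
  "return_time = (SOME r. 0 < r \<and> \<one> \<in> set_pmf (walk r))"

lemma return_time: "0 < return_time" "\<one> \<in> set_pmf (walk return_time)"
  using someI_ex[OF walk_cover[OF one_closed]] by (auto simp: return_time_def)

text \<open>The return time need not be the period: since \<open>x\<^sup>-\<^sup>1 = (x\<^sup>-\<^sup>1)\<^sup>r x\<^sup>r\<^sup>-\<^sup>1\<close>, the elements that are
  reachable at multiples of any return time \<open>r\<close> already form a normal subgroup.\<close>

definition aperiodic :: "'a set" where
  "aperiodic = {z. \<exists>i. z \<in> set_pmf (walk (i * return_time))}"

lemma aperiodic_carrier: "z \<in> aperiodic \<Longrightarrow> z \<in> carrier G"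
  using walk_carrier by (auto simp: aperiodic_def)

lemma one_mem_walk: "\<one> \<in> set_pmf (walk (i * return_time))"
  using pow_mem_convolution_power[OF supp return_time(2), of i] by simp

lemma walk_add_return_time:
  assumes "x \<in> set_pmf (walk j)"
  shows "x \<in> set_pmf (walk (j + i * return_time))"
  using mult_mem_convolution_power[OF supp assms one_mem_walk[of i]] walk_carrier'[OF assms] by simp

text \<open>Inversion negates time modulo \<open>return_time\<close>: the power
  \<open>inv x [^] return_time\<close> is reached at a multiple of it, and the remaining power of
  \<open>x\<close> takes time -j modulo it.\<close>

lemma inv_mem_walk:
  assumes "x \<in> set_pmf (walk j)"
  shows "\<exists>l. inv x \<in> set_pmf (walk l) \<and> return_time dvd l + j"
proof -
  have x: "x \<in> carrier G" using assms by (rule walk_carrier')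
  then obtain a where "inv x \<in> set_pmf (walk a)" using walk_cover[of "inv x"] by auto
  then have 1: "inv x [^] return_time \<in> set_pmf (walk (return_time * a))"
    by (rule pow_mem_convolution_power[OF supp])
  have 2: "x [^] (return_time - 1) \<in> set_pmf (walk ((return_time - 1) * j))"
    using assms by (rule pow_mem_convolution_power[OF supp])
  obtain q where q: "return_time = Suc q" using return_time(1) gr0_implies_Suc by blast
  have "inv x [^] q \<otimes> x [^] q = \<one>"
    using x by (simp add: nat_pow_inv)
  moreover have "inv x [^] return_time = inv x \<otimes> inv x [^] q"
    unfolding q using x by (intro nat_pow_Suc2) simp
  ultimately have "inv x [^] return_time \<otimes> x [^] (return_time - 1) = inv x"
    using x by (simp add: q m_assoc)
  with mult_mem_convolution_power[OF supp 1 2]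
  have "inv x \<in> set_pmf (walk (return_time * a + (return_time - 1) * j))" by simp
  moreover have "return_time * a + (return_time - 1) * j + j = return_time * (a + j)"
    by (simp add: q algebra_simps)
  then have "return_time dvd return_time * a + (return_time - 1) * j + j"
    by simp
  ultimately show ?thesis by blast
qed

lemma aperiodic_inv:
  assumes "z \<in> aperiodic"
  shows "inv z \<in> aperiodic"
proof -
  from assms obtain i where "z \<in> set_pmf (walk (i * return_time))" by (auto simp: aperiodic_def)
  from inv_mem_walk[OF this] obtain l where l: "inv z \<in> set_pmf (walk l)" "return_time dvd l + i * return_time" by blast
  then have "return_time dvd l" by (simp add: dvd_add_left_iff)
  with l(1) show ?thesis by (auto simp: aperiodic_def dvd_def mult.commute)
qed

lemma aperiodic_mult:
  assumes "y \<in> aperiodic" "z \<in> aperiodic"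
  shows "y \<otimes> z \<in> aperiodic"
proof -
  from assms obtain i j where "y \<in> set_pmf (walk (i * return_time))" "z \<in> set_pmf (walk (j * return_time))"
    by (auto simp: aperiodic_def)
  from mult_mem_convolution_power[OF supp this] show ?thesis
    unfolding aperiodic_def add_mult_distrib[symmetric] by blast
qed

lemma aperiodic_one: "\<one> \<in> aperiodic"
  using one_mem_walk by (auto simp: aperiodic_def)

lemma aperiodic_pow: "z \<in> aperiodic \<Longrightarrow> z [^] (n::nat) \<in> aperiodic"
  by (induction n) (simp_all add: aperiodic_one aperiodic_mult)

text \<open>Congruent times cancel in a quotient. In particular the quotient of two support
  elements, both reached at time 1, is in \<open>aperiodic\<close>, although each of them alone may
  not be.\<close>

lemma mult_inv_aperiodic:
  assumes "x \<in> set_pmf (walk i)" "y \<in> set_pmf (walk j)" "i mod return_time = j mod return_time"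
  shows "x \<otimes> inv y \<in> aperiodic"
proof -
  obtain l where l: "inv y \<in> set_pmf (walk l)" "return_time dvd l + j"
    using inv_mem_walk[OF assms(2)] by blast
  moreover have "(i + l) mod return_time = (l + j) mod return_time"
    using mod_add_cong[OF assms(3) refl, of l] by (simp add: add.commute)
  ultimately have "return_time dvd i + l"
    by (simp add: dvd_eq_mod_eq_0)
  with mult_mem_convolution_power[OF supp assms(1) l(1)] show ?thesis
    by (auto simp: aperiodic_def dvd_def mult.commute)
qed

lemma aperiodic_conj:
  assumes "g \<in> carrier G" "z \<in> aperiodic"
  shows "conjugate g z \<in> aperiodic"
proof -
  obtain j where j: "g \<in> set_pmf (walk j)" using walk_cover[OF assms(1)] by blast
  obtain i where "z \<in> set_pmf (walk (i * return_time))" using assms(2) by (auto simp: aperiodic_def)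
  from mult_mem_convolution_power[OF supp j this] show ?thesis
    using j by (rule mult_inv_aperiodic) simp
qed

lemma aperiodic_pow_return_time: 
  assumes "g \<in> carrier G"
  shows "g [^] return_time \<in> aperiodic"
proof -
  obtain j where "g \<in> set_pmf (walk j)" using walk_cover[OF assms] by blast
  from pow_mem_convolution_power[OF supp this, of return_time] show ?thesis
    by (auto simp: aperiodic_def mult.commute)
qed

text \<open>The identity is reachable at every multiple of \<open>return_time\<close>, so an element
  reached early can wait for the others. One time is needed because a coin chooses between its faces
  within one block of increments; positivity makes the recursions over blocks terminate.\<close>

lemma aperiodic_common_time:
  assumes "finite Z" "Z \<subseteq> aperiodic"
  shows "\<exists>k>0. \<forall>z\<in>Z. z \<in> set_pmf (walk k)"
proof -
  have "\<exists>i>0. \<forall>z\<in>Z. z \<in> set_pmf (walk (i * return_time))"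
    using assms
  proof (induction Z)
    case empty
    then show ?case by auto
  next
    case (insert z Z)
    then obtain i j where ij: "i > 0" "\<forall>z\<in>Z. z \<in> set_pmf (walk (i * return_time))" "z \<in> set_pmf (walk (j * return_time))"
      by (auto simp: aperiodic_def)
    have "z \<in> set_pmf (walk ((i + j) * return_time))"
      using walk_add_return_time[OF ij(3), of i] by (simp add: algebra_simps)
    moreover have "y \<in> set_pmf (walk ((i + j) * return_time))" if "y \<in> Z" for y
      using walk_add_return_time[of y "i * return_time" j] ij(2) that by (simp add: algebra_simps)
    ultimately show ?case using ij(1) by (intro exI[of _ "i + j"]) auto
  qed
  then obtain i where "i > 0" "\<forall>z\<in>Z. z \<in> set_pmf (walk (i * return_time))" by blast
  then show ?thesis using return_time(1) by (intro exI[of _ "i * return_time"]) simp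
qed

text \<open>The FC-centre (elements with finite conjugacy class) cut down to
  \<open>aperiodic\<close>. It is stable under conjugation, whereas an abelian subgroup of finite
  index need not be normal.\<close>

definition core :: "'a set" where
  "core = {h \<in> aperiodic. finite ((\<lambda>g. conjugate g h) ` carrier G)}"

text \<open>The conjugate of \<open>h\<close> by \<open>g\<close> depends only on the left coset g
  H, since H commutes with \<open>h\<close>. The hypothesis counts right cosets, so the right coset
  of \<open>inv g\<close> serves as a label for g H.\<close>

lemma finite_conj_of_abelian_subgroup:
  assumes H: "subgroup H G" "comm_group (G\<lparr>carrier := H\<rparr>)" "finite (rcosets H)" and h: "h \<in> H"
  shows "finite ((\<lambda>g. conjugate g h) ` carrier G)"
proof -
  have "(\<lambda>g. H #> inv g) ` carrier G \<subseteq> rcosets H"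
    using H(1) by (auto simp: RCOSETS_def)
  then have "finite ((\<lambda>g. H #> inv g) ` carrier G)"
    using H(3) by (rule finite_subset)
  then obtain T where T: "finite T" "T \<subseteq> carrier G" "\<And>x. x \<in> carrier G \<Longrightarrow> \<exists>t\<in>T. H #> inv x = H #> inv t"
    by (rule finite_transversal) (rule that)
  have "(\<lambda>g. conjugate g h) ` carrier G \<subseteq> (\<lambda>g. conjugate g h) ` T"
  proof (rule image_subsetI)
    fix g assume g: "g \<in> carrier G"
    then obtain t where t: "t \<in> T" "H #> inv g = H #> inv t" using T(3) by blast
    then have tc: "t \<in> carrier G" using T(2) by blast
    have hc: "h \<in> carrier G" using subgroup.subset[OF H(1)] h by blast
    have "inv g \<in> H #> inv t"
      using t(2) rcos_self[OF _ H(1), of "inv g"] g by simp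
    then obtain k where k: "k \<in> H" "inv g = k \<otimes> inv t" by (auto simp: r_coset_def)
    then have kc: "k \<in> carrier G" using subgroup.subset[OF H(1)] by blast
    have "inv (inv g) = inv (k \<otimes> inv t)" using k(2) by simp
    then have g_eq: "g = t \<otimes> inv k"
      using g tc kc by (simp add: inv_mult_group)
    have "h \<otimes> k = k \<otimes> h"
      using comm_groupE(4)[OF H(2)] h k(1) by simp
    then have "inv k \<otimes> h \<otimes> k = h"
      using kc hc by (simp add: m_assoc inv_cancel_left)
    moreover have "conjugate g h = conjugate t (inv k \<otimes> h \<otimes> k)"
      using kc hc tc unfolding g_eq by (simp add: inv_mult_group m_assoc)
    ultimately have "conjugate g h = conjugate t h" by simp
    then show "conjugate g h \<in> (\<lambda>g. conjugate g h) ` T" using t(1) by blast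
  qed
  then show ?thesis using T(1) by (auto intro: finite_subset)
qed

text \<open>The colour of \<open>x\<close> is its coset of an abelian subgroup together with some
  time, modulo \<open>return_time\<close>, at which it is reached. Equal colours put the quotient
  both into the subgroup and into \<open>aperiodic\<close>. The colouring stands in for finite index
  of \<open>core\<close> in all later uses.\<close>

lemma finite_index_colouring:
  obtains c :: "'a \<Rightarrow> 'a set \<times> nat" where "finite (c ` carrier G)"
    "\<And>x y. x \<in> carrier G \<Longrightarrow> y \<in> carrier G \<Longrightarrow> c x = c y \<Longrightarrow> x \<otimes> inv y \<in> core"
proof -
  obtain H where H: "subgroup H G" "comm_group (G\<lparr>carrier := H\<rparr>)" "finite (rcosets H)"
    using virt_abelian unfolding virtually_abelian_def by blast
  define j where "j x = (SOME j. x \<in> set_pmf (walk j))" for x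
  have j: "x \<in> set_pmf (walk (j x))" if "x \<in> carrier G" for x
    unfolding j_def by (rule someI_ex) (use walk_cover[OF that] in blast)
  define c where "c x = (H #> x, j x mod return_time)" for x
  show ?thesis
  proof
    have "c ` carrier G \<subseteq> (rcosets H) \<times> {..<return_time}"
      using return_time(1) by (auto simp: c_def RCOSETS_def)
    then show "finite (c ` carrier G)"
      using H(3) by (meson finite_SigmaI finite_lessThan finite_subset)
    show "x \<otimes> inv y \<in> core" if xy: "x \<in> carrier G" "y \<in> carrier G" "c x = c y" for x y
    proof -
      have "x \<in> H #> y"
        using xy rcos_self[OF xy(1) H(1)] by (simp add: c_def)
      then obtain k where k: "k \<in> H" "x = k \<otimes> y" by (auto simp: r_coset_def)
      then have "x \<otimes> inv y = k"
        using xy subgroup.subset[OF H(1)] by (auto simp: m_assoc subset_iff)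
      moreover have "x \<otimes> inv y \<in> aperiodic"
        using mult_inv_aperiodic[OF j j] xy by (simp add: c_def)
      ultimately show ?thesis
        using finite_conj_of_abelian_subgroup[OF H] k(1) by (simp add: core_def)
    qed
  qed
qed

lemma core_transversal:
  obtains T where "finite T" "T \<subseteq> carrier G" "\<And>x. x \<in> carrier G \<Longrightarrow> \<exists>t\<in>T. x \<otimes> inv t \<in> core"
proof -
  obtain c :: "'a \<Rightarrow> 'a set \<times> nat" where c: "finite (c ` carrier G)"
    "\<And>x y. x \<in> carrier G \<Longrightarrow> y \<in> carrier G \<Longrightarrow> c x = c y \<Longrightarrow> x \<otimes> inv y \<in> core"
    by (rule finite_index_colouring) (rule that)
  from c(1) obtain T where "finite T" "T \<subseteq> carrier G" "\<And>x. x \<in> carrier G \<Longrightarrow> \<exists>t\<in>T. c x = c t"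
    by (rule finite_transversal) blast
  with c(2) that show ?thesis by (meson subsetD)
qed

text \<open>Pigeonhole on the colours of the powers of \<open>z\<close>.\<close>

lemma core_pow:
  assumes "z \<in> carrier G"
  shows "\<exists>p>0. z [^] (p::nat) \<in> core"
proof -
  obtain c :: "'a \<Rightarrow> 'a set \<times> nat" where c: "finite (c ` carrier G)"
    "\<And>x y. x \<in> carrier G \<Longrightarrow> y \<in> carrier G \<Longrightarrow> c x = c y \<Longrightarrow> x \<otimes> inv y \<in> core"
    by (rule finite_index_colouring) (rule that)
  have "finite (range (\<lambda>i::nat. c (z [^] i)))"
    using assms by (auto intro: finite_subset[OF _ c(1)])
  then have "\<not> inj (\<lambda>i::nat. c (z [^] i))"
    using finite_imageD by blast
  then obtain a b :: nat where ab: "a \<noteq> b" "c (z [^] a) = c (z [^] b)"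
    by (auto simp: inj_def)
  obtain i j :: nat where ij: "i < j" "c (z [^] j) = c (z [^] i)"
    using that[of a b] that[of b a] ab by (cases "a < b") auto
  have "z [^] j = z [^] (j - i) \<otimes> z [^] i"
    using assms ij(1) by (simp add: nat_pow_mult)
  then have "z [^] j \<otimes> inv (z [^] i) = z [^] (j - i)"
    using assms by (simp add: m_assoc)
  with c(2)[of "z [^] j" "z [^] i"] assms ij show ?thesis
    by (intro exI[of _ "j - i"]) simp
qed

end

section \<open>Two real inequalities behind the rate m^(-1/2)\<close>

text \<open>One block in the smoothing induction: a share \<open>c\<close> of the mass gains one
  coin, and this counts as a gain of \<open>c / 4\<close> coins for all of it. The loss is needed: 1
  / sqrt is convex, so for c between 0 and 1 the inequality is reversed when \<open>c / 4\<close> is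
  replaced by \<open>c\<close>.\<close>

lemma inverse_sqrt_concavity:
  fixes s c :: real
  assumes s: "1 \<le> s" and c: "0 \<le> c"
  shows "(1 - c) / sqrt s + c / sqrt (s + 1) \<le> 1 / sqrt (s + c / 4)"
proof -
  define a b d where "a = sqrt s" and "b = sqrt (s + 1)" and "d = sqrt (s + c / 4)"
  have a: "1 \<le> a" "a\<^sup>2 = s" and b: "a \<le> b" "b\<^sup>2 = a\<^sup>2 + 1" and d: "a \<le> d" "d\<^sup>2 = a\<^sup>2 + c / 4"
    using s c by (auto simp: a_def b_def d_def)
  \<comment> \<open>From s >= 1: b^2 = a^2 + 1 <= 2 a^2. The product (3/2) (5/2) = 15/4 below then
    fits under 4, the denominator in \<open>c / 4\<close>.\<close>
  have "b\<^sup>2 \<le> (3/2 * a)\<^sup>2"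
    using a b(2) one_le_power[OF a(1), of 2] by (simp add: power2_eq_square)
  then have b2: "b \<le> 3/2 * a"
    using a by (simp add: abs_le_square_iff[symmetric])
  have "b * (a + b) \<le> (3/2 * a) * (5/2 * a)"
    using b b2 a by (intro mult_mono) auto
  also have "\<dots> \<le> 4 * (a * a)" using a by simp
  finally have *: "b * (a + b) \<le> 4 * (a * a)" .
  have diff: "1 / u - 1 / v = (v\<^sup>2 - u\<^sup>2) / (u * v * (u + v))" if "0 < u" "0 < v" for u v :: real
    using that by (simp add: power2_eq_square divide_simps) (simp add: algebra_simps)
  have "1 / a - 1 / d = (d\<^sup>2 - a\<^sup>2) / (a * d * (a + d))"
    using a d by (intro diff) auto
  also have "\<dots> = (c / 4) / (a * (d * (a + d)))"
    using d by (simp add: mult.assoc)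
  also have "\<dots> \<le> (c / 4) / (a * (a * a))"
    using a d c by (intro divide_left_mono mult_left_mono mult_mono mult_pos_pos) auto
  also have "\<dots> = c / (a * (4 * (a * a)))" by simp
  also have "\<dots> \<le> c / (a * (b * (a + b)))"
    using a b c * by (intro divide_left_mono mult_left_mono mult_pos_pos) auto
  also have "\<dots> = c * ((b\<^sup>2 - a\<^sup>2) / (a * b * (a + b)))"
    using b by (simp add: mult.assoc)
  also have "(b\<^sup>2 - a\<^sup>2) / (a * b * (a + b)) = 1 / a - 1 / b"
    using a b by (intro diff[symmetric]) auto
  finally show ?thesis
    unfolding a_def[symmetric] b_def[symmetric] d_def[symmetric] by (simp add: diff_divide_distrib right_diff_distrib)
qed

text \<open>A contraction by \<open>1 - c\<close> every \<open>k\<close> steps turns a forcing term of order \<open>m\<^sup>-\<^sup>1\<^sup>/\<^sup>2\<close> into a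
  bound of the same order, because \<open>m\<^sup>-\<^sup>1\<^sup>/\<^sup>2\<close> decays subexponentially.\<close>

lemma contraction_inverse_sqrt:
  fixes a :: "nat \<Rightarrow> real"
  assumes k: "0 < k" and c: "0 < c" "c \<le> 1" and B: "0 \<le> B"
    and a2: "\<And>m. a m \<le> 2"
    and rec: "\<And>m. k \<le> m \<Longrightarrow> a m \<le> (1 - c) * a (m - k) + B / sqrt (real (Suc (m - k)))"
  shows "\<exists>C\<ge>0. \<forall>m. a m \<le> C / sqrt (real (Suc m))"
proof -
  \<comment> \<open>From \<open>m0\<close> on, going back \<open>k\<close> steps multiplies m + 1 by
    at least 1 - c / 2, which uses up half of the contraction. In \<open>C\<close> the first entry
    covers the times below \<open>m0\<close> by the trivial bound 2; the second makes
    \<open>B\<close> at most \<open>c * C / 2\<close>, the other half.\<close>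
  define m0 where "m0 = k + nat \<lceil>2 * real k / c\<rceil>"
  define C where "C = max (2 * sqrt (real (Suc m0))) (2 * B / c)"
  have C: "2 * sqrt (real (Suc m0)) \<le> C" "2 * B / c \<le> C"
    unfolding C_def by simp_all
  then have C0: "0 \<le> C"
    using order_trans[of 0 "2 * sqrt (real (Suc m0))" C] by simp
  have "a m \<le> C / sqrt (real (Suc m))" for m
  proof (induction m rule: less_induct)
    case (less m)
    show ?case
    proof (cases "m < m0")
      case True
      have "2 * sqrt (real (Suc m)) \<le> C"
        using C(1) True by (intro order_trans[OF _ C(1)]) auto
      then have "2 \<le> C / sqrt (real (Suc m))" by (simp add: field_simps)
      with a2[of m] show ?thesis by linarith
    next
      case False
      then have km: "k \<le> m" by (simp add: m0_def)
      define x y where "x = real (Suc m)" and "y = real (Suc (m - k))"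
      have xy: "0 < y" "y \<le> x" "x = y + real k"
        using km by (auto simp: x_def y_def of_nat_diff)
      have "2 * real k / c \<le> x"
        using False unfolding x_def m0_def by linarith
      then have "(1 - c / 2) * x \<le> y"
        using c xy(3) by (simp add: field_simps)
      then have "1 - c / 2 \<le> y / x" using xy by (simp add: field_simps)
      also have "y / x \<le> sqrt (y / x)"
        using xy mult_left_le[of "y / x" "y / x"]
        by (intro real_le_rsqrt) (auto simp: power2_eq_square)
      finally have *: "(1 - c / 2) \<le> sqrt y / sqrt x" by (simp add: real_sqrt_divide)
      have "m - k < m" using k km by simp
      then have "a m \<le> (1 - c) * (C / sqrt y) + B / sqrt y"
        using rec[OF km] mult_left_mono[OF less.IH[of "m - k"], of "1 - c"] c unfolding y_def by linarith
      also have "\<dots> = ((1 - c) * C + B) / sqrt y" by (simp add: add_divide_distrib)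
      also have "\<dots> \<le> ((1 - c / 2) * C) / sqrt y"
        using C(2) c xy by (intro divide_right_mono) (auto simp: field_simps)
      also have "\<dots> \<le> ((sqrt y / sqrt x) * C) / sqrt y"
        using * C0 xy by (intro divide_right_mono mult_right_mono) auto
      also have "\<dots> = C / sqrt x" using xy by simp
      finally show ?thesis by (simp add: x_def)
    qed
  qed
  with C0 show ?thesis by blast
qed

context va_random_walk
begin

subsection \<open>Translates of the law of the walk\<close>

definition shift_dist :: "nat \<Rightarrow> 'a \<Rightarrow> real" where
  "shift_dist m z = l1_dist (map_pmf (\<lambda>x. x \<otimes> z) (walk m)) (walk m)"

lemma shift_dist_le_2: "shift_dist m z \<le> 2"
  by (simp add: shift_dist_def l1_dist_le_2)

lemma shift_dist_leI:
  assumes "\<And>f. (\<And>x. \<bar>f x\<bar> \<le> 1) \<Longrightarrow>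
    \<bar>measure_pmf.expectation (walk m) (\<lambda>x. f (x \<otimes> z)) - measure_pmf.expectation (walk m) f\<bar> \<le> c"
  shows "shift_dist m z \<le> c"
  unfolding shift_dist_def by (rule l1_dist_leI) (use assms in simp)

text \<open>Write x y as (x (y w^(-1))) w and absorb the last factor into the test function: only
  the quotient of the two translations counts.\<close>

lemma expectation_shift_le:
  assumes f: "\<And>x. \<bar>f x\<bar> \<le> 1" and "y \<in> carrier G" "w \<in> carrier G"
  shows "\<bar>measure_pmf.expectation (walk m) (\<lambda>x. f (x \<otimes> y)) - measure_pmf.expectation (walk m) (\<lambda>x. f (x \<otimes> w))\<bar>
    \<le> shift_dist m (y \<otimes> inv w)"
proof -
  have "measure_pmf.expectation (walk m) (\<lambda>x. f (x \<otimes> y)) =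
      measure_pmf.expectation (walk m) (\<lambda>x. f ((x \<otimes> (y \<otimes> inv w)) \<otimes> w))"
    using assms walk_carrier' by (intro expectation_cong_pmf) (simp add: m_assoc)
  then show ?thesis
    using l1_distD1[of "\<lambda>x. f (x \<otimes> w)" "map_pmf (\<lambda>x. x \<otimes> (y \<otimes> inv w)) (walk m)" "walk m"] f
    by (simp add: shift_dist_def)
qed

lemma shift_dist_mult:
  assumes "y \<in> carrier G" "z \<in> carrier G"
  shows "shift_dist m (y \<otimes> z) \<le> shift_dist m y + shift_dist m z"
proof (rule shift_dist_leI)
  fix f :: "'a \<Rightarrow> real"
  assume f: "\<And>x. \<bar>f x\<bar> \<le> 1"
  have e: "(y \<otimes> z) \<otimes> inv z = y" "z \<otimes> inv \<one> = z" using assms by (simp_all add: m_assoc)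
  have "measure_pmf.expectation (walk m) (\<lambda>x. f (x \<otimes> \<one>)) = measure_pmf.expectation (walk m) f"
    using walk_carrier' by (intro expectation_cong_pmf) simp
  with expectation_shift_le[of f "y \<otimes> z" z m] expectation_shift_le[of f z \<one> m] f assms
  show "\<bar>measure_pmf.expectation (walk m) (\<lambda>x. f (x \<otimes> (y \<otimes> z))) - measure_pmf.expectation (walk m) f\<bar>
      \<le> shift_dist m y + shift_dist m z"
    unfolding e by auto
qed

lemma shift_dist_inv:
  assumes "z \<in> carrier G"
  shows "shift_dist m (inv z) \<le> shift_dist m z"
proof (rule shift_dist_leI)
  fix f :: "'a \<Rightarrow> real"
  assume f: "\<And>x. \<bar>f x\<bar> \<le> 1"
  have "measure_pmf.expectation (walk m) (\<lambda>x. f (x \<otimes> \<one>)) = measure_pmf.expectation (walk m) f"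
    using walk_carrier' by (intro expectation_cong_pmf) simp
  with expectation_shift_le[of f \<one> "inv z" m] f assms
  show "\<bar>measure_pmf.expectation (walk m) (\<lambda>x. f (x \<otimes> inv z)) - measure_pmf.expectation (walk m) f\<bar>
      \<le> shift_dist m z"
    by auto
qed

text \<open>The block \<open>b\<close> consists of the last \<open>k\<close> increments, so a
  translation by \<open>y\<close> after it acts on the earlier part as the translation by b y
  b^(-1).\<close>

lemma expectation_walk_split:
  fixes F :: "'a \<Rightarrow> real"
  assumes "k \<le> m" and F: "\<And>x. \<bar>F x\<bar> \<le> B"
  shows "measure_pmf.expectation (walk m) F =
    measure_pmf.expectation (walk k) (\<lambda>b. measure_pmf.expectation (walk (m - k)) (\<lambda>x. F (x \<otimes> b)))"
proof -
  have "walk m = convolution_pmf G (walk (m - k)) (walk k)"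
    using convolution_power_add[OF supp, of "m - k" k] assms(1) by simp
  then show ?thesis
    by (simp add: expectation_convolution_pmf_swap[of F B, OF F])
qed

text \<open>The weights of the walk at a suitable fixed time dominate a fair coin flip between \<open>\<one>\<close> and
  any conjugate \<open>y\<close> of \<open>h\<close>. Each such coin that is used raises the order of the binomial
  smoothing by one, and conjugating by the remaining increments only permutes the finitely many
  conjugates of \<open>h\<close>.\<close>

lemma shift_dist_core:
  assumes h: "h \<in> core"
  shows "\<exists>C\<ge>0. \<forall>m. \<forall>g\<in>carrier G. shift_dist m (conjugate g h) \<le> C / sqrt (real (Suc m))"
proof -
  define Y where "Y = (\<lambda>g. conjugate g h) ` carrier G"
  have hc: "h \<in> carrier G" using h aperiodic_carrier by (simp add: core_def)
  have Y: "finite Y" "Y \<subseteq> aperiodic"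
    using h aperiodic_conj by (auto simp: Y_def core_def)
  then have Yc: "Y \<subseteq> carrier G" using aperiodic_carrier by blast
  have Y_conj: "conjugate g y \<in> Y" if "g \<in> carrier G" "y \<in> Y" for g y
    using that hc by (auto simp: Y_def conj_conj)
  \<comment> \<open>Both faces of every coin, the identity and a conjugate of \<open>h\<close>, have
    to be reachable at the same time \<open>k\<close>; \<open>c\<close> is the least of their
    weights.\<close>
  have "finite (insert \<one> Y)" "insert \<one> Y \<subseteq> aperiodic"
    using Y aperiodic_one by auto
  from aperiodic_common_time[OF this] obtain k where k: "0 < k" "\<And>y. y \<in> insert \<one> Y \<Longrightarrow> y \<in> set_pmf (walk k)"
    by blast
  define c where "c = Min (pmf (walk k) ` insert \<one> Y)"
  have c_le: "c \<le> pmf (walk k) y" if "y \<in> insert \<one> Y" for y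
    unfolding c_def using that Y(1) by (intro Min_le) auto
  have "c \<in> pmf (walk k) ` insert \<one> Y"
    unfolding c_def using Y(1) by (intro Min_in) auto
  then have c: "0 < c" "c \<le> 1"
    using k(2) by (auto simp: pmf_le_1 intro: pmf_positive)
  \<comment> \<open>The difference of \<open>f\<close> along powers of \<open>y\<close>, averaged
    over \<open>j\<close> coins. The total weight 2^j is not divided out, so that Pascal's rule
    applies as it stands.\<close>
  define D :: "('a \<Rightarrow> real) \<Rightarrow> nat \<Rightarrow> 'a \<Rightarrow> 'a \<Rightarrow> real" where
    "D f j y x = (\<Sum>i\<le>j. real (j choose i) * (f (x \<otimes> y [^] i) - f (x \<otimes> y [^] Suc i)))" for f j y x
  have D_bound: "\<bar>D f j y x\<bar> \<le> 2 ^ j * (2 / sqrt (real (Suc j)))" if "\<And>x. \<bar>f x\<bar> \<le> 1" for f j y x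
    unfolding D_def using binomial_shift_bound[of "\<lambda>i. f (x \<otimes> y [^] i)" j] that by simp
  \<comment> \<open>Under the root stands an effective number of coins: the \<open>j + 1\<close> of
    the binomial bound plus \<open>c / 4\<close> for each block of \<open>k\<close> increments not
    yet used. Reading off a block changes both \<open>y\<close> and \<open>f\<close>, so the
    induction ranges over all of them.\<close>
  have main: "\<bar>measure_pmf.expectation (walk m) (D f j y)\<bar> \<le> 2 ^ j * (2 / sqrt (real (Suc j) + c / 4 * real (m div k)))"
    if "y \<in> Y" and "\<And>x. \<bar>f x\<bar> \<le> 1" for m f j y
    using that
  proof (induction m arbitrary: f j y rule: less_induct)
    case (less m)
    note y = \<open>y \<in> Y\<close> and f = \<open>\<And>x. \<bar>f x\<bar> \<le> 1\<close>
    from y Yc have yc: "y \<in> carrier G" by blast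
    show ?case
    proof (cases "m < k")
      case True
      then show ?thesis
        using abs_expectation_le_const[of "walk m" "D f j y", OF D_bound[OF f]] by simp
    next
      case False
      define M where "M = (m - k) div k"
      have M: "m div k = Suc M" using False k(1) by (simp add: M_def le_div_geq)
      define s where "s = real (Suc j) + c / 4 * real M"
      have s: "1 \<le> s" using c by (simp add: s_def)
      define \<Psi> where "\<Psi> b = measure_pmf.expectation (walk (m - k)) (\<lambda>x. D f j y (x \<otimes> b))" for b
      have IH: "\<bar>measure_pmf.expectation (walk (m - k)) (D f' j' y')\<bar> \<le> 2 ^ j' * (2 / sqrt (real (Suc j') + c / 4 * real M))"
        if "y' \<in> Y" "\<And>x. \<bar>f' x\<bar> \<le> 1" for f' j' y'
        unfolding M_def using False k(1) that by (intro less.IH) auto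
      have \<Psi>: "\<bar>\<Psi> b\<bar> \<le> 2 ^ j * (2 / sqrt s)" if "b \<in> set_pmf (walk k)" for b
      proof -
        have b: "b \<in> carrier G" using that by (rule walk_carrier')
        \<comment> \<open>Moving the block to the right end turns \<open>y\<close> into its
          conjugate and hands \<open>b\<close> over to the test function.\<close>
        have eq: "(x \<otimes> b) \<otimes> y [^] i = (x \<otimes> conjugate b y [^] i) \<otimes> b" if "x \<in> carrier G" for x and i :: nat
          unfolding conj_pow[OF b yc] using that b yc by (simp add: m_assoc)
        have "D f j y (x \<otimes> b) = D (\<lambda>w. f (w \<otimes> b)) j (conjugate b y) x" if "x \<in> carrier G" for x
          unfolding D_def eq[OF that] ..
        then have "\<Psi> b = measure_pmf.expectation (walk (m - k)) (D (\<lambda>w. f (w \<otimes> b)) j (conjugate b y))"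
          unfolding \<Psi>_def using walk_carrier' by (intro expectation_cong_pmf) blast
        then show ?thesis
          using IH[of "conjugate b y" "\<lambda>w. f (w \<otimes> b)" j] Y_conj[OF b y] f by (simp add: s_def)
      qed
      define z where "z i = (if i = 0 then \<one> else y)" for i :: nat
      have int: "integrable (measure_pmf (walk (m - k))) (\<lambda>x. D f j y (x \<otimes> b))" for b
        by (rule integrable_pmf_bounded[where B = "2 ^ j * (2 / sqrt (real (Suc j)))"]) (rule D_bound[OF f])
      \<comment> \<open>The two faces together form a binomial sum of order \<open>j + 1\<close>:
        this is the gain from s to s + 1.\<close>
      have "D f j y (x \<otimes> \<one>) + D f j y (x \<otimes> y) = D f (Suc j) y x" if x: "x \<in> carrier G" for x
      proof -
        have eq: "(x \<otimes> y) \<otimes> y [^] i = x \<otimes> y [^] Suc i" for i :: nat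
          using x yc nat_pow_Suc2[OF yc, of i] by (simp add: m_assoc del: nat_pow_Suc)
        show ?thesis
          unfolding D_def sum_binomial_Suc eq r_one[OF x] by (simp only: sum.distrib distrib_left)
      qed
      then have "\<Psi> \<one> + \<Psi> y = measure_pmf.expectation (walk (m - k)) (D f (Suc j) y)"
        unfolding \<Psi>_def Bochner_Integration.integral_add[OF int int, symmetric]
        using walk_carrier' by (intro expectation_cong_pmf) blast
      also have "\<bar>\<dots>\<bar> \<le> 2 ^ Suc j * (2 / sqrt (s + 1))"
        using IH[of y f "Suc j", OF y f] by (simp add: s_def algebra_simps)
      finally have \<Psi>z: "\<bar>\<Sum>i<2. \<Psi> (z i)\<bar> \<le> real 2 * (2 ^ j * (2 / sqrt (s + 1)))"
        by (simp add: z_def numeral_2_eq_2)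
      have "\<bar>measure_pmf.expectation (walk m) (D f j y)\<bar> = \<bar>measure_pmf.expectation (walk k) \<Psi>\<bar>"
        unfolding \<Psi>_def using False
        by (subst expectation_walk_split[of k m "D f j y", OF _ D_bound[OF f]]) auto
      also have "\<bar>measure_pmf.expectation (walk k) \<Psi>\<bar> \<le> measure_pmf.expectation (walk k) (\<lambda>_. 2 ^ j * (2 / sqrt s))
          - c * ((\<Sum>i<(2::nat). 2 ^ j * (2 / sqrt s)) / real 2) + c * (2 ^ j * (2 / sqrt (s + 1)))"
      proof (rule expectation_coin_bound[where z = z and n = 2])
        show "\<bar>\<Psi> b\<bar> \<le> 2 ^ j * (2 / sqrt s)" if "b \<in> set_pmf (walk k)" for b
          using that by (rule \<Psi>)
        show "\<bar>\<Sum>i<2. \<Psi> (z i)\<bar> \<le> real 2 * (2 ^ j * (2 / sqrt (s + 1)))"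
          by (rule \<Psi>z)
      qed (use c c_le k(2) y in \<open>auto simp: z_def\<close>)
      also have "\<dots> = 2 ^ j * 2 * ((1 - c) / sqrt s + c / sqrt (s + 1))"
        by (simp add: algebra_simps diff_divide_distrib)
      also have "\<dots> \<le> 2 ^ j * 2 * (1 / sqrt (s + c / 4))"
        using inverse_sqrt_concavity[OF s, of c] c by (intro mult_left_mono) auto
      also have "s + c / 4 = real (Suc j) + c / 4 * real (m div k)"
        by (simp add: M s_def distrib_left)
      finally show ?thesis by simp
    qed
  qed
  \<comment> \<open>The constant is 2 / sqrt (c / (4 k)), after m + 1 <= k (m div k + 1).\<close>
  define C where "C = 2 * sqrt (4 * real k / c)"
  have "shift_dist m y \<le> C / sqrt (real (Suc m))" if y: "y \<in> Y" for m y
  proof (rule shift_dist_leI)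
    fix f :: "'a \<Rightarrow> real"
    assume f: "\<And>x. \<bar>f x\<bar> \<le> 1"
    have yc: "y \<in> carrier G" using y Yc by blast
    have "measure_pmf.expectation (walk m) (D f 0 y) =
        measure_pmf.expectation (walk m) (\<lambda>x. f x - f (x \<otimes> y))"
      using walk_carrier' yc by (intro expectation_cong_pmf) (auto simp: D_def)
    also have "\<dots> = measure_pmf.expectation (walk m) f - measure_pmf.expectation (walk m) (\<lambda>x. f (x \<otimes> y))"
      by (intro Bochner_Integration.integral_diff integrable_pmf_bounded[where B = 1] f)
    finally have "\<bar>measure_pmf.expectation (walk m) (\<lambda>x. f (x \<otimes> y)) - measure_pmf.expectation (walk m) f\<bar>
        \<le> 2 / sqrt (1 + c / 4 * real (m div k))"
      using main[of y f m 0, OF y f] by simp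
    also have "\<dots> \<le> 2 / sqrt (c / (4 * real k) * real (Suc m))"
    proof -
      have "Suc m \<le> k * Suc (m div k)"
        using mult_div_mod_eq[of k m] mod_less_divisor[OF k(1), of m] by (simp only: mult_Suc_right)
      then have "real (Suc m) \<le> real k * real (Suc (m div k))"
        by (metis of_nat_le_iff of_nat_mult)
      then have "c / (4 * real k) * real (Suc m) \<le> c / (4 * real k) * (real k * real (Suc (m div k)))"
        using c by (intro mult_left_mono) auto
      also have "\<dots> = c / 4 * real (Suc (m div k))" using k(1) by simp
      also have "\<dots> \<le> 1 + c / 4 * real (m div k)" using c by (simp add: algebra_simps)
      finally show ?thesis
        using c k(1) by (intro divide_left_mono real_sqrt_le_mono mult_pos_pos) (auto intro: add_pos_nonneg)
    qed
    also have "\<dots> = C / sqrt (real (Suc m))"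
      using c k(1) by (simp add: C_def real_sqrt_mult real_sqrt_divide)
    finally show "\<bar>measure_pmf.expectation (walk m) (\<lambda>x. f (x \<otimes> y)) - measure_pmf.expectation (walk m) f\<bar>
        \<le> C / sqrt (real (Suc m))" .
  qed
  then show ?thesis
    using c by (intro exI[of _ C]) (auto simp: Y_def C_def)
qed

text \<open>Bounding all conjugates at once makes the constant behave like a conjugation-invariant
  length: it adds up under products and is kept by inverses.\<close>

definition smoothed :: "real \<Rightarrow> 'a \<Rightarrow> bool" where
  "smoothed C h \<longleftrightarrow> h \<in> aperiodic \<and> (\<forall>m. \<forall>g\<in>carrier G. shift_dist m (conjugate g h) \<le> C / sqrt (real (Suc m)))"

lemma smoothedD:
  assumes "smoothed C h"
  shows "h \<in> aperiodic" "h \<in> carrier G"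
    "g \<in> carrier G \<Longrightarrow> shift_dist m (conjugate g h) \<le> C / sqrt (real (Suc m))"
    "shift_dist m h \<le> C / sqrt (real (Suc m))"
proof -
  show h: "h \<in> aperiodic" "h \<in> carrier G"
    using assms aperiodic_carrier by (auto simp: smoothed_def)
  show *: "shift_dist m (conjugate g h) \<le> C / sqrt (real (Suc m))" if "g \<in> carrier G" for g
    using assms that by (simp add: smoothed_def)
  from *[of \<one>] h show "shift_dist m h \<le> C / sqrt (real (Suc m))" by simp
qed

lemma smoothed_mono:
  assumes "smoothed C h" "C \<le> C'"
  shows "smoothed C' h"
proof -
  have "C / sqrt (real (Suc m)) \<le> C' / sqrt (real (Suc m))" for m
    using assms(2) by (intro divide_right_mono) auto
  with assms(1) show ?thesis
    unfolding smoothed_def by (meson order_trans)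
qed

lemma smoothed_mult:
  assumes "smoothed C x" "smoothed C' y"
  shows "smoothed (C + C') (x \<otimes> y)"
  unfolding smoothed_def
proof (intro conjI allI ballI)
  show "x \<otimes> y \<in> aperiodic"
    using assms by (intro aperiodic_mult smoothedD(1))
  fix m g assume g: "g \<in> carrier G"
  have "shift_dist m (conjugate g (x \<otimes> y)) \<le> shift_dist m (conjugate g x) + shift_dist m (conjugate g y)"
    using g assms[THEN smoothedD(2)] by (simp only: conj_mult) (intro shift_dist_mult, auto)
  also have "\<dots> \<le> C / sqrt (real (Suc m)) + C' / sqrt (real (Suc m))"
    using g assms by (intro add_mono smoothedD(3))
  finally show "shift_dist m (conjugate g (x \<otimes> y)) \<le> (C + C') / sqrt (real (Suc m))"
    by (simp add: add_divide_distrib)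
qed

lemma smoothed_inv:
  assumes "smoothed C x"
  shows "smoothed C (inv x)"
  unfolding smoothed_def
proof (intro conjI allI ballI)
  show "inv x \<in> aperiodic"
    using assms by (intro aperiodic_inv smoothedD(1))
  fix m g assume g: "g \<in> carrier G"
  have "shift_dist m (conjugate g (inv x)) \<le> shift_dist m (conjugate g x)"
    using g smoothedD(2)[OF assms] shift_dist_inv[of "conjugate g x" m] by (simp add: conj_inv)
  also have "\<dots> \<le> C / sqrt (real (Suc m))"
    using assms g by (rule smoothedD(3))
  finally show "shift_dist m (conjugate g (inv x)) \<le> C / sqrt (real (Suc m))" .
qed

lemma core_smoothed: "h \<in> core \<Longrightarrow> \<exists>C\<ge>0. smoothed C h"
  using shift_dist_core[of h] by (auto simp: smoothed_def core_def)

lemma finite_core_smoothed: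
  assumes "finite W" "W \<subseteq> core"
  shows "\<exists>C\<ge>0. \<forall>x\<in>W. smoothed C x"
  using assms
proof (induction W)
  case empty
  then show ?case by auto
next
  case (insert x W)
  then obtain C C' where "C \<ge> 0" "\<forall>x\<in>W. smoothed C x" "smoothed C' x"
    using core_smoothed[of x] by auto
  then show ?case
    by (intro exI[of _ "max C C'"]) (auto intro: smoothed_mono)
qed

text \<open>Schreier rewriting: reading a word letter by letter and passing to coset representatives
  after each letter writes its \<open>core\<close> part as a product of one factor for each letter, and the
  possible factors form a finite set.\<close>

lemma schreier_decomposition:
  obtains T C where "finite T" "T \<subseteq> carrier G" "0 \<le> C"
    "\<And>g. g \<in> carrier G \<Longrightarrow> \<exists>t\<in>T. \<exists>h. g = h \<otimes> t \<and> smoothed (C * (len g + 1)) h"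
proof -
  obtain T where T: "finite T" "T \<subseteq> carrier G" "\<And>x. x \<in> carrier G \<Longrightarrow> \<exists>t\<in>T. x \<otimes> inv t \<in> core"
    by (rule core_transversal) (rule that)
  define L where "L = insert \<one> (gens \<union> m_inv G ` gens)"
  have L: "finite L" "L \<subseteq> carrier G"
    using finite_gens letters_subset by (auto simp: L_def)
  \<comment> \<open>The Schreier generators. The identity is added to \<open>T\<close> because
    reading starts there, and to the letters so that the empty word also yields a factor; a word of
    length n thus gives n + 1 factors.\<close>
  define W where "W = core \<inter> (\<lambda>(t, s, t'). t \<otimes> s \<otimes> inv t') ` (insert \<one> T \<times> L \<times> T)"
  have "finite W" "W \<subseteq> core"
    unfolding W_def using T(1) L(1) by auto
  from finite_core_smoothed[OF this] obtain C where C: "0 \<le> C" "\<And>x. x \<in> W \<Longrightarrow> smoothed C x" by blast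
  have step: "\<exists>t'\<in>T. \<exists>x. t \<otimes> s = x \<otimes> t' \<and> smoothed C x" if "t \<in> insert \<one> T" "s \<in> L" for t s
  proof -
    have ts: "t \<in> carrier G" "s \<in> carrier G" using that T(2) L(2) by auto
    then obtain t' where t': "t' \<in> T" "t \<otimes> s \<otimes> inv t' \<in> core" using T(3)[of "t \<otimes> s"] by auto
    then have "t \<otimes> s \<otimes> inv t' \<in> W" using that by (force simp: W_def)
    moreover have "t \<otimes> s = t \<otimes> s \<otimes> inv t' \<otimes> t'"
      using ts t'(1) T(2) by (auto simp: m_assoc subset_iff)
    ultimately show ?thesis using t'(1) C(2) by blast
  qed
  have main: "\<exists>t\<in>T. \<exists>h. g = h \<otimes> t \<and> smoothed (C * (real n + 1)) h" if "is_word n g" for n g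
    using that
  proof (induction n arbitrary: g)
    case 0
    then have g: "g = \<one>" by (simp add: is_word_def)
    have "\<one> \<in> L" by (simp add: L_def)
    from step[OF insertI1 this] show ?case by (simp add: g)
  next
    case (Suc n)
    from Suc.prems obtain g' s where gs: "is_word n g'" "s \<in> gens \<union> m_inv G ` gens" "g = g' \<otimes> s"
      by (rule is_word_Suc)
    from Suc.IH[OF gs(1)] obtain t h where t: "t \<in> T" "g' = h \<otimes> t" "smoothed (C * (real n + 1)) h" by blast
    have s: "s \<in> L" using gs(2) by (simp add: L_def)
    from step[of t s] t(1) s obtain t' x where t': "t' \<in> T" "t \<otimes> s = x \<otimes> t'" "smoothed C x" by blast
    have car: "h \<in> carrier G" "t \<in> carrier G" "s \<in> carrier G" "x \<in> carrier G" "t' \<in> carrier G"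
      using t t' s T(2) L(2) smoothedD(2) by auto
    have "g = h \<otimes> x \<otimes> t'"
      using car t'(2) by (simp add: gs(3) t(2) m_assoc)
    moreover have "smoothed (C * (real (Suc n) + 1)) (h \<otimes> x)"
      using smoothed_mult[OF t(3) t'(3)] by (simp add: algebra_simps)
    ultimately show ?case using t'(1) by blast
  qed
  show ?thesis
    by (rule that[OF T(1,2) C(1)]) (use main is_word_word_length in blast)
qed

text \<open>Elements with infinitely many conjugates. A conjugate \<open>b z b\<^sup>-\<^sup>1\<close> differs from one of finitely
  many conjugates \<open>z'\<close> of \<open>z\<close> by an element \<open>h (z' h\<^sup>-\<^sup>1 z'\<^sup>-\<^sup>1)\<close> of the core, whose cost is linear in the
  length of \<open>b\<close>; and averaging over the powers of \<open>z\<close> below the order \<open>p\<close> of \<open>z\<close> modulo the core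
  replaces \<open>z\<close> by \<open>z\<^sup>p\<close>. This yields a contraction.\<close>

lemma shift_dist_aperiodic:
  assumes z: "z \<in> aperiodic"
  shows "\<exists>C\<ge>0. \<forall>m. shift_dist m z \<le> C / sqrt (real (Suc m))"
proof -
  have zc: "z \<in> carrier G" using z by (rule aperiodic_carrier)
  obtain T C where T0: "finite T" "T \<subseteq> carrier G" and C: "0 \<le> C"
    "\<And>g. g \<in> carrier G \<Longrightarrow> \<exists>t\<in>T. \<exists>h. g = h \<otimes> t \<and> smoothed (C * (len g + 1)) h"
    by (rule schreier_decomposition) (rule that)
  \<comment> \<open>With the identity added, \<open>z\<close> itself is among the conjugates over
    which the maximum \<open>a\<close> is taken.\<close>
  define T' where "T' = insert \<one> T"
  have T: "finite T'" "T' \<subseteq> carrier G" "T' \<noteq> {}" "\<one> \<in> T'" using T0 by (auto simp: T'_def)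
  obtain p :: nat where p: "0 < p" "z [^] p \<in> core" using core_pow[OF zc] by blast
  obtain C4 where C4: "0 \<le> C4" "smoothed C4 (z [^] p)" using core_smoothed[OF p(2)] by blast
  \<comment> \<open>The faces of a coin with \<open>p\<close> sides: the powers below
    \<open>p\<close>, for each representative conjugate.\<close>
  define Y where "Y = (\<lambda>(t, i). conjugate t z [^] i) ` (T' \<times> {..<p})"
  have Y: "finite Y" "Y \<subseteq> aperiodic"
    using T aperiodic_pow aperiodic_conj z by (auto simp: Y_def)
  from aperiodic_common_time[OF this] obtain k where k: "0 < k" "\<And>y. y \<in> Y \<Longrightarrow> y \<in> set_pmf (walk k)"
    by blast
  have Yne: "Y \<noteq> {}" using T p(1) by (auto simp: Y_def)
  define c where "c = Min (pmf (walk k) ` Y)"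
  have c_le: "c \<le> pmf (walk k) y" if "y \<in> Y" for y
    unfolding c_def using that Y(1) by (intro Min_le) auto
  have "c \<in> pmf (walk k) ` Y"
    unfolding c_def using Y(1) Yne by (intro Min_in) auto
  then have c: "0 < c" "c \<le> 1"
    using k(2) by (auto simp: pmf_le_1 intro: pmf_positive)
  define a where "a m = Max ((\<lambda>t. shift_dist m (conjugate t z)) ` T')" for m
  have a_ge: "shift_dist m (conjugate t z) \<le> a m" if "t \<in> T'" for m t
    unfolding a_def using that T(1) by (intro Max_ge) auto
  have a_in: "\<exists>t\<in>T'. a m = shift_dist m (conjugate t z)" for m
  proof -
    have "a m \<in> (\<lambda>t. shift_dist m (conjugate t z)) ` T'"
      unfolding a_def using T by (intro Max_in) auto
    then show ?thesis by auto
  qed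
  define l where "l = (\<Sum>t\<in>T'. len t)"
  have l: "len t \<le> l" if "t \<in> T'" for t
    unfolding l_def using that T(1) by (intro member_le_sum) auto
  have l0: "0 \<le> l" by (simp add: l_def sum_nonneg)
  define e where "e = measure_pmf.expectation (walk k) len"
  have e0: "0 \<le> e" by (simp add: e_def)
  define B where "B = 2 * C * (e + l + 1) + C4"
  have B: "0 \<le> B" using C(1) C4(1) e0 l0 by (simp add: B_def)
  have rec: "a m \<le> (1 - c) * a (m - k) + B / sqrt (real (Suc (m - k)))" if "k \<le> m" for m
  proof -
    define r where "r = 1 / sqrt (real (Suc (m - k)))"
    have r0: "0 \<le> r" by (simp add: r_def)
    obtain t where t: "t \<in> T'" "a m = shift_dist m (conjugate t z)" using a_in by blast
    then have tc: "t \<in> carrier G" using T(2) by blast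
    define y where "y = conjugate t z"
    have yc: "y \<in> carrier G" using tc zc by (simp add: y_def)
    have yY: "y [^] i \<in> Y" if "i < p" for i :: nat
      using that t(1) by (force simp: Y_def y_def)
    \<comment> \<open>The bound depends on the block \<open>b\<close> through its length; only its
      expectation, finite by \<open>integrable_len_walk\<close>, reaches the recursion.\<close>
    define u where "u b = 2 * C * r * (len b + (l + 1)) + a (m - k)" for b
    have iu: "integrable (measure_pmf (walk k)) u"
      unfolding u_def using integrable_len_walk[of k] by simp
    have Eu: "measure_pmf.expectation (walk k) u = 2 * C * r * (e + (l + 1)) + a (m - k)"
      unfolding u_def e_def using integrable_len_walk[of k] by simp
    have conj_bound: "shift_dist (m - k) (conjugate b y) \<le> u b" if b: "b \<in> carrier G" for b
    proof -
      have btc: "b \<otimes> t \<in> carrier G" using b tc by simp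
      from C(2)[OF this] obtain t' h where th: "t' \<in> T" "b \<otimes> t = h \<otimes> t'" "smoothed (C * (len (b \<otimes> t) + 1)) h"
        by blast
      have hc: "h \<in> carrier G" "t' \<in> carrier G" using th(1) smoothedD(2)[OF th(3)] T0(2) by auto
      define z' where "z' = conjugate t' z"
      have z'c: "z' \<in> carrier G" using hc zc by (simp add: z'_def)
      have "conjugate b y = conjugate (h \<otimes> t') z"
        unfolding y_def conj_conj[OF b tc zc] th(2) ..
      also have "\<dots> = conjugate h z'"
        unfolding z'_def using conj_conj[OF hc zc] by simp
      also have "\<dots> = h \<otimes> (conjugate z' (inv h) \<otimes> z')"
        using hc z'c by (simp add: m_assoc)
      finally have "shift_dist (m - k) (conjugate b y) \<le>
          shift_dist (m - k) h + (shift_dist (m - k) (conjugate z' (inv h)) + shift_dist (m - k) z')"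
        using hc z'c by (simp, intro order_trans[OF shift_dist_mult] add_left_mono shift_dist_mult) auto
      also have "\<dots> \<le> C * (len (b \<otimes> t) + 1) * r + (C * (len (b \<otimes> t) + 1) * r + a (m - k))"
        using smoothedD(4)[OF th(3), of "m - k"] smoothedD(3)[OF smoothed_inv[OF th(3)] z'c, of "m - k"]
          a_ge[of t' "m - k"] th(1)
        by (intro add_mono) (auto simp: r_def z'_def T'_def)
      also have "\<dots> = 2 * C * r * (len (b \<otimes> t) + 1) + a (m - k)"
        by (simp add: algebra_simps)
      also have "\<dots> \<le> u b"
        unfolding u_def using len_mult[OF b tc] l[OF t(1)] C(1) r0
        by (intro add_right_mono mult_left_mono) auto
      finally show ?thesis .
    qed
    have "shift_dist m y \<le> (1 - c) * a (m - k) + B * r"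
    proof (rule shift_dist_leI)
      fix f :: "'a \<Rightarrow> real"
      assume f: "\<And>x. \<bar>f x\<bar> \<le> 1"
      define \<Psi> where "\<Psi> b = measure_pmf.expectation (walk (m - k)) (\<lambda>x. f (x \<otimes> (b \<otimes> y))) -
        measure_pmf.expectation (walk (m - k)) (\<lambda>x. f (x \<otimes> b))" for b
      have \<Psi>: "\<bar>\<Psi> b\<bar> \<le> u b" if "b \<in> set_pmf (walk k)" for b
      proof -
        have b: "b \<in> carrier G" using that by (rule walk_carrier')
        have "\<bar>\<Psi> b\<bar> \<le> shift_dist (m - k) (conjugate b y)"
          unfolding \<Psi>_def using expectation_shift_le[OF f, of "b \<otimes> y" b] b yc by simp
        also have "\<dots> \<le> u b" using b by (rule conj_bound)
        finally show ?thesis .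
      qed
      \<comment> \<open>Translating y^i by y gives y^(i+1), so the faces telescope to one
        translation by y^p. This is a conjugate of z^p, which the core estimate covers.\<close>
      have "(\<Sum>i<p. \<Psi> (y [^] i)) =
          (\<Sum>i<p. measure_pmf.expectation (walk (m - k)) (\<lambda>x. f (x \<otimes> y [^] Suc i)) -
                  measure_pmf.expectation (walk (m - k)) (\<lambda>x. f (x \<otimes> y [^] i)))"
        by (simp add: \<Psi>_def)
      also have "\<dots> = measure_pmf.expectation (walk (m - k)) (\<lambda>x. f (x \<otimes> y [^] p)) -
          measure_pmf.expectation (walk (m - k)) (\<lambda>x. f (x \<otimes> y [^] (0::nat)))"
        by (rule sum_lessThan_telescope)
      also have "\<bar>\<dots>\<bar> \<le> shift_dist (m - k) (y [^] p)"
        using expectation_shift_le[OF f, of "y [^] p" "\<one>" "m - k"] yc by simp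
      also have "\<dots> \<le> C4 * r"
        unfolding y_def conj_pow[OF tc zc] using smoothedD(3)[OF C4(2) tc, of "m - k"] by (simp add: r_def)
      finally have sum\<Psi>: "\<bar>\<Sum>i<p. \<Psi> (y [^] i)\<bar> \<le> real p * (C4 * r / real p)"
        using p(1) by simp
      have fy: "measure_pmf.expectation (walk m) (\<lambda>x. f (x \<otimes> y)) =
          measure_pmf.expectation (walk k) (\<lambda>b. measure_pmf.expectation (walk (m - k)) (\<lambda>x. f (x \<otimes> (b \<otimes> y))))"
        unfolding expectation_walk_split[of k m "\<lambda>x. f (x \<otimes> y)" 1, OF \<open>k \<le> m\<close> f]
        by (intro expectation_cong_pmf) (use yc walk_carrier' in \<open>auto simp: m_assoc\<close>)
      have "measure_pmf.expectation (walk m) (\<lambda>x. f (x \<otimes> y)) - measure_pmf.expectation (walk m) f =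
          measure_pmf.expectation (walk k) \<Psi>"
        unfolding fy expectation_walk_split[of k m f 1, OF \<open>k \<le> m\<close> f] \<Psi>_def
        by (intro Bochner_Integration.integral_diff[symmetric] integrable_pmf_bounded[where B = 1]
            abs_expectation_le_const f)
      also have "\<bar>\<dots>\<bar> \<le> measure_pmf.expectation (walk k) u - c * ((\<Sum>i<p. u (y [^] i)) / real p)
          + c * (C4 * r / real p)"
        by (rule expectation_coin_bound[where z = "\<lambda>i. y [^] i", OF iu \<Psi> p(1) _ _ _ sum\<Psi>])
           (use c c_le k(2) yY in auto)
      also have "\<dots> \<le> (2 * C * r * (e + (l + 1)) + a (m - k)) - c * a (m - k) + C4 * r"
      proof (intro add_mono diff_mono)
        \<comment> \<open>At the faces only the part \<open>a (m - k)\<close> of \<open>u\<close> is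
          kept. This produces the factor 1 - c; the length costs go into the forcing term.\<close>
        have "real p * a (m - k) \<le> (\<Sum>i<p. u (y [^] i))"
          unfolding u_def using C(1) r0 l0 by (intro sum_bounded_below[where A = "{..<p}", simplified]) auto
        then show "c * a (m - k) \<le> c * ((\<Sum>i<p. u (y [^] i)) / real p)"
          using c p(1) by (intro mult_left_mono) (auto simp: field_simps)
        have "c * (C4 * r / real p) \<le> 1 * (C4 * r / 1)"
          using c p(1) C4(1) r0 by (intro mult_mono divide_left_mono) auto
        then show "c * (C4 * r / real p) \<le> C4 * r" by simp
      qed (simp add: Eu)
      also have "\<dots> = (1 - c) * a (m - k) + B * r"
        by (simp add: B_def algebra_simps)
      finally show "\<bar>measure_pmf.expectation (walk m) (\<lambda>x. f (x \<otimes> y)) - measure_pmf.expectation (walk m) f\<bar>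
          \<le> (1 - c) * a (m - k) + B * r" .
    qed
    then show ?thesis by (simp add: t(2) y_def r_def)
  qed
  have "a m \<le> 2" for m using a_in[of m] shift_dist_le_2 by auto
  from contraction_inverse_sqrt[OF k(1) c B this rec] obtain C' where
    C': "0 \<le> C'" "\<And>m. a m \<le> C' / sqrt (real (Suc m))" by blast
  have "shift_dist m z \<le> C' / sqrt (real (Suc m))" for m
    using a_ge[OF T(4), of m] C'(2)[of m] zc by simp
  with C'(1) show ?thesis by blast
qed

text \<open>With a smoothed part times a representative for each element, y x^(-1) becomes h (t
  t'^(-1)) h'^(-1). The middle factor is in \<open>aperiodic\<close> because the quotient and both
  smoothed parts are, and it takes finitely many values, so the element-dependent constants of
  \<open>shift_dist_aperiodic\<close> can be summed.\<close>

lemma shift_dist_support: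
  "\<exists>C\<ge>0. \<forall>m. \<forall>x\<in>set_pmf \<mu>. \<forall>y\<in>set_pmf \<mu>.
     shift_dist m (y \<otimes> inv x) \<le> C * (len x + len y + 1) / sqrt (real (Suc m))"
proof -
  obtain T C where T: "finite T" "T \<subseteq> carrier G" and C: "0 \<le> C"
    "\<And>g. g \<in> carrier G \<Longrightarrow> \<exists>t\<in>T. \<exists>h. g = h \<otimes> t \<and> smoothed (C * (len g + 1)) h"
    by (rule schreier_decomposition) (rule that)
  define W where "W = aperiodic \<inter> (\<lambda>(t, t'). t \<otimes> inv t') ` (T \<times> T)"
  have "finite W" using T(1) by (simp add: W_def)
  have "\<forall>w\<in>W. \<exists>C\<ge>0. \<forall>m. shift_dist m w \<le> C / sqrt (real (Suc m))"
    using shift_dist_aperiodic by (auto simp: W_def)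
  then obtain D where D: "\<And>w. w \<in> W \<Longrightarrow> 0 \<le> D w" "\<And>w m. w \<in> W \<Longrightarrow> shift_dist m w \<le> D w / sqrt (real (Suc m))"
    by metis
  define C3 where "C3 = (\<Sum>w\<in>W. D w)"
  have C3: "0 \<le> C3" "\<And>w. w \<in> W \<Longrightarrow> D w \<le> C3"
    unfolding C3_def using D(1) \<open>finite W\<close> by (auto intro: sum_nonneg member_le_sum)
  have "shift_dist m (y \<otimes> inv x) \<le> (2 * C + C3) * (len x + len y + 1) / sqrt (real (Suc m))"
    if x: "x \<in> set_pmf \<mu>" and y: "y \<in> set_pmf \<mu>" for m x y
  proof -
    have xy: "x \<in> carrier G" "y \<in> carrier G" using x y supp by auto
    obtain t h where t: "t \<in> T" "y = h \<otimes> t" "smoothed (C * (len y + 1)) h" using C(2)[OF xy(2)] by blast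
    obtain t' h' where t': "t' \<in> T" "x = h' \<otimes> t'" "smoothed (C * (len x + 1)) h'" using C(2)[OF xy(1)] by blast
    have car: "h \<in> carrier G" "h' \<in> carrier G" "t \<in> carrier G" "t' \<in> carrier G"
      using t t' smoothedD(2) T(2) by auto
    define w where "w = t \<otimes> inv t'"
    have wc: "w \<in> carrier G" using car by (simp add: w_def)
    have eq: "y \<otimes> inv x = h \<otimes> (w \<otimes> inv h')"
      using car by (simp add: t(2) t'(2) w_def inv_mult_group m_assoc)
    have "y \<otimes> inv x \<in> aperiodic"
      using mult_inv_aperiodic[of y 1 x 1] x y convolution_power_1[OF supp] by simp
    then have "inv h \<otimes> (y \<otimes> inv x) \<otimes> h' \<in> aperiodic"
      using aperiodic_mult[OF aperiodic_mult[OF aperiodic_inv[OF smoothedD(1)[OF t(3)]]] smoothedD(1)[OF t'(3)]]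
      by simp
    also have "inv h \<otimes> (y \<otimes> inv x) \<otimes> h' = w"
      unfolding eq using car wc by (simp add: m_assoc inv_cancel_left)
    finally have w: "w \<in> W" using t(1) t'(1) by (force simp: W_def w_def)
    have "shift_dist m (y \<otimes> inv x) \<le> shift_dist m h + (shift_dist m w + shift_dist m (inv h'))"
      unfolding eq using car wc by (intro order_trans[OF shift_dist_mult] add_left_mono shift_dist_mult) auto
    also have "\<dots> \<le> C * (len y + 1) / sqrt (real (Suc m)) +
        (C3 / sqrt (real (Suc m)) + C * (len x + 1) / sqrt (real (Suc m)))"
    proof (intro add_mono)
      show "shift_dist m h \<le> C * (len y + 1) / sqrt (real (Suc m))"
        using t(3) by (rule smoothedD(4))
      show "shift_dist m w \<le> C3 / sqrt (real (Suc m))"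
        by (rule order_trans[OF D(2)[OF w] divide_right_mono[OF C3(2)[OF w]]]) simp
      show "shift_dist m (inv h') \<le> C * (len x + 1) / sqrt (real (Suc m))"
        using smoothed_inv[OF t'(3)] by (rule smoothedD(4))
    qed
    also have "\<dots> = (C * (len x + len y + 2) + C3) / sqrt (real (Suc m))"
      by (simp add: add_divide_distrib[symmetric] algebra_simps)
    also have "\<dots> \<le> (2 * C + C3) * (len x + len y + 1) / sqrt (real (Suc m))"
    proof (intro divide_right_mono)
      have "0 \<le> C * (len x + len y) + C3 * (len x + len y)" using C(1) C3(1) by simp
      then show "C * (len x + len y + 2) + C3 \<le> (2 * C + C3) * (len x + len y + 1)"
        by (simp add: algebra_simps)
    qed simp
    finally show ?thesis .
  qed
  then show ?thesis
    using C(1) C3(1) by (intro exI[of _ "2 * C + C3"]) auto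
qed

section \<open>Influence of a single increment\<close>

text \<open>The law at time \<open>Suc m\<close> is the \<mu>-average of the translates by
  \<open>y\<close>, so the distance is at most the average over \<open>y\<close> of a bound linear
  in both lengths. Squaring it leaves a quadratic expression in \<open>len x\<close>, which calls
  for the second moment.\<close>

lemma last_increment_influence:
  "\<exists>C\<ge>0. \<forall>m. measure_pmf.expectation \<mu>
     (\<lambda>x. (l1_dist (map_pmf (\<lambda>w. w \<otimes> x) (walk m)) (walk (Suc m)))\<^sup>2) \<le> C / real (Suc m)"
proof -
  obtain C where C: "0 \<le> C" "\<And>m x y. x \<in> set_pmf \<mu> \<Longrightarrow> y \<in> set_pmf \<mu> \<Longrightarrow>
     shift_dist m (y \<otimes> inv x) \<le> C * (len x + len y + 1) / sqrt (real (Suc m))"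
    using shift_dist_support by blast
  define e where "e = measure_pmf.expectation \<mu> len"
  have e0: "0 \<le> e" by (simp add: e_def)
  define \<phi> where "\<phi> x = (C * (len x + (e + 1)))\<^sup>2" for x
  have i\<phi>: "integrable (measure_pmf \<mu>) \<phi>"
  proof -
    have "\<phi> = (\<lambda>x. C\<^sup>2 * ((len x)\<^sup>2 + 2 * (e + 1) * len x + (e + 1)\<^sup>2))"
      by (rule ext) (simp add: \<phi>_def power2_eq_square algebra_simps)
    then show ?thesis
      by (simp only:) (intro integrable_mult_right Bochner_Integration.integrable_add moment2 integrable_len, simp)
  qed
  have dist: "l1_dist (map_pmf (\<lambda>w. w \<otimes> x) (walk m)) (walk (Suc m)) \<le> C * (len x + (e + 1)) / sqrt (real (Suc m))"
    if x: "x \<in> set_pmf \<mu>" for x m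
  proof (rule l1_dist_leI)
    fix f :: "'a \<Rightarrow> real"
    assume f: "\<And>x. \<bar>f x\<bar> \<le> 1"
    define F where "F y = measure_pmf.expectation (walk m) (\<lambda>w. f (w \<otimes> y))" for y
    have F: "\<bar>F y\<bar> \<le> 1" for y unfolding F_def by (intro abs_expectation_le_const f)
    have "F x - measure_pmf.expectation (walk (Suc m)) f = F x - measure_pmf.expectation \<mu> F"
      unfolding convolution_power.simps expectation_convolution_pmf_swap[of f 1, OF f] F_def ..
    also have "\<dots> = measure_pmf.expectation \<mu> (\<lambda>y. F x - F y)"
      using F by (subst Bochner_Integration.integral_diff) (auto intro: integrable_pmf_bounded[where B = 1])
    also have "\<bar>\<dots>\<bar> \<le> measure_pmf.expectation \<mu> (\<lambda>y. C * (len y + (len x + 1)) / sqrt (real (Suc m)))"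
    proof (rule abs_expectation_le)
      fix y assume y: "y \<in> set_pmf \<mu>"
      have "\<bar>F x - F y\<bar> \<le> shift_dist m (x \<otimes> inv y)"
        unfolding F_def using x y supp by (intro expectation_shift_le f) auto
      also have "\<dots> \<le> C * (len y + (len x + 1)) / sqrt (real (Suc m))"
        using C(2)[OF y x, of m] by (simp add: add.assoc)
      finally show "\<bar>F x - F y\<bar> \<le> C * (len y + (len x + 1)) / sqrt (real (Suc m))" .
    qed (use integrable_len in simp)
    also have "\<dots> = C * (len x + (e + 1)) / sqrt (real (Suc m))"
      using integrable_len by (simp add: e_def algebra_simps)
    finally show "\<bar>measure_pmf.expectation (map_pmf (\<lambda>w. w \<otimes> x) (walk m)) f - measure_pmf.expectation (walk (Suc m)) f\<bar>
        \<le> C * (len x + (e + 1)) / sqrt (real (Suc m))"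
      by (simp add: F_def)
  qed
  have "measure_pmf.expectation \<mu> (\<lambda>x. (l1_dist (map_pmf (\<lambda>w. w \<otimes> x) (walk m)) (walk (Suc m)))\<^sup>2)
      \<le> measure_pmf.expectation \<mu> \<phi> / real (Suc m)" for m
  proof -
    have "measure_pmf.expectation \<mu> (\<lambda>x. (l1_dist (map_pmf (\<lambda>w. w \<otimes> x) (walk m)) (walk (Suc m)))\<^sup>2)
        \<le> measure_pmf.expectation \<mu> (\<lambda>x. \<phi> x / real (Suc m))"
    proof (rule expectation_mono_pmf)
      show "integrable (measure_pmf \<mu>) (\<lambda>x. (l1_dist (map_pmf (\<lambda>w. w \<otimes> x) (walk m)) (walk (Suc m)))\<^sup>2)"
        by (rule integrable_pmf_bounded[where B = "2\<^sup>2"])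
           (simp only: abs_power2, intro power_mono l1_dist_le_2 l1_dist_nonneg)
      show "(l1_dist (map_pmf (\<lambda>w. w \<otimes> x) (walk m)) (walk (Suc m)))\<^sup>2 \<le> \<phi> x / real (Suc m)" if "x \<in> set_pmf \<mu>" for x
        using power_mono[OF dist[OF that, of m] l1_dist_nonneg, of 2]
        by (simp add: \<phi>_def power_divide del: convolution_power.simps)
    qed (use i\<phi> in simp)
    then show ?thesis by simp
  qed
  moreover have "0 \<le> measure_pmf.expectation \<mu> \<phi>" by (simp add: \<phi>_def)
  ultimately show ?thesis by blast
qed

end

section \<open>Covariances, direct products and correlated increments\<close>

text \<open>Since \<open>bind_pmf \<mu> p\<close> is the mean of the laws \<open>p x\<close>, both
  cross terms average to the product term; what remains is an average of tensor squares of
  \<open>p x\<close> minus the mean.\<close>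

lemma covariance_bound:
  fixes F :: "'a \<Rightarrow> 'a \<Rightarrow> real" and p :: "'b \<Rightarrow> 'a pmf"
  assumes F: "\<And>x y. \<bar>F x y\<bar> \<le> 1"
  defines "E r s \<equiv> measure_pmf.expectation r (\<lambda>u. measure_pmf.expectation s (F u))"
  shows "\<bar>measure_pmf.expectation \<mu> (\<lambda>x. E (p x) (p x)) - E (bind_pmf \<mu> p) (bind_pmf \<mu> p)\<bar>
    \<le> measure_pmf.expectation \<mu> (\<lambda>x. (l1_dist (p x) (bind_pmf \<mu> p))\<^sup>2)"
proof -
  define q where "q = bind_pmf \<mu> p"
  have E1: "\<bar>E r s\<bar> \<le> 1" for r s
    unfolding E_def by (intro abs_expectation_le_const F)
  have int: "integrable (measure_pmf \<mu>) (\<lambda>x. E (r x) (s x))" for r s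
    using E1 by (rule integrable_pmf_bounded)
  have bind: "measure_pmf.expectation q g = measure_pmf.expectation \<mu> (\<lambda>x. measure_pmf.expectation (p x) g)"
    if "\<And>u. \<bar>g u\<bar> \<le> 1" for g :: "'a \<Rightarrow> real"
    unfolding q_def using integrable_pmf_bounded[OF that] by (rule expectation_bind_pmf)
  have left: "measure_pmf.expectation \<mu> (\<lambda>x. E (p x) q) = E q q"
    unfolding E_def by (rule bind[symmetric]) (intro abs_expectation_le_const F)
  have swap: "E r s = measure_pmf.expectation s (\<lambda>v. measure_pmf.expectation r (\<lambda>u. F u v))" for r s
    unfolding E_def by (rule expectation_swap_pmf) (rule F)
  have right: "measure_pmf.expectation \<mu> (\<lambda>x. E q (p x)) = E q q"
    unfolding swap by (rule bind[symmetric]) (intro abs_expectation_le_const F)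
  have "measure_pmf.expectation \<mu> (\<lambda>x. E (p x) (p x)) - E q q =
      measure_pmf.expectation \<mu> (\<lambda>x. E (p x) (p x) - E (p x) q - E q (p x) + E q q)"
    by (simp add: int left right)
  also have "\<bar>\<dots>\<bar> \<le> measure_pmf.expectation \<mu> (\<lambda>x. (l1_dist (p x) q)\<^sup>2)"
  proof (rule abs_expectation_le)
    show "integrable (measure_pmf \<mu>) (\<lambda>x. (l1_dist (p x) q)\<^sup>2)"
      by (rule integrable_pmf_bounded[where B = "2\<^sup>2"])
         (simp only: abs_power2, intro power_mono l1_dist_le_2 l1_dist_nonneg)
    show "\<bar>E (p x) (p x) - E (p x) q - E q (p x) + E q q\<bar> \<le> (l1_dist (p x) q)\<^sup>2" for x
      unfolding E_def power2_eq_square by (rule l1_dist_bilinear) (rule F)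
  qed
  finally show ?thesis unfolding q_def .
qed

lemma convolution_pmf_eq_bind:
  "convolution_pmf G p q = bind_pmf p (\<lambda>x. map_pmf (\<lambda>y. x \<otimes>\<^bsub>G\<^esub> y) q)"
  "convolution_pmf G p q = bind_pmf q (\<lambda>y. map_pmf (\<lambda>x. x \<otimes>\<^bsub>G\<^esub> y) p)"
proof -
  show *: "convolution_pmf G p q = bind_pmf p (\<lambda>x. map_pmf (\<lambda>y. x \<otimes>\<^bsub>G\<^esub> y) q)"
    by (simp add: convolution_pmf_def pair_pmf_def map_pmf_def bind_assoc_pmf bind_return_pmf)
  show "convolution_pmf G p q = bind_pmf q (\<lambda>y. map_pmf (\<lambda>x. x \<otimes>\<^bsub>G\<^esub> y) p)"
    unfolding * map_pmf_def by (rule bind_commute_pmf)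
qed

lemma convolution_pmf_DirProd:
  "convolution_pmf (G \<times>\<times> H) (pair_pmf p q) (pair_pmf p' q') =
    pair_pmf (convolution_pmf G p p') (convolution_pmf H q q')"
proof -
  have "convolution_pmf (G \<times>\<times> H) (pair_pmf p q) (pair_pmf p' q') =
    bind_pmf p (\<lambda>x. bind_pmf q (\<lambda>y. bind_pmf p' (\<lambda>x'. bind_pmf q' (\<lambda>y'.
      return_pmf (x \<otimes>\<^bsub>G\<^esub> x', y \<otimes>\<^bsub>H\<^esub> y')))))"
    by (simp add: convolution_pmf_def pair_pmf_def map_pmf_def bind_assoc_pmf bind_return_pmf)
  also have "\<dots> = bind_pmf p (\<lambda>x. bind_pmf p' (\<lambda>x'. bind_pmf q (\<lambda>y. bind_pmf q' (\<lambda>y'.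
      return_pmf (x \<otimes>\<^bsub>G\<^esub> x', y \<otimes>\<^bsub>H\<^esub> y')))))"
    by (subst bind_commute_pmf[of q p']) simp
  also have "\<dots> = pair_pmf (convolution_pmf G p p') (convolution_pmf H q q')"
    by (simp add: convolution_pmf_def pair_pmf_def map_pmf_def bind_assoc_pmf bind_return_pmf)
  finally show ?thesis .
qed

lemma
  fixes g :: "'a \<times> 'a \<Rightarrow> real"
  assumes \<rho>: "0 \<le> \<rho>" "\<rho> \<le> 1"
    and g: "integrable (measure_pmf (pair_pmf \<mu> \<mu>)) g" "integrable (measure_pmf \<mu>) (\<lambda>x. g (x, x))"
  shows integrable_correlated_pmf: "integrable (measure_pmf (correlated_pmf \<rho> \<mu>)) g"
    and expectation_correlated_pmf: "measure_pmf.expectation (correlated_pmf \<rho> \<mu>) g =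
      \<rho> * measure_pmf.expectation (pair_pmf \<mu> \<mu>) g + (1 - \<rho>) * measure_pmf.expectation \<mu> (\<lambda>x. g (x, x))"
proof -
  show *: "integrable (measure_pmf (correlated_pmf \<rho> \<mu>)) g"
    using g \<rho> unfolding correlated_pmf_def integrable_iff_bounded
    by (auto simp: ennreal_mult_less_top)
  show "measure_pmf.expectation (correlated_pmf \<rho> \<mu>) g =
      \<rho> * measure_pmf.expectation (pair_pmf \<mu> \<mu>) g + (1 - \<rho>) * measure_pmf.expectation \<mu> (\<lambda>x. g (x, x))"
    using \<rho> by (subst correlated_pmf_def, subst expectation_bind_pmf[OF *[unfolded correlated_pmf_def]]) simp
qed

lemma set_correlated_pmf: "set_pmf (correlated_pmf \<rho> \<mu>) \<subseteq> set_pmf \<mu> \<times> set_pmf \<mu>"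
  by (auto simp: correlated_pmf_def split: if_splits)

section \<open>The walk of inverses\<close>

context va_random_walk
begin

lemma convolution_pmf_inv:
  assumes "set_pmf p \<subseteq> carrier G" "set_pmf q \<subseteq> carrier G"
  shows "convolution_pmf G (map_pmf (m_inv G) p) (map_pmf (m_inv G) q) = map_pmf (m_inv G) (convolution_pmf G q p)"
proof -
  have "convolution_pmf G (map_pmf (m_inv G) p) (map_pmf (m_inv G) q) =
      bind_pmf p (\<lambda>x. bind_pmf q (\<lambda>y. return_pmf (inv x \<otimes> inv y)))"
    by (simp add: convolution_pmf_eq_bind(1) map_pmf_def bind_assoc_pmf bind_return_pmf)
  also have "\<dots> = bind_pmf p (\<lambda>x. bind_pmf q (\<lambda>y. return_pmf (inv (y \<otimes> x))))"
    using assms by (intro bind_pmf_cong refl) (auto simp: inv_mult_group subset_iff)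
  also have "\<dots> = map_pmf (m_inv G) (convolution_pmf G q p)"
    by (simp add: convolution_pmf_eq_bind(2) map_pmf_def bind_assoc_pmf bind_return_pmf)
  finally show ?thesis .
qed

text \<open>Inverting a product reverses the order of its increments, and independent increments
  with one common law have the same joint law in either order.\<close>

lemma convolution_power_inv: "convolution_power G (map_pmf (m_inv G) \<mu>) n = map_pmf (m_inv G) (walk n)"
proof (induction n)
  case 0
  then show ?case by simp
next
  case (Suc n)
  have "convolution_power G (map_pmf (m_inv G) \<mu>) (Suc n) = map_pmf (m_inv G) (convolution_pmf G \<mu> (walk n))"
    using convolution_pmf_inv[OF walk_carrier supp] by (simp add: Suc)
  then show ?case
    unfolding convolution_power_Suc_left[OF supp] .
qed

text \<open>The hypotheses survive inversion because \<open>len\<close> is symmetric. Right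
  translates of this walk are left translates of the original one.\<close>

lemma inverse_walk: "va_random_walk G (map_pmf (m_inv G) \<mu>) gens"
proof unfold_locales
  let ?\<nu> = "map_pmf (m_inv G) \<mu>"
  show supp': "set_pmf ?\<nu> \<subseteq> carrier G" using supp by auto
  have sub: "x \<in> carrier G" if "x \<in> semigroup_generate G (set_pmf ?\<nu>)" for x
    using that by induction (use supp' in auto)
  have inv: "x \<in> carrier G \<and> inv x \<in> semigroup_generate G (set_pmf ?\<nu>)" if "x \<in> semigroup_generate G (set_pmf \<mu>)" for x
    using that
  proof induction
    case (incl x)
    then show ?case using supp by (auto intro: semigroup_generate.incl)
  next
    case (mult x y)
    then show ?case by (auto simp: inv_mult_group intro: semigroup_generate.mult)
  qed
  have "x \<in> semigroup_generate G (set_pmf ?\<nu>)" if "x \<in> carrier G" for x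
    using inv[of "inv x"] that semigroup by simp
  with sub show "semigroup_generate G (set_pmf ?\<nu>) = carrier G" by blast
  show "integrable (measure_pmf ?\<nu>) (\<lambda>g. (len g)\<^sup>2)"
    unfolding integrable_map_pmf_eq
  proof (rule integrable_pmf_mono[OF moment2])
    fix x assume "x \<in> set_pmf \<mu>"
    then have "len (inv x) = len x" using supp by (intro len_inv) auto
    then show "\<bar>(len (inv x))\<^sup>2\<bar> \<le> (len x)\<^sup>2" by simp
  qed
qed (rule gens virt_abelian)+

lemma first_increment_influence:
  "\<exists>C\<ge>0. \<forall>m. measure_pmf.expectation \<mu>
     (\<lambda>x. (l1_dist (map_pmf (\<lambda>w. x \<otimes> w) (walk m)) (walk (Suc m)))\<^sup>2) \<le> C / real (Suc m)"
proof -
  interpret I: va_random_walk G "map_pmf (m_inv G) \<mu>" gens by (rule inverse_walk)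
  have inv_inv: "map_pmf (m_inv G) (map_pmf (m_inv G) p) = p" if "set_pmf p \<subseteq> carrier G" for p
  proof -
    have "map_pmf (\<lambda>x. inv (inv x)) p = map_pmf (\<lambda>x. x) p"
      using that by (intro map_pmf_cong refl) auto
    then show ?thesis by (simp add: pmf.map_comp o_def)
  qed
  have le: "l1_dist (map_pmf (\<lambda>w. x \<otimes> w) (walk m)) (walk (Suc m)) \<le>
      l1_dist (map_pmf (\<lambda>w. w \<otimes> inv x) (I.walk m)) (I.walk (Suc m))" if x: "x \<in> set_pmf \<mu>" for x m
  proof -
    have xc: "x \<in> carrier G" using x supp by blast
    have "map_pmf (\<lambda>w. w \<otimes> inv x) (I.walk m) = map_pmf (m_inv G) (map_pmf (\<lambda>w. x \<otimes> w) (walk m))"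
      unfolding convolution_power_inv pmf.map_comp o_def using xc walk_carrier'
      by (intro map_pmf_cong refl) (simp add: inv_mult_group)
    moreover have "set_pmf (map_pmf (\<lambda>w. x \<otimes> w) (walk m)) \<subseteq> carrier G"
      using xc walk_carrier' by auto
    ultimately show ?thesis
      unfolding convolution_power_inv[of "Suc m"]
      using l1_dist_map_le[of "m_inv G" "map_pmf (m_inv G) (map_pmf (\<lambda>w. x \<otimes> w) (walk m))" "map_pmf (m_inv G) (walk (Suc m))"]
        inv_inv walk_carrier[of "Suc m"] by simp
  qed
  obtain C where C: "C \<ge> 0" "\<And>m. measure_pmf.expectation (map_pmf (m_inv G) \<mu>)
     (\<lambda>x. (l1_dist (map_pmf (\<lambda>w. w \<otimes> x) (I.walk m)) (I.walk (Suc m)))\<^sup>2) \<le> C / real (Suc m)"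
    using I.last_increment_influence by blast
  have "measure_pmf.expectation \<mu> (\<lambda>x. (l1_dist (map_pmf (\<lambda>w. x \<otimes> w) (walk m)) (walk (Suc m)))\<^sup>2) \<le> C / real (Suc m)" for m
  proof -
    have int: "integrable (measure_pmf \<mu>) (\<lambda>x. (l1_dist (p x) (q x))\<^sup>2)" for p q :: "'a \<Rightarrow> 'a pmf"
      by (rule integrable_pmf_bounded[where B = "2\<^sup>2"])
         (simp only: abs_power2, intro power_mono l1_dist_le_2 l1_dist_nonneg)
    have "measure_pmf.expectation \<mu> (\<lambda>x. (l1_dist (map_pmf (\<lambda>w. x \<otimes> w) (walk m)) (walk (Suc m)))\<^sup>2) \<le>
      measure_pmf.expectation \<mu> (\<lambda>x. (l1_dist (map_pmf (\<lambda>w. w \<otimes> inv x) (I.walk m)) (I.walk (Suc m)))\<^sup>2)"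
      by (intro expectation_mono_pmf int power_mono le l1_dist_nonneg)
    also have "\<dots> \<le> C / real (Suc m)"
      using C(2)[of m] by (simp only: integral_map_pmf)
    finally show ?thesis .
  qed
  with C(1) show ?thesis by blast
qed

subsection \<open>Comparison of the noised walk with independent copies\<close>

abbreviation "walk2 n \<equiv> pair_pmf (walk n) (walk n)"

abbreviation "noised \<rho> \<equiv> convolution_power (G \<times>\<times> G) (correlated_pmf \<rho> \<mu>)"

lemma set_walk2: "set_pmf (walk2 n) \<subseteq> carrier (G \<times>\<times> G)"
  using walk_carrier[of n] by auto

lemma set_correlated: "set_pmf (correlated_pmf \<rho> \<mu>) \<subseteq> carrier (G \<times>\<times> G)"
  using set_correlated_pmf[of \<rho> \<mu>] supp by auto

lemma monoid_DirProd: "monoid (G \<times>\<times> G)"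
  by (intro DirProd_monoid is_monoid)

lemma set_noised: "set_pmf (noised \<rho> n) \<subseteq> carrier (G \<times>\<times> G)"
  using monoid_DirProd set_correlated by (rule monoid.set_convolution_power)

lemma expectation_correlated_diff:
  fixes g :: "'a \<times> 'a \<Rightarrow> real"
  assumes \<rho>: "0 \<le> \<rho>" "\<rho> \<le> 1" and g: "\<And>x. \<bar>g x\<bar> \<le> 1"
  shows "measure_pmf.expectation (correlated_pmf \<rho> \<mu>) g - measure_pmf.expectation (pair_pmf \<mu> \<mu>) g =
    (1 - \<rho>) * (measure_pmf.expectation \<mu> (\<lambda>x. g (x, x)) - measure_pmf.expectation (pair_pmf \<mu> \<mu>) g)"
  using expectation_correlated_pmf[of \<rho> \<mu> g] \<rho> integrable_pmf_bounded[of g 1] integrable_pmf_bounded[of "\<lambda>x. g (x, x)" 1] g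
  by (simp add: algebra_simps)

text \<open>The first order terms cancel: \<open>\<mu>\<^sub>d\<^sub>i\<^sub>a\<^sub>g - \<mu> \<times> \<mu>\<close> is the average over \<open>x\<close> of the tensor square of
  \<open>\<delta>\<^sub>x - \<mu>\<close>, so replacing one noised increment is a covariance.\<close>

lemma replace_increment:
  "\<exists>C\<ge>0. \<forall>\<rho>\<in>{0..1}. \<forall>m.
     l1_dist (convolution_pmf (G \<times>\<times> G) (walk2 m) (correlated_pmf \<rho> \<mu>)) (walk2 (Suc m)) \<le> (1 - \<rho>) * C / real (Suc m) \<and>
     l1_dist (convolution_pmf (G \<times>\<times> G) (correlated_pmf \<rho> \<mu>) (walk2 m)) (walk2 (Suc m)) \<le> (1 - \<rho>) * C / real (Suc m)"
proof -
  obtain C1 where C1: "C1 \<ge> 0" "\<And>m. measure_pmf.expectation \<mu>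
     (\<lambda>x. (l1_dist (map_pmf (\<lambda>w. w \<otimes> x) (walk m)) (walk (Suc m)))\<^sup>2) \<le> C1 / real (Suc m)"
    using last_increment_influence by blast
  obtain C2 where C2: "C2 \<ge> 0" "\<And>m. measure_pmf.expectation \<mu>
     (\<lambda>x. (l1_dist (map_pmf (\<lambda>w. x \<otimes> w) (walk m)) (walk (Suc m)))\<^sup>2) \<le> C2 / real (Suc m)"
    using first_increment_influence by blast
  define C where "C = max C1 C2"
  have C: "C1 / real (Suc m) \<le> C / real (Suc m)" "C2 / real (Suc m) \<le> C / real (Suc m)" for m
    unfolding C_def by (intro divide_right_mono; simp)+
  have left: "l1_dist (convolution_pmf (G \<times>\<times> G) (walk2 m) (correlated_pmf \<rho> \<mu>)) (walk2 (Suc m)) \<le> (1 - \<rho>) * (C / real (Suc m))"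
    if \<rho>: "0 \<le> \<rho>" "\<rho> \<le> 1" for \<rho> m
  proof (rule l1_dist_leI)
    fix f :: "'a \<times> 'a \<Rightarrow> real"
    assume f: "\<And>x. \<bar>f x\<bar> \<le> 1"
    define p where "p x = map_pmf (\<lambda>w. w \<otimes> x) (walk m)" for x
    have q: "walk (Suc m) = bind_pmf \<mu> p"
      unfolding p_def by (simp add: convolution_pmf_eq_bind(2))
    define g where "g z = measure_pmf.expectation (walk2 m) (\<lambda>w. f (w \<otimes>\<^bsub>G \<times>\<times> G\<^esub> z))" for z
    have g: "\<bar>g z\<bar> \<le> 1" for z unfolding g_def by (intro abs_expectation_le_const f)
    have "walk2 (Suc m) = convolution_pmf (G \<times>\<times> G) (walk2 m) (pair_pmf \<mu> \<mu>)"
      by (simp add: convolution_pmf_DirProd)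
    then have pair: "measure_pmf.expectation (walk2 (Suc m)) f = measure_pmf.expectation (pair_pmf \<mu> \<mu>) g"
      unfolding g_def using expectation_convolution_pmf_swap[of f 1, OF f] by simp
    \<comment> \<open>Given a common last increment \<open>x\<close>, the two coordinates are still
      independent, each with law \<open>p x\<close>: the form required by
      \<open>covariance_bound\<close>.\<close>
    have diag: "g (x, x) = measure_pmf.expectation (p x) (\<lambda>u. measure_pmf.expectation (p x) (\<lambda>v. f (u, v)))" for x
      unfolding g_def p_def
      by (subst expectation_pair_pmf) (auto intro!: integrable_pmf_bounded[where B = 1] f)
    have pair': "measure_pmf.expectation (walk2 (Suc m)) f =
        measure_pmf.expectation (bind_pmf \<mu> p) (\<lambda>u. measure_pmf.expectation (bind_pmf \<mu> p) (\<lambda>v. f (u, v)))"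
      unfolding q by (rule expectation_pair_pmf) (intro integrable_pmf_bounded[where B = 1] f)
    have conv: "measure_pmf.expectation (convolution_pmf (G \<times>\<times> G) (walk2 m) (correlated_pmf \<rho> \<mu>)) f =
        measure_pmf.expectation (correlated_pmf \<rho> \<mu>) g"
      unfolding g_def by (rule expectation_convolution_pmf_swap) (rule f)
    have "measure_pmf.expectation (convolution_pmf (G \<times>\<times> G) (walk2 m) (correlated_pmf \<rho> \<mu>)) f
        - measure_pmf.expectation (walk2 (Suc m)) f =
        (1 - \<rho>) * (measure_pmf.expectation \<mu> (\<lambda>x. g (x, x)) - measure_pmf.expectation (walk2 (Suc m)) f)"
      unfolding pair conv by (rule expectation_correlated_diff) (use \<rho> g in auto)
    also have "\<bar>\<dots>\<bar> = (1 - \<rho>) * \<bar>measure_pmf.expectation \<mu> (\<lambda>x. g (x, x)) - measure_pmf.expectation (walk2 (Suc m)) f\<bar>"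
      using \<rho> by (simp add: abs_mult)
    also have "\<bar>measure_pmf.expectation \<mu> (\<lambda>x. g (x, x)) - measure_pmf.expectation (walk2 (Suc m)) f\<bar>
        \<le> measure_pmf.expectation \<mu> (\<lambda>x. (l1_dist (p x) (walk (Suc m)))\<^sup>2)"
      unfolding diag pair' unfolding q by (rule covariance_bound) (rule f)
    also have "\<dots> \<le> C / real (Suc m)"
      unfolding p_def using C1(2)[of m] C(1)[of m] by (rule order_trans)
    finally show "\<bar>measure_pmf.expectation (convolution_pmf (G \<times>\<times> G) (walk2 m) (correlated_pmf \<rho> \<mu>)) f
        - measure_pmf.expectation (walk2 (Suc m)) f\<bar> \<le> (1 - \<rho>) * (C / real (Suc m))"
      using \<rho> by (simp add: mult_left_mono)
  qed
  have right: "l1_dist (convolution_pmf (G \<times>\<times> G) (correlated_pmf \<rho> \<mu>) (walk2 m)) (walk2 (Suc m)) \<le> (1 - \<rho>) * (C / real (Suc m))"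
    if \<rho>: "0 \<le> \<rho>" "\<rho> \<le> 1" for \<rho> m
  proof (rule l1_dist_leI)
    fix f :: "'a \<times> 'a \<Rightarrow> real"
    assume f: "\<And>x. \<bar>f x\<bar> \<le> 1"
    define p where "p x = map_pmf (\<lambda>w. x \<otimes> w) (walk m)" for x
    have q: "walk (Suc m) = bind_pmf \<mu> p"
      unfolding p_def convolution_power_Suc_left[OF supp] by (rule convolution_pmf_eq_bind(1))
    define g where "g z = measure_pmf.expectation (walk2 m) (\<lambda>w. f (z \<otimes>\<^bsub>G \<times>\<times> G\<^esub> w))" for z
    have g: "\<bar>g z\<bar> \<le> 1" for z unfolding g_def by (intro abs_expectation_le_const f)
    have "walk2 (Suc m) = convolution_pmf (G \<times>\<times> G) (pair_pmf \<mu> \<mu>) (walk2 m)"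
      unfolding convolution_power_Suc_left[OF supp] convolution_pmf_DirProd ..
    then have pair: "measure_pmf.expectation (walk2 (Suc m)) f = measure_pmf.expectation (pair_pmf \<mu> \<mu>) g"
      unfolding g_def using expectation_convolution_pmf[of f 1, OF f] by simp
    have diag: "g (x, x) = measure_pmf.expectation (p x) (\<lambda>u. measure_pmf.expectation (p x) (\<lambda>v. f (u, v)))" for x
      unfolding g_def p_def
      by (subst expectation_pair_pmf) (auto intro!: integrable_pmf_bounded[where B = 1] f)
    have pair': "measure_pmf.expectation (walk2 (Suc m)) f =
        measure_pmf.expectation (bind_pmf \<mu> p) (\<lambda>u. measure_pmf.expectation (bind_pmf \<mu> p) (\<lambda>v. f (u, v)))"
      unfolding q by (rule expectation_pair_pmf) (intro integrable_pmf_bounded[where B = 1] f)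
    have conv: "measure_pmf.expectation (convolution_pmf (G \<times>\<times> G) (correlated_pmf \<rho> \<mu>) (walk2 m)) f =
        measure_pmf.expectation (correlated_pmf \<rho> \<mu>) g"
      unfolding g_def by (rule expectation_convolution_pmf) (rule f)
    have "measure_pmf.expectation (convolution_pmf (G \<times>\<times> G) (correlated_pmf \<rho> \<mu>) (walk2 m)) f
        - measure_pmf.expectation (walk2 (Suc m)) f =
        (1 - \<rho>) * (measure_pmf.expectation \<mu> (\<lambda>x. g (x, x)) - measure_pmf.expectation (walk2 (Suc m)) f)"
      unfolding pair conv by (rule expectation_correlated_diff) (use \<rho> g in auto)
    also have "\<bar>\<dots>\<bar> = (1 - \<rho>) * \<bar>measure_pmf.expectation \<mu> (\<lambda>x. g (x, x)) - measure_pmf.expectation (walk2 (Suc m)) f\<bar>"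
      using \<rho> by (simp add: abs_mult)
    also have "\<bar>measure_pmf.expectation \<mu> (\<lambda>x. g (x, x)) - measure_pmf.expectation (walk2 (Suc m)) f\<bar>
        \<le> measure_pmf.expectation \<mu> (\<lambda>x. (l1_dist (p x) (walk (Suc m)))\<^sup>2)"
      unfolding diag pair' unfolding q by (rule covariance_bound) (rule f)
    also have "\<dots> \<le> C / real (Suc m)"
      unfolding p_def using C2(2)[of m] C(2)[of m] by (rule order_trans)
    finally show "\<bar>measure_pmf.expectation (convolution_pmf (G \<times>\<times> G) (correlated_pmf \<rho> \<mu>) (walk2 m)) f
        - measure_pmf.expectation (walk2 (Suc m)) f\<bar> \<le> (1 - \<rho>) * (C / real (Suc m))"
      using \<rho> by (simp add: mult_left_mono)
  qed
  show ?thesis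
    using left right C1(1) by (intro exI[of _ C]) (auto simp: C_def)
qed

text \<open>In the step from \<open>a\<close> and \<open>b\<close> to \<open>a + b\<close> the two linear terms only involve replacements next to a
  long stretch of independent increments, so no smoothing estimate for the noised walk is needed;
  the quadratic term is absorbed as long as \<open>1 - \<rho>\<close> is small.\<close>

lemma l1_dist_noised:
  "\<exists>C\<ge>0. \<forall>\<rho>\<in>{0..1}. \<forall>n. (1 - \<rho>) * C \<le> 1 / 8 \<longrightarrow> l1_dist (noised \<rho> n) (walk2 n) \<le> 4 * ((1 - \<rho>) * C)"
proof -
  interpret P: monoid "G \<times>\<times> G" by (rule monoid_DirProd)
  let ?conv = "convolution_pmf (G \<times>\<times> G)"
  obtain C where C: "C \<ge> 0"
    "\<And>\<rho> m. \<rho> \<in> {0..1} \<Longrightarrow> l1_dist (?conv (walk2 m) (correlated_pmf \<rho> \<mu>)) (walk2 (Suc m)) \<le> (1 - \<rho>) * C / real (Suc m)"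
    "\<And>\<rho> m. \<rho> \<in> {0..1} \<Longrightarrow> l1_dist (?conv (correlated_pmf \<rho> \<mu>) (walk2 m)) (walk2 (Suc m)) \<le> (1 - \<rho>) * C / real (Suc m)"
    using replace_increment by blast
  have "l1_dist (noised \<rho> n) (walk2 n) \<le> 4 * ((1 - \<rho>) * C)"
    if \<rho>: "\<rho> \<in> {0..1}" and small: "(1 - \<rho>) * C \<le> 1 / 8" for \<rho> n
  proof -
    define e where "e = (1 - \<rho>) * C"
    have e: "0 \<le> e" "e \<le> 1 / 8" using \<rho> C(1) small by (auto simp: e_def)
    let ?\<pi> = "correlated_pmf \<rho> \<mu>"
    \<comment> \<open>The exchange starts next to the independent block, which only grows on the
      way, so each of the \<open>b\<close> exchanges costs at most
      \<open>e / (a + 1)\<close>.\<close>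
    have left: "l1_dist (?conv (walk2 a) (noised \<rho> b)) (walk2 (a + b)) \<le> real b * e / real (Suc a)" for a b
    proof (induction b arbitrary: a)
      case 0
      then show ?case using P.convolution_return_right[OF set_walk2] by simp
    next
      case (Suc b)
      have "?conv (walk2 a) (noised \<rho> (Suc b)) = ?conv (?conv (walk2 a) ?\<pi>) (noised \<rho> b)"
        unfolding P.convolution_power_Suc_left[OF set_correlated]
        by (rule P.convolution_pmf_assoc[OF set_walk2 set_correlated set_noised, symmetric])
      then have "l1_dist (?conv (walk2 a) (noised \<rho> (Suc b))) (?conv (walk2 (Suc a)) (noised \<rho> b)) \<le> e / real (Suc a)"
        using order_trans[OF l1_dist_convolution_right C(2)[OF \<rho>, of a]] by (simp only: e_def)
      moreover have "l1_dist (?conv (walk2 (Suc a)) (noised \<rho> b)) (walk2 (a + Suc b)) \<le> real b * e / real (Suc a)"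
        using order_trans[OF Suc.IH[of "Suc a"], of "real b * e / real (Suc a)"] e(1)
        by (simp add: frac_le del: convolution_power.simps)
      ultimately have "l1_dist (?conv (walk2 a) (noised \<rho> (Suc b))) (walk2 (a + Suc b)) \<le>
          e / real (Suc a) + real b * e / real (Suc a)"
        by (rule order_trans[OF l1_dist_triangle add_mono])
      then show ?case
        by (simp add: add_divide_distrib[symmetric] algebra_simps del: convolution_power.simps)
    qed
    have right: "l1_dist (?conv (noised \<rho> a) (walk2 b)) (walk2 (a + b)) \<le> real a * e / real (Suc b)" for a b
    proof (induction a arbitrary: b)
      case 0
      then show ?case using P.convolution_return_left[OF set_walk2] by (simp add: one_DirProd)
    next
      case (Suc a)
      have "?conv (noised \<rho> (Suc a)) (walk2 b) = ?conv (noised \<rho> a) (?conv ?\<pi> (walk2 b))"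
        unfolding convolution_power.simps
        by (rule P.convolution_pmf_assoc[OF set_noised set_correlated set_walk2])
      then have "l1_dist (?conv (noised \<rho> (Suc a)) (walk2 b)) (?conv (noised \<rho> a) (walk2 (Suc b))) \<le> e / real (Suc b)"
        using order_trans[OF l1_dist_convolution_left C(3)[OF \<rho>, of b]] by (simp only: e_def)
      moreover have "l1_dist (?conv (noised \<rho> a) (walk2 (Suc b))) (walk2 (Suc a + b)) \<le> real a * e / real (Suc b)"
        using order_trans[OF Suc.IH[of "Suc b"], of "real a * e / real (Suc b)"] e(1)
        by (simp add: frac_le del: convolution_power.simps)
      ultimately have "l1_dist (?conv (noised \<rho> (Suc a)) (walk2 b)) (walk2 (Suc a + b)) \<le>
          e / real (Suc b) + real a * e / real (Suc b)"
        by (rule order_trans[OF l1_dist_triangle add_mono])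
      then show ?case
        by (simp add: add_divide_distrib[symmetric] algebra_simps del: convolution_power.simps)
    qed
    have split: "l1_dist (noised \<rho> (a + b)) (walk2 (a + b)) \<le> real b * e / real (Suc a) + real a * e / real (Suc b) +
        l1_dist (noised \<rho> a) (walk2 a) * l1_dist (noised \<rho> b) (walk2 b)" for a b
    proof -
      have "noised \<rho> (a + b) = ?conv (noised \<rho> a) (noised \<rho> b)"
        by (rule P.convolution_power_add[OF set_correlated])
      moreover have "walk2 (a + b) = ?conv (walk2 a) (walk2 b)"
        unfolding convolution_power_add[OF supp] convolution_pmf_DirProd ..
      ultimately show ?thesis
        using l1_dist_convolution_mixed[of "G \<times>\<times> G" "walk2 a" "walk2 b" "noised \<rho> a" "noised \<rho> b"] left[of a b] right[of a b]
        by (simp add: l1_dist_sym[of "walk2 _"] l1_dist_sym[of "?conv (walk2 a) (walk2 b)"])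
    qed
    show "l1_dist (noised \<rho> n) (walk2 n) \<le> 4 * ((1 - \<rho>) * C)"
      unfolding e_def[symmetric]
    proof (induction n rule: less_induct)
      case (less n)
      consider "n = 0" | "n = 1" | "2 \<le> n" by linarith
      then show ?case
      proof cases
        case 1
        have "noised \<rho> 0 = walk2 0" by (simp add: pair_pmf_def bind_return_pmf)
        then show ?thesis using e by (simp add: 1)
      next
        case 2
        have w0: "walk2 0 = return_pmf \<one>\<^bsub>G \<times>\<times> G\<^esub>"
          by (simp add: pair_pmf_def bind_return_pmf)
        have "l1_dist (noised \<rho> 1) (walk2 1) \<le> e"
          using left[of 0 1] unfolding w0 P.convolution_return_left[OF set_noised]
          by (simp del: convolution_power.simps)
        then show ?thesis using e(1) unfolding 2 by linarith
      next
        case 3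
        \<comment> \<open>The halves differ by at most one, so each linear term is at most
          \<open>e\<close>. With the bound 4 e at both halves the quadratic term is at most 16 e^2,
          and e <= 1/8 makes this at most 2 e; together 4 e.\<close>
        define a b where "a = n div 2" and "b = n - n div 2"
        have ab: "a + b = n" "b \<le> Suc a" "a \<le> Suc b" "a < n" "b < n"
          using 3 by (auto simp: a_def b_def)
        have "real b * e / real (Suc a) \<le> e" "real a * e / real (Suc b) \<le> e"
          using ab e(1) by (simp_all add: divide_le_eq mult.commute mult_left_mono)
        moreover have "l1_dist (noised \<rho> a) (walk2 a) * l1_dist (noised \<rho> b) (walk2 b) \<le> (4 * e) * (4 * e)"
          using less.IH[OF ab(4)] less.IH[OF ab(5)] e(1) by (intro mult_mono l1_dist_nonneg) auto
        moreover have "(4 * e) * (4 * e) \<le> 2 * e"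
          using mult_left_mono[OF e(2) e(1)] by simp
        ultimately show ?thesis
          using split[of a b] unfolding ab(1) by linarith
      qed
    qed
  qed
  with C(1) show ?thesis by blast
qed

subsection \<open>Homomorphisms to the integers\<close>

context
  fixes h :: "'a \<Rightarrow> int"
  assumes h: "h \<in> hom G integer_group"
begin

lemma h_mult: "x \<in> carrier G \<Longrightarrow> y \<in> carrier G \<Longrightarrow> h (x \<otimes> y) = h x + h y"
  using hom_mult[OF h] by simp

lemma h_one: "h \<one> = 0"
  using h_mult[of \<one> \<one>] by simp

lemma h_pow: "x \<in> carrier G \<Longrightarrow> h (x [^] (n::nat)) = int n * h x"
  by (induction n) (simp_all add: h_one h_mult algebra_simps)

lemma h_inv: "x \<in> carrier G \<Longrightarrow> h (inv x) = - h x"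
  using h_mult[of x "inv x"] by (simp add: h_one)

lemma h_le_len: "\<exists>K\<ge>0. \<forall>g\<in>carrier G. \<bar>real_of_int (h g)\<bar> \<le> K * len g"
proof -
  define L where "L = gens \<union> m_inv G ` gens"
  have L: "finite L" "L \<subseteq> carrier G"
    using finite_gens letters_subset by (auto simp: L_def)
  define K where "K = (\<Sum>s\<in>L. \<bar>real_of_int (h s)\<bar>)"
  have K: "\<bar>real_of_int (h s)\<bar> \<le> K" if "s \<in> L" for s
    unfolding K_def using that L(1) by (intro member_le_sum) auto
  have "\<bar>real_of_int (h g)\<bar> \<le> K * real n" if "is_word n g" for n g
    using that
  proof (induction n arbitrary: g)
    case 0
    then have "g = \<one>" by (simp add: is_word_def)
    then show ?case by (simp add: h_one)
  next
    case (Suc n)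
    from Suc.prems obtain g' s where gs: "is_word n g'" "s \<in> gens \<union> m_inv G ` gens" "g = g' \<otimes> s"
      by (rule is_word_Suc)
    have "s \<in> carrier G" using gs(2) letters_subset by blast
    then have "h g = h g' + h s"
      using gs(3) is_word_carrier[OF gs(1)] by (simp add: h_mult)
    then show ?case
      using Suc.IH[OF gs(1)] K[of s] gs(2) by (simp add: L_def algebra_simps)
  qed
  then show ?thesis
    using is_word_word_length by (intro exI[of _ K]) (auto simp: K_def sum_nonneg)
qed

text \<open>It vanishes on the diagonal, so shared increments contribute nothing to it.\<close>

definition drift :: "'a \<times> 'a \<Rightarrow> real" where
  "drift z = real_of_int (h (fst z) - h (snd z))"

lemma drift_mult:
  assumes "z \<in> carrier (G \<times>\<times> G)" "w \<in> carrier (G \<times>\<times> G)"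
  shows "drift (z \<otimes>\<^bsub>G \<times>\<times> G\<^esub> w) = drift z + drift w"
  using assms by (cases z; cases w) (auto simp: drift_def h_mult)

lemma integrable_h2: "integrable (measure_pmf \<mu>) (\<lambda>x. (real_of_int (h x))\<^sup>2)"
proof -
  obtain K where K: "K \<ge> 0" "\<And>g. g \<in> carrier G \<Longrightarrow> \<bar>real_of_int (h g)\<bar> \<le> K * len g"
    using h_le_len by blast
  show ?thesis
  proof (rule integrable_pmf_mono)
    show "integrable (measure_pmf \<mu>) (\<lambda>g. K\<^sup>2 * (len g)\<^sup>2)" using moment2 by simp
    show "\<bar>(real_of_int (h x))\<^sup>2\<bar> \<le> K\<^sup>2 * (len x)\<^sup>2" if "x \<in> set_pmf \<mu>" for x
      using power_mono[OF K(2)[of x], of 2] supp that by (auto simp: power_mult_distrib)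
  qed
qed

lemma integrable_h: "integrable (measure_pmf \<mu>) (\<lambda>x. real_of_int (h x))"
proof (rule integrable_pmf_mono)
  show "integrable (measure_pmf \<mu>) (\<lambda>x. 1 + (real_of_int (h x))\<^sup>2)" using integrable_h2 by simp
  show "\<bar>real_of_int (h x)\<bar> \<le> 1 + (real_of_int (h x))\<^sup>2" for x
    using sum_power2_ge_zero[of "\<bar>real_of_int (h x)\<bar> - 1" 0] 
    by (simp add: power2_eq_square algebra_simps abs_if split: if_splits)
qed

lemma drift_bound: "(drift (x, y))\<^sup>2 \<le> 2 * (real_of_int (h x))\<^sup>2 + 2 * (real_of_int (h y))\<^sup>2"
  using sum_power2_ge_zero[of "real_of_int (h x) + real_of_int (h y)" 0]
  by (simp add: drift_def power2_eq_square algebra_simps)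

lemma integrable_drift:
  "integrable (measure_pmf (pair_pmf \<mu> \<mu>)) drift"
  "integrable (measure_pmf (pair_pmf \<mu> \<mu>)) (\<lambda>z. (drift z)\<^sup>2)"
proof -
  have 1: "integrable (measure_pmf (pair_pmf \<mu> \<mu>)) (\<lambda>z. f (fst z))"
    and 2: "integrable (measure_pmf (pair_pmf \<mu> \<mu>)) (\<lambda>z. f (snd z))"
    if "integrable (measure_pmf \<mu>) f" for f :: "'a \<Rightarrow> real"
    using that integrable_map_pmf_eq[of fst "pair_pmf \<mu> \<mu>" f] integrable_map_pmf_eq[of snd "pair_pmf \<mu> \<mu>" f]
    by (simp_all add: map_fst_pair_pmf map_snd_pair_pmf)
  show "integrable (measure_pmf (pair_pmf \<mu> \<mu>)) drift"
    unfolding drift_def of_int_diff by (intro Bochner_Integration.integrable_diff 1 2 integrable_h)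
  show "integrable (measure_pmf (pair_pmf \<mu> \<mu>)) (\<lambda>z. (drift z)\<^sup>2)"
  proof (rule integrable_pmf_mono)
    show "integrable (measure_pmf (pair_pmf \<mu> \<mu>))
        (\<lambda>z. 2 * (real_of_int (h (fst z)))\<^sup>2 + 2 * (real_of_int (h (snd z)))\<^sup>2)"
      by (intro Bochner_Integration.integrable_add integrable_mult_right 1[OF integrable_h2] 2[OF integrable_h2])
    show "\<bar>(drift z)\<^sup>2\<bar> \<le> 2 * (real_of_int (h (fst z)))\<^sup>2 + 2 * (real_of_int (h (snd z)))\<^sup>2" for z
      using drift_bound[of "fst z" "snd z"] by simp
  qed
qed

text \<open>Twice the variance of \<open>h\<close> under \<mu>.\<close>

definition drift_var :: real where
  "drift_var = measure_pmf.expectation (pair_pmf \<mu> \<mu>) (\<lambda>z. (drift z)\<^sup>2)"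

lemma correlated_drift:
  assumes \<rho>: "0 \<le> \<rho>" "\<rho> \<le> 1"
  shows "integrable (measure_pmf (correlated_pmf \<rho> \<mu>)) drift"
    "integrable (measure_pmf (correlated_pmf \<rho> \<mu>)) (\<lambda>z. (drift z)\<^sup>2)"
    "measure_pmf.expectation (correlated_pmf \<rho> \<mu>) drift = 0"
    "measure_pmf.expectation (correlated_pmf \<rho> \<mu>) (\<lambda>z. (drift z)\<^sup>2) = \<rho> * drift_var"
proof -
  have diag: "drift (x, x) = 0" for x by (simp add: drift_def)
  have "integrable (measure_pmf (pair_pmf \<mu> \<mu>)) (\<lambda>z. real_of_int (h (fst z)))"
    "integrable (measure_pmf (pair_pmf \<mu> \<mu>)) (\<lambda>z. real_of_int (h (snd z)))"
    using integrable_h integrable_map_pmf_eq[of fst "pair_pmf \<mu> \<mu>" "\<lambda>x. real_of_int (h x)"]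
      integrable_map_pmf_eq[of snd "pair_pmf \<mu> \<mu>" "\<lambda>x. real_of_int (h x)"]
    by (simp_all add: map_fst_pair_pmf map_snd_pair_pmf)
  then have mean: "measure_pmf.expectation (pair_pmf \<mu> \<mu>) drift = 0"
    unfolding drift_def of_int_diff
    using expectation_pair_pmf_fst[of \<mu> \<mu> "\<lambda>x. real_of_int (h x)"] expectation_pair_pmf_snd[of \<mu> \<mu> "\<lambda>x. real_of_int (h x)"]
    by simp
  show "integrable (measure_pmf (correlated_pmf \<rho> \<mu>)) drift"
    "integrable (measure_pmf (correlated_pmf \<rho> \<mu>)) (\<lambda>z. (drift z)\<^sup>2)"
    using \<rho> integrable_drift by (auto intro!: integrable_correlated_pmf simp: diag)
  show "measure_pmf.expectation (correlated_pmf \<rho> \<mu>) drift = 0"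
    using \<rho> integrable_drift mean by (subst expectation_correlated_pmf) (auto simp: diag)
  show "measure_pmf.expectation (correlated_pmf \<rho> \<mu>) (\<lambda>z. (drift z)\<^sup>2) = \<rho> * drift_var"
    using \<rho> integrable_drift unfolding drift_var_def by (subst expectation_correlated_pmf) (auto simp: diag)
qed

text \<open>Exchanging the coordinates changes the sign of \<open>drift\<close> and preserves the
  law of an increment. Increments are therefore centred whatever the mean of \<open>h\<close>, and
  their second moments add up.\<close>

lemma noised_drift:
  assumes \<rho>: "0 \<le> \<rho>" "\<rho> \<le> 1"
  shows "integrable (measure_pmf (noised \<rho> n)) (\<lambda>z. (drift z)\<^sup>2) \<and>
    measure_pmf.expectation (noised \<rho> n) (\<lambda>z. (drift z)\<^sup>2) = real n * (\<rho> * drift_var)"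
proof (induction n)
  case 0
  then show ?case by (simp add: drift_def integrable_measure_pmf_finite)
next
  case (Suc n)
  let ?\<pi> = "correlated_pmf \<rho> \<mu>" and ?P = "pair_pmf (noised \<rho> n) (correlated_pmf \<rho> \<mu>)"
  let ?g = "\<lambda>zw. (drift (fst zw \<otimes>\<^bsub>G \<times>\<times> G\<^esub> snd zw))\<^sup>2"
  have mult: "drift (z \<otimes>\<^bsub>G \<times>\<times> G\<^esub> w) = drift z + drift w" if "z \<in> set_pmf (noised \<rho> n)" "w \<in> set_pmf ?\<pi>" for z w
    using that set_noised[of \<rho> n] set_correlated[of \<rho>] by (intro drift_mult) auto
  have i1: "integrable (measure_pmf ?P) (\<lambda>zw. (drift (fst zw))\<^sup>2)"
    using Suc integrable_map_pmf_eq[of fst ?P "\<lambda>z. (drift z)\<^sup>2"] by (simp add: map_fst_pair_pmf)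
  have i2: "integrable (measure_pmf ?P) (\<lambda>zw. (drift (snd zw))\<^sup>2)"
    using correlated_drift(2)[OF \<rho>] integrable_map_pmf_eq[of snd ?P "\<lambda>z. (drift z)\<^sup>2"] by (simp add: map_snd_pair_pmf)
  have int: "integrable (measure_pmf ?P) ?g"
  proof (rule integrable_pmf_mono)
    show "integrable (measure_pmf ?P) (\<lambda>zw. 2 * (drift (fst zw))\<^sup>2 + 2 * (drift (snd zw))\<^sup>2)"
      using i1 i2 by simp
    fix zw assume "zw \<in> set_pmf ?P"
    then have "?g zw = (drift (fst zw) + drift (snd zw))\<^sup>2" using mult by auto
    then have "?g zw \<le> 2 * (drift (fst zw))\<^sup>2 + 2 * (drift (snd zw))\<^sup>2"
      using sum_power2_ge_zero[of "drift (fst zw) - drift (snd zw)" 0]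
      by (simp add: power2_eq_square algebra_simps)
    then show "\<bar>?g zw\<bar> \<le> 2 * (drift (fst zw))\<^sup>2 + 2 * (drift (snd zw))\<^sup>2"
      by simp
  qed
  have inner: "measure_pmf.expectation ?\<pi> (\<lambda>w. ?g (z, w)) = (drift z)\<^sup>2 + \<rho> * drift_var"
    if z: "z \<in> set_pmf (noised \<rho> n)" for z
  proof -
    have "measure_pmf.expectation ?\<pi> (\<lambda>w. ?g (z, w)) =
        measure_pmf.expectation ?\<pi> (\<lambda>w. (drift z)\<^sup>2 + 2 * drift z * drift w + (drift w)\<^sup>2)"
      using z by (intro expectation_cong_pmf) (simp add: mult power2_sum)
    also have "\<dots> = (drift z)\<^sup>2 + \<rho> * drift_var"
      using correlated_drift[OF \<rho>] by simp
    finally show ?thesis .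
  qed
  have "measure_pmf.expectation ?P ?g = measure_pmf.expectation (noised \<rho> n) (\<lambda>z. (drift z)\<^sup>2 + \<rho> * drift_var)"
    unfolding expectation_pair_pmf[OF int] by (intro expectation_cong_pmf inner)
  also have "\<dots> = real (Suc n) * (\<rho> * drift_var)"
    using Suc by (simp add: algebra_simps)
  finally show ?case
    using int by (simp add: convolution_pmf_def case_prod_unfold)
qed

lemma noised_concentration:
  assumes \<rho>: "0 \<le> \<rho>" "\<rho> \<le> 1" and r: "0 < r"
  shows "1 - real n * (\<rho> * drift_var) / r\<^sup>2 \<le> measure (measure_pmf (noised \<rho> n)) {z. \<bar>drift z\<bar> \<le> r}"
proof -
  let ?A = "{z. \<bar>drift z\<bar> \<le> r}"
  have "measure (measure_pmf (noised \<rho> n)) (- ?A) = measure_pmf.expectation (noised \<rho> n) (indicator (- ?A))"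
    by simp
  also have "\<dots> \<le> measure_pmf.expectation (noised \<rho> n) (\<lambda>z. (drift z)\<^sup>2 / r\<^sup>2)"
  proof (rule expectation_mono_pmf)
    show "indicator (- ?A) z \<le> (drift z)\<^sup>2 / r\<^sup>2" for z
      using r power_mono[of r "\<bar>drift z\<bar>" 2] by (auto simp: indicator_def)
    show "integrable (measure_pmf (noised \<rho> n)) (indicator (- ?A) :: _ \<Rightarrow> real)"
      by (rule integrable_pmf_bounded[where B = 1]) (simp add: indicator_def)
    show "integrable (measure_pmf (noised \<rho> n)) (\<lambda>z. (drift z)\<^sup>2 / r\<^sup>2)"
      using noised_drift[OF \<rho>, of n] by simp
  qed
  also have "\<dots> = real n * (\<rho> * drift_var) / r\<^sup>2"
    using noised_drift[OF \<rho>, of n] by simp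
  finally show ?thesis
    using measure_pmf.prob_compl[of ?A "noised \<rho> n"] by (simp add: Compl_eq_Diff_UNIV)
qed

text \<open>If \<open>h z \<noteq> 0\<close>, the translates of an interval by multiples of \<open>h z\<close> carry almost the same mass,
  and many of them are disjoint.\<close>

lemma walk_anticoncentration:
  assumes h_nonzero: "\<exists>g\<in>carrier G. h g \<noteq> 0"
  shows "\<exists>C\<ge>0. \<forall>n c r. \<forall>J::nat. 0 \<le> r \<longrightarrow> 0 < J \<longrightarrow>
    measure (measure_pmf (walk n)) {x. \<bar>real_of_int (h x) - c\<bar> \<le> r} \<le>
      1 / real J + real J * (2 * r + 1) * C / sqrt (real (Suc n))"
proof -
  obtain g where g: "g \<in> carrier G" "h g \<noteq> 0" using h_nonzero by blast
  define g' where "g' = (if h g > 0 then g else inv g)"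
  have g': "g' \<in> carrier G" "h g' > 0" using g by (auto simp: g'_def h_inv)
  \<comment> \<open>The power \<open>return_time\<close> brings the element into
    \<open>aperiodic\<close>, where translations are controlled, and keeps its image under
    \<open>h\<close> positive.\<close>
  define z where "z = g' [^] return_time"
  have z: "z \<in> aperiodic" "z \<in> carrier G"
    using g'(1) aperiodic_pow_return_time by (auto simp: z_def)
  have hz: "1 \<le> h z"
    using mult_pos_pos[of "int return_time" "h g'"] g'(2) return_time(1) unfolding z_def h_pow[OF g'(1)] by linarith
  obtain C where C: "0 \<le> C" "\<And>m. shift_dist m z \<le> C / sqrt (real (Suc m))"
    using shift_dist_aperiodic[OF z(1)] by blast
  have shift_pow: "shift_dist m (z [^] i) \<le> real i * (C / sqrt (real (Suc m)))" for i m :: nat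
  proof (induction i)
    case 0
    have "map_pmf (\<lambda>x. x \<otimes> \<one>) (walk m) = map_pmf (\<lambda>x. x) (walk m)"
      using walk_carrier' by (intro map_pmf_cong refl) simp
    then show ?case by (simp add: shift_dist_def)
  next
    case (Suc i)
    have "shift_dist m (z [^] Suc i) \<le> shift_dist m (z [^] i) + shift_dist m z"
      using shift_dist_mult[of "z [^] i" z m] z(2) by simp
    with Suc C(2)[of m] show ?case by (simp add: algebra_simps add_divide_distrib)
  qed
  have "measure (measure_pmf (walk n)) {x. \<bar>real_of_int (h x) - c\<bar> \<le> r} \<le>
      1 / real J + real J * (2 * r + 1) * C / sqrt (real (Suc n))"
    if r: "0 \<le> r" and J: "0 < J" for n c r and J :: nat
  proof -
    \<comment> \<open>The least natural number above 2 r. Since \<open>h z\<close> is at least 1,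
      intervals of radius \<open>r\<close> shifted by different multiples of \<open>s * h z\<close>
      are disjoint, while each of the \<open>J\<close> shifts costs at most
      \<open>J * s * q\<close>.\<close>
    define s where "s = nat \<lfloor>2 * r\<rfloor> + 1"
    have s: "2 * r < real s" "real s \<le> 2 * r + 1"
      using r unfolding s_def by linarith+
    define f where "f i x = (indicat_real {x. \<bar>real_of_int (h x) - real (i * s) * real_of_int (h z) - c\<bar> \<le> r} x)" for i :: nat and x
    define P where "P = measure (measure_pmf (walk n)) {x. \<bar>real_of_int (h x) - c\<bar> \<le> r}"
    define q where "q = C / sqrt (real (Suc n))"
    have q0: "0 \<le> q" using C(1) by (simp add: q_def)
    have fb: "\<bar>f i x\<bar> \<le> 1" for i x by (simp add: f_def indicator_def)
    have P_le: "P \<le> measure_pmf.expectation (walk n) (f i) + real J * real s * q" if i: "i < J" for i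
    proof -
      have "f i (x \<otimes> z [^] (i * s)) = indicat_real {x. \<bar>real_of_int (h x) - c\<bar> \<le> r} x" if "x \<in> carrier G" for x
        using that z(2) by (simp add: f_def h_mult h_pow indicator_def)
      then have "measure_pmf.expectation (walk n) (\<lambda>x. f i (x \<otimes> z [^] (i * s))) =
          measure_pmf.expectation (walk n) (indicator {x. \<bar>real_of_int (h x) - c\<bar> \<le> r})"
        using walk_carrier' by (intro expectation_cong_pmf) auto
      then have "measure_pmf.expectation (walk n) (\<lambda>x. f i (x \<otimes> z [^] (i * s))) = P"
        by (simp add: P_def)
      moreover have "measure_pmf.expectation (walk n) (\<lambda>x. f i (x \<otimes> \<one>)) = measure_pmf.expectation (walk n) (f i)"
        using walk_carrier' by (intro expectation_cong_pmf) simp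
      moreover have "shift_dist n (z [^] (i * s)) \<le> real (i * s) * q"
        unfolding q_def by (rule shift_pow)
      moreover have "real (i * s) * q \<le> real J * real s * q"
        using i q0 by (intro mult_right_mono) (simp_all add: mult_right_mono)
      ultimately show ?thesis
        using expectation_shift_le[of "f i" "z [^] (i * s)" \<one> n, OF fb] z(2) by simp
    qed
    have disj: "(\<Sum>i<J. f i x) \<le> 1" for x
    proof -
      let ?I = "{i. i < J \<and> \<bar>real_of_int (h x) - real (i * s) * real_of_int (h z) - c\<bar> \<le> r}"
      have "i = j" if "i \<in> ?I" "j \<in> ?I" for i j
      proof (rule ccontr)
        assume "i \<noteq> j"
        then have "1 \<le> \<bar>real i - real j\<bar>" by linarith
        then have "1 * real s * 1 \<le> \<bar>real i - real j\<bar> * real s * real_of_int (h z)"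
          using hz by (intro mult_mono) auto
        also have "\<dots> = \<bar>real (i * s) * real_of_int (h z) - real (j * s) * real_of_int (h z)\<bar>"
          using hz by (simp add: abs_mult left_diff_distrib[symmetric])
        also have "\<dots> \<le> 2 * r" using that by auto
        finally show False using s(1) by simp
      qed
      then have "card ?I \<le> 1"
        by (auto simp: card_le_Suc0_iff_eq)
      moreover have "(\<Sum>i<J. f i x) = real (card ?I)"
        by (simp add: f_def indicator_def of_bool_def sum.If_cases Int_def)
      ultimately show ?thesis by simp
    qed
    have int: "integrable (measure_pmf (walk n)) (f i)" for i
      by (rule integrable_pmf_bounded) (rule fb)
    have "real J * P = (\<Sum>i<J. P)" by simp
    also have "\<dots> \<le> (\<Sum>i<J. measure_pmf.expectation (walk n) (f i) + real J * real s * q)"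
      by (intro sum_mono P_le) simp
    also have "\<dots> = measure_pmf.expectation (walk n) (\<lambda>x. \<Sum>i<J. f i x) + real J * (real J * real s * q)"
      using int by (simp add: sum.distrib)
    also have "\<dots> \<le> 1 + real J * (real J * real s * q)"
      using int disj
        expectation_mono_pmf[of "walk n" "\<lambda>x. \<Sum>i<J. f i x" "\<lambda>_. 1"] by simp
    finally have "P \<le> 1 / real J + real J * real s * q"
      using J by (simp add: field_simps)
    also have "\<dots> \<le> 1 / real J + real J * (2 * r + 1) * q"
      using s(2) q0 by (intro add_left_mono mult_right_mono mult_left_mono) auto
    finally show ?thesis by (simp add: P_def q_def)
  qed
  with C(1) show ?thesis by blast
qed

lemma noise_distance_lower_bound:
  assumes "\<exists>g\<in>carrier G. h g \<noteq> 0"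
  shows "\<exists>C\<ge>0. \<forall>\<rho>\<in>{0<..1}. \<forall>n>0. \<forall>J::nat. 0 < J \<longrightarrow>
    1 - sqrt \<rho> * drift_var - 1 / real J - 2 * real J * C * sqrt (sqrt \<rho>) - real J * C / sqrt (real (Suc n))
      \<le> noise_distance G \<mu> \<rho> n"
proof -
  obtain C where C: "0 \<le> C" "\<And>n c r J. 0 \<le> r \<Longrightarrow> 0 < J \<Longrightarrow>
    measure (measure_pmf (walk n)) {x. \<bar>real_of_int (h x) - c\<bar> \<le> r} \<le>
      1 / real J + real J * (2 * r + 1) * C / sqrt (real (Suc n))"
    using walk_anticoncentration[OF assms] by blast
  have "1 - sqrt \<rho> * drift_var - 1 / real J - 2 * real J * C * sqrt (sqrt \<rho>) - real J * C / sqrt (real (Suc n))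
      \<le> noise_distance G \<mu> \<rho> n"
    if \<rho>: "\<rho> \<in> {0<..1}" and n: "0 < n" and J: "0 < J" for \<rho> n and J :: nat
  proof -
    \<comment> \<open>The geometric mean of the scale sqrt (\<rho> n) of the noised walk and the
      scale sqrt n of independent copies. The errors are then of order sqrt \<rho> by Chebyshev and
      \<rho>^(1/4) by spreading.\<close>
    define r where "r = sqrt (sqrt \<rho>) * sqrt (real n)"
    define A where "A = {z. \<bar>drift z\<bar> \<le> r}"
    have r: "0 < r" using \<rho> n by (simp add: r_def)
    have "r\<^sup>2 = sqrt \<rho> * real n" using \<rho> by (simp add: r_def power_mult_distrib)
    then have "real n * (\<rho> * drift_var) / r\<^sup>2 = \<rho> / sqrt \<rho> * drift_var" using n by simp
    also have "\<rho> / sqrt \<rho> = sqrt \<rho>" using \<rho> by (simp add: real_div_sqrt)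
    finally have var: "real n * (\<rho> * drift_var) / r\<^sup>2 = sqrt \<rho> * drift_var" .
    have upper: "1 - sqrt \<rho> * drift_var \<le> measure (measure_pmf (noised \<rho> n)) A"
      using noised_concentration[of \<rho> r n] \<rho> r unfolding var A_def by simp
    define B where "B = 1 / real J + real J * (2 * r + 1) * C / sqrt (real (Suc n))"
    have "measure (measure_pmf (walk2 n)) A = measure_pmf.expectation (walk2 n) (indicator A)" by simp
    also have "\<dots> = measure_pmf.expectation (walk n) (\<lambda>x. measure_pmf.expectation (walk n) (\<lambda>y. indicator A (x, y)))"
      by (rule expectation_pair_pmf) (rule integrable_pmf_bounded[where B = 1], simp add: indicator_def)
    \<comment> \<open>With the first coordinate fixed, the window is centred at \<open>h x\<close>;
      hence the estimate for one walk had to be uniform in the centre.\<close>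
    also have "\<dots> = measure_pmf.expectation (walk n) (\<lambda>x. measure (measure_pmf (walk n)) {y. \<bar>real_of_int (h y) - real_of_int (h x)\<bar> \<le> r})"
    proof (rule expectation_cong_pmf)
      fix x
      have "(\<lambda>y. indicat_real A (x, y)) = indicator {y. \<bar>real_of_int (h y) - real_of_int (h x)\<bar> \<le> r}"
        by (auto simp: A_def drift_def indicator_def abs_minus_commute)
      then show "measure_pmf.expectation (walk n) (\<lambda>y. indicator A (x, y)) =
          measure (measure_pmf (walk n)) {y. \<bar>real_of_int (h y) - real_of_int (h x)\<bar> \<le> r}"
        by simp
    qed
    also have "\<dots> \<le> measure_pmf.expectation (walk n) (\<lambda>_. B)"
      unfolding B_def
    proof (rule expectation_mono_pmf)
      show "integrable (measure_pmf (walk n))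
          (\<lambda>x. measure (measure_pmf (walk n)) {y. \<bar>real_of_int (h y) - real_of_int (h x)\<bar> \<le> r})"
        by (rule integrable_pmf_bounded[where B = 1]) simp
    qed (use C(2) r J in simp_all)
    finally have lower: "measure (measure_pmf (walk2 n)) A \<le> B" by simp
    have "r / sqrt (real (Suc n)) \<le> sqrt (sqrt \<rho>)"
      using \<rho> by (simp add: r_def divide_le_eq mult_left_mono)
    then have "(2 * real J * C) * (r / sqrt (real (Suc n))) \<le> (2 * real J * C) * sqrt (sqrt \<rho>)"
      using C(1) by (intro mult_left_mono) auto
    then have "B \<le> 1 / real J + (2 * real J * C) * sqrt (sqrt \<rho>) + real J * C / sqrt (real (Suc n))"
      by (simp add: B_def algebra_simps add_divide_distrib)
    with upper lower have "1 - sqrt \<rho> * drift_var - 1 / real J - 2 * real J * C * sqrt (sqrt \<rho>) - real J * C / sqrt (real (Suc n))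
      \<le> measure (measure_pmf (noised \<rho> n)) A - measure (measure_pmf (walk2 n)) A"
      by linarith
    also have "\<dots> \<le> noise_distance G \<mu> \<rho> n"
      unfolding noise_distance_def by (rule total_variation_ge)
    finally show ?thesis .
  qed
  with C(1) show ?thesis by blast
qed

section \<open>The limits at both ends of the noise range\<close>

lemma tendsto_liminf_noise_distance:
  assumes "\<exists>g\<in>carrier G. h g \<noteq> 0"
  shows "((\<lambda>\<rho>. liminf (\<lambda>n. ereal (noise_distance G \<mu> \<rho> n))) \<longlongrightarrow> 1) (at 0 within {0..1})"
proof (rule order_tendstoI)
  obtain C where C: "0 \<le> C" "\<And>\<rho> n J. \<rho> \<in> {0<..1} \<Longrightarrow> 0 < n \<Longrightarrow> 0 < J \<Longrightarrow>
    1 - sqrt \<rho> * drift_var - 1 / real J - 2 * real J * C * sqrt (sqrt \<rho>) - real J * C / sqrt (real (Suc n))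
      \<le> noise_distance G \<mu> \<rho> n"
    using noise_distance_lower_bound[OF assms] by blast
  fix a :: ereal
  assume "a < 1"
  then obtain b where b: "a < ereal b" "b < 1"
    using ereal_dense2[of a 1] by auto
  \<comment> \<open>The room 1 - b is split evenly among 1 / J, the terms in \<rho> and the term in
    \<open>n\<close>; \<open>J\<close> is fixed before \<rho>, and both before
    \<open>n\<close>.\<close>
  define d where "d = (1 - b) / 3"
  have d: "0 < d" "1 - 3 * d = b" using b(2) by (simp_all add: d_def field_simps)
  obtain J :: nat where J': "1 / d < real J" using reals_Archimedean2 by blast
  moreover have "0 < 1 / d" using d(1) by simp
  ultimately have "0 < real J" by linarith
  then have J: "0 < J" "1 / real J < d"
    using J' d(1) by (simp_all add: field_simps)
  have "((\<lambda>\<rho>. sqrt \<rho> * drift_var + 2 * real J * C * sqrt (sqrt \<rho>)) \<longlongrightarrow>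
      sqrt 0 * drift_var + 2 * real J * C * sqrt (sqrt 0)) (at 0 within {0..1})"
    by (intro tendsto_intros)
  then have "eventually (\<lambda>\<rho>. sqrt \<rho> * drift_var + 2 * real J * C * sqrt (sqrt \<rho>) < d) (at 0 within {0..1})"
    using d(1) by (intro order_tendstoD(2)[where y = "0::real"]) auto
  moreover have "eventually (\<lambda>\<rho>. \<rho> \<in> {0<..1::real}) (at 0 within {0..1})"
    by (auto simp: eventually_at_filter)
  ultimately show "eventually (\<lambda>\<rho>. a < liminf (\<lambda>n. ereal (noise_distance G \<mu> \<rho> n))) (at 0 within {0..1})"
  proof eventually_elim
    case (elim \<rho>)
    have "(\<lambda>n. real J * C / sqrt (real (Suc n))) \<longlonglongrightarrow> 0"
      by (rule real_tendsto_divide_at_top[OF tendsto_const])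
         (rule filterlim_compose[OF sqrt_at_top filterlim_compose[OF filterlim_real_sequentially filterlim_Suc]])
    then have "eventually (\<lambda>n. real J * C / sqrt (real (Suc n)) < d) sequentially"
      using d(1) by (rule order_tendstoD(2))
    then have "eventually (\<lambda>n. ereal b \<le> ereal (noise_distance G \<mu> \<rho> n)) sequentially"
      using eventually_gt_at_top[of 0]
    proof eventually_elim
      case (elim n)
      with C(2)[of \<rho> n J] J \<open>\<rho> \<in> {0<..1}\<close> \<open>sqrt \<rho> * drift_var + 2 * real J * C * sqrt (sqrt \<rho>) < d\<close> d(2)
      show ?case by simp
    qed
    then have "ereal b \<le> liminf (\<lambda>n. ereal (noise_distance G \<mu> \<rho> n))"
      by (rule Liminf_bounded)
    with b(1) show ?case by (rule less_le_trans)
  qed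
next
  fix a :: ereal
  assume a: "1 < a"
  have "liminf (\<lambda>n. ereal (noise_distance G \<mu> \<rho> n)) \<le> 1" for \<rho>
    by (rule Liminf_le) (auto simp: noise_distance_def total_variation_le_1)
  with a show "eventually (\<lambda>\<rho>. liminf (\<lambda>n. ereal (noise_distance G \<mu> \<rho> n)) < a) (at 0 within {0..1})"
    by (intro always_eventually allI) (rule le_less_trans)
qed

end

lemma tendsto_limsup_noise_distance:
  "((\<lambda>\<rho>. limsup (\<lambda>n. ereal (noise_distance G \<mu> \<rho> n))) \<longlongrightarrow> 0) (at 1 within {0..1})"
proof -
  obtain C where C: "0 \<le> C" "\<And>\<rho> n. \<rho> \<in> {0..1} \<Longrightarrow> (1 - \<rho>) * C \<le> 1 / 8 \<Longrightarrow>
      l1_dist (noised \<rho> n) (walk2 n) \<le> 4 * ((1 - \<rho>) * C)"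
    using l1_dist_noised by blast
  have lim: "((\<lambda>\<rho>. (1 - \<rho>) * C) \<longlongrightarrow> (1 - 1) * C) (at 1 within {0..1})"
    by (intro tendsto_intros)
  then have "eventually (\<lambda>\<rho>. (1 - \<rho>) * C < 1 / 8) (at 1 within {0..1})"
    by (rule order_tendstoD(2)) simp
  moreover have "eventually (\<lambda>\<rho>. \<rho> \<in> {0..1::real}) (at 1 within {0..1})"
    by (auto simp: eventually_at_filter)
  ultimately have upper: "eventually (\<lambda>\<rho>. limsup (\<lambda>n. ereal (noise_distance G \<mu> \<rho> n)) \<le> ereal (4 * ((1 - \<rho>) * C)))
      (at 1 within {0..1})"
  proof eventually_elim
    case (elim \<rho>)
    show ?case
    proof (intro Limsup_bounded always_eventually allI)
      fix n
      show "ereal (noise_distance G \<mu> \<rho> n) \<le> ereal (4 * ((1 - \<rho>) * C))"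
        unfolding noise_distance_def
        using order_trans[OF total_variation_le_l1_dist C(2)[of \<rho> n]] elim by simp
    qed
  qed
  have nonneg: "0 \<le> noise_distance G \<mu> \<rho> n" for \<rho> n
    unfolding noise_distance_def using total_variation_ge[of "noised \<rho> n" "{}" "walk2 n"] by simp
  have lower: "0 \<le> limsup (\<lambda>n. ereal (noise_distance G \<mu> \<rho> n))" for \<rho>
    by (rule le_Limsup) (auto simp: nonneg)
  have "((\<lambda>\<rho>. ereal (4 * ((1 - \<rho>) * C))) \<longlongrightarrow> ereal (4 * ((1 - 1) * C))) (at 1 within {0..1})"
    by (intro tendsto_intros)
  then have "((\<lambda>\<rho>. ereal (4 * ((1 - \<rho>) * C))) \<longlongrightarrow> 0) (at 1 within {0..1})"
    by (simp add: zero_ereal_def)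
  from tendsto_sandwich[OF _ upper tendsto_const this] lower show ?thesis
    by (simp add: always_eventually)
qed

end

section \<open>From the summability hypothesis to the theorem\<close>

lemma integrable_pmf_of_summable:
  fixes f :: "'a \<Rightarrow> real"
  assumes "set_pmf p \<subseteq> A" and "(\<lambda>x. f x * pmf p x) summable_on A"
  shows "integrable (measure_pmf p) f"
proof -
  have "(\<lambda>x. f x * pmf p x) summable_on A \<longleftrightarrow> (\<lambda>x. f x * pmf p x) summable_on UNIV"
    by (rule summable_on_cong_neutral) (use assms(1) in \<open>auto simp: set_pmf_iff\<close>)
  with assms(2) have "(\<lambda>x. f x * pmf p x) summable_on UNIV" by simp
  then have "Infinite_Set_Sum.abs_summable_on (\<lambda>x. f x * pmf p x) UNIV"
    by (simp only: summable_on_iff_abs_summable_on_real[of "\<lambda>x. f x * pmf p x"] flip: abs_summable_equivalent)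
  then have "integrable (count_space UNIV) (\<lambda>x. f x * pmf p x)"
    by (simp only: Infinite_Set_Sum.abs_summable_on_def)
  then show ?thesis
    unfolding measure_pmf_eq_density by (subst integrable_density) (auto simp: mult.commute)
qed

theorem theorem1p2:
  fixes G :: "('a, 'b) monoid_scheme" and \<mu> :: "'a pmf"
  assumes "group G"
    and "finitely_generated G"
    and "virtually_abelian G"
    and "set_pmf \<mu> \<subseteq> carrier G"
    and "finite_second_moment G \<mu>"
    and "semigroup_generate G (set_pmf \<mu>) = carrier G"
  shows "((\<lambda>\<rho>. limsup (\<lambda>n. ereal (noise_distance G \<mu> \<rho> n))) \<longlongrightarrow> 0) (at 1 within {0..1}) \<and>
         ((\<exists>h. h \<in> epi G integer_group) \<longrightarrow>
            ((\<lambda>\<rho>. liminf (\<lambda>n. ereal (noise_distance G \<mu> \<rho> n))) \<longlongrightarrow> 1) (at 0 within {0..1}) \<and>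
            \<not> noise_sensitive_TV G \<mu>)"
proof -
  obtain S where S: "finite_generating_set G S"
    "(\<lambda>g. (real (word_length G S g))\<^sup>2 * pmf \<mu> g) summable_on carrier G"
    using assms(5) unfolding finite_second_moment_def by blast
  interpret va_random_walk G \<mu> S
    by (intro va_random_walk.intro va_random_walk_axioms.intro assms S integrable_pmf_of_summable[OF assms(4)])
  have "((\<lambda>\<rho>. liminf (\<lambda>n. ereal (noise_distance G \<mu> \<rho> n))) \<longlongrightarrow> 1) (at 0 within {0..1}) \<and>
      \<not> noise_sensitive_TV G \<mu>" if "h \<in> epi G integer_group" for h
  proof
    from that have h: "h \<in> hom G integer_group" "h ` carrier G = UNIV"
      by (auto simp: epi_def)
    then have "1 \<in> h ` carrier G" by simp
    then obtain g where "g \<in> carrier G" "h g = 1" by (metis imageE)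
    then have "\<exists>g\<in>carrier G. h g \<noteq> 0" by (intro bexI[of _ g]) auto
    with h(1) show lim: "((\<lambda>\<rho>. liminf (\<lambda>n. ereal (noise_distance G \<mu> \<rho> n))) \<longlongrightarrow> 1) (at 0 within {0..1})"
      by (rule tendsto_liminf_noise_distance)
    show "\<not> noise_sensitive_TV G \<mu>"
    proof
      assume "noise_sensitive_TV G \<mu>"
      then have lim0: "(\<lambda>n. ereal (noise_distance G \<mu> \<rho> n)) \<longlonglongrightarrow> ereal 0" if "\<rho> \<in> {0<..1}" for \<rho>
        using that unfolding noise_sensitive_TV_def by (intro tendsto_intros) auto
      have "liminf (\<lambda>n. ereal (noise_distance G \<mu> \<rho> n)) = 0" if "\<rho> \<in> {0<..1}" for \<rho>
        using lim_imp_Liminf[OF sequentially_bot lim0[OF that]] by (simp add: zero_ereal_def)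
      \<comment> \<open>The punctured filter leaves out \<rho> = 0, about which noise sensitivity
        says nothing.\<close>
      then have "eventually (\<lambda>\<rho>. liminf (\<lambda>n. ereal (noise_distance G \<mu> \<rho> n)) = 0) (at 0 within {0..1})"
        by (auto simp: eventually_at_filter)
      then have "((\<lambda>\<rho>. liminf (\<lambda>n. ereal (noise_distance G \<mu> \<rho> n))) \<longlongrightarrow> 0) (at 0 within {0..1})"
        by (rule tendsto_eventually)
      moreover have "at (0::real) within {0..1} \<noteq> bot"
        by (simp add: at_within_Icc_at_right)
      ultimately have "(0::ereal) = 1"
        using lim by (intro tendsto_unique)
      then show False by simp
    qed
  qed
  with tendsto_limsup_noise_distance show ?thesis by blast
qed

end
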